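(* Let $U\subseteq M$ be open, let $f:U\to\mathbb C$ be an eigenfunction for the Laplace-Beltrami operator, let $l\in\mathbb C^\times$, and let $V_U(l,f)$ be the $V(l,\mathbf 1)$-module generated by $f$, with $\mathrm{wt}\,f=0$. Then the vector $f$ (the case $r=0$) together with the vectors $$h_{i_1}(-t_1)\cdots h_{i_k}(-t_k)h_{i_{k+1}}(0)\cdots h_{i_r}(0)f$$ with $r\ge1$, $1\le k\le r$, $t_1,\dots,t_k\in\mathbb{Z}_+$, $i_1,\dots,i_r\in\{+,-\}$ such that (a) $\#\{j\in[1,r]:i_j=+\}=\#\{j\in[1,r]:i_j=-\}$, and (b) for every $q=k+1,\dots,r$, $\#\{j\in[q,r]:i_j=+\}\ne\#\{j\in[q,r]:i_j=-\}$, forms a basis of $V_U(l,f)$.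
   Context: Geometry: $M$ is a two-dimensional, connected, complete, orientable Riemannian manifold of constant sectional curvature $K\neq0$; $E=\mathbb C\otimes_{\mathbb R}TM$ with complex-linearly extended Levi-Civita connection $\nabla$ and complex-bilinearly extended metric $(\cdot,\cdot)$. Fix $p\in M$, an orthonormal basis $e_1,e_2$ of $T_pM$, and $h_\pm=e_1\mp\sqrt{-1}e_2\in E_p$, so $(h_\pm,h_\pm)=0$, $(h_+,h_-)=2$. $\Pi(T(E))$ is the algebra of parallel sections of $T(E)=\bigoplus_kE^{\otimes k}$, identified by evaluation at $p$ with the subalgebra of the tensor algebra $T(E_p)$ spanned by the words $h_{i_1}\otimes\cdots\otimes h_{i_k}$ with as many $+$ as $-$. $X\in\Pi(E^{\otimes k})$ acts on $C^\infty(U)$ (complex valued) by $g\mapsto(\nabla^kg)(X)$, with $(\nabla^kg)(Z_1,\dots,Z_k)=(\nabla_{Z_1}(\nabla^{k-1}g))(Z_2,\dots,Z_k)$. An eigenfunction is a nonzero smooth $f$ with $-\Delta f=\lambda f$, $\lambda\in\mathbb C$. Modes: for a left $T(E_p)$-module $S$ put $F(S)=T(\widehat E_{p,-})\otimes S$, $\widehat E_{p,-}=E_p\otimes t^{-1}\mathbb C[t^{-1}]$. For $a\in E_p$: $a(-m)$ ($m>0$) is left multiplication by $a\otimes t^{-m}$; $a(0)$ acts as $1\otimes a$ through $S$; $a(m)$ ($m>0$) kills $1\otimes S$ and satisfies $a(m)b(-n)=b(-n)a(m)+m(a,b)\delta_{m,n}l$. Set $a(x)=\sum_na(n)x^{-n-1}$;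 normal ordering ${:}\ {:}$ places negative modes first, then positive modes, then zero modes, preserving relative order in each group. $V=V(l,\mathbf 1)$ has basis the words $v=h_{i_1}(-m_1)\cdots h_{i_s}(-m_s)\mathbf 1$ with $m_j\in\mathbb Z_+$ and as many $+$ as $-$; it acts on $F(S)$ by $Y(v,x)={:}\prod_{j=1}^s\frac1{(m_j-1)!}\frac{d^{m_j-1}}{dx^{m_j-1}}h_{i_j}(x){:}=\sum_nv_nx^{-n-1}$ (product in the order $j=1,\dots,s$). $V_U(l,f)$ is the span of all $v_n f$ ($v\in V$, $n\in\mathbb Z$) inside $F(S)$ with $S=T(E_p)\otimes_{\Pi(T(E))}C^\infty(U)$, where $f$ stands for $1\otimes(1\otimes f)$. *)

theory Defs
  imports "HOL-Analysis.Analysis" "HOL-Algebra.AbelCoset" "HOL-Algebra.Module"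
begin

section \<open>Riemannian surfaces in local coordinates\<close>

definition pd :: "2 \<Rightarrow> (real^2 \<Rightarrow> 'b::real_normed_vector) \<Rightarrow> real^2 \<Rightarrow> 'b" where
  "pd i F x = frechet_derivative F (at x) (axis i 1)"

primrec Ck_on :: "nat \<Rightarrow> (real^2) set \<Rightarrow> (real^2 \<Rightarrow> 'b::real_normed_vector) \<Rightarrow> bool" where
  "Ck_on 0 S F = continuous_on S F"
| "Ck_on (Suc n) S F = ((\<forall>x\<in>S. F differentiable (at x)) \<and> (\<forall>i. Ck_on n S (pd i F)))"

text \<open>Only used for open \<open>S\<close>.\<close>
definition smooth_on :: "(real^2) set \<Rightarrow> (real^2 \<Rightarrow> 'b::real_normed_vector) \<Rightarrow> bool" where
  "smooth_on S F \<longleftrightarrow> (\<forall>n. Ck_on n S F)"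

text \<open>A chart is a domain together with a coordinate map; the values of the coordinate map
  outside the domain are irrelevant.\<close>
type_synonym 'a chart = "'a set \<times> ('a \<Rightarrow> real^2)"

definition chart_inv :: "'a chart \<Rightarrow> real^2 \<Rightarrow> 'a" where
  "chart_inv c = inv_into (fst c) (snd c)"

definition chart_range :: "'a chart \<Rightarrow> (real^2) set" where
  "chart_range c = snd c ` fst c"

text \<open>\<open>jac c d q\<close> has the entry \<open>\<partial>y\<^sup>a/\<partial>x\<^sup>i\<close> in row \<open>a\<close> and column \<open>i\<close>, where \<open>x\<close> are the
  coordinates of \<open>c\<close> and \<open>y\<close> those of \<open>d\<close>.\<close>
definition jac :: "'a chart \<Rightarrow> 'a chart \<Rightarrow> 'a \<Rightarrow> real^2^2" where
  "jac c d q = matrix (frechet_derivative (snd d \<circ> chart_inv c) (at (snd c q)))"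

definition smooth_atlas :: "('a::topological_space) chart set \<Rightarrow> bool" where
  "smooth_atlas A \<longleftrightarrow>
     (\<Union>c\<in>A. fst c) = UNIV \<and>
     (\<forall>c\<in>A. open (fst c) \<and> open (chart_range c) \<and>
             homeomorphism (fst c) (chart_range c) (snd c) (chart_inv c)) \<and>
     (\<forall>c\<in>A. \<forall>d\<in>A. smooth_on (snd c ` (fst c \<inter> fst d)) (snd d \<circ> chart_inv c))"

text \<open>The manifold is the whole type \<open>'a\<close>. Tensors are given by their components in every chart of
  the atlas; \<open>metric R c q\<close> is the Gram matrix at \<open>q\<close> of the coordinate frame of \<open>c\<close>.\<close>
record 'a riem =
  atlas :: "'a chart set"
  metric :: "'a chart \<Rightarrow> 'a \<Rightarrow> real^2^2"

definition riemannian_surface ::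
    "('a::{t2_space,second_countable_topology}) riem \<Rightarrow> bool" where
  "riemannian_surface R \<longleftrightarrow>
     smooth_atlas (atlas R) \<and>
     (\<forall>c\<in>atlas R. \<forall>q\<in>fst c. transpose (metric R c q) = metric R c q \<and>
        (\<forall>v. v \<noteq> 0 \<longrightarrow> v \<bullet> (metric R c q *v v) > 0)) \<and>
     (\<forall>c\<in>atlas R. \<forall>i j. smooth_on (chart_range c) (\<lambda>x. metric R c (chart_inv c x) $ i $ j)) \<and>
     (\<forall>c\<in>atlas R. \<forall>d\<in>atlas R. \<forall>q\<in>fst c \<inter> fst d.
        metric R c q = transpose (jac c d q) ** metric R d q ** jac c d q)"

definition orientable :: "('a::topological_space) riem \<Rightarrow> bool" where
  "orientable R \<longleftrightarrow> (\<exists>B. smooth_atlas (atlas R \<union> B) \<and> (\<Union>c\<in>B. fst c) = UNIV \<and>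
     (\<forall>c\<in>B. \<forall>d\<in>B. \<forall>q\<in>fst c \<inter> fst d. det (jac c d q) > 0))"

text \<open>\<open>christoffel R c l i j\<close> is \<open>\<Gamma>\<^sup>l\<^bsub>ij\<^esub>\<close> of the Levi-Civita connection, as a function of the
  coordinates of \<open>c\<close>.\<close>
definition christoffel :: "'a riem \<Rightarrow> 'a chart \<Rightarrow> 2 \<Rightarrow> 2 \<Rightarrow> 2 \<Rightarrow> real^2 \<Rightarrow> real" where
  "christoffel R c l i j x =
     (let G = (\<lambda>a b y. metric R c (chart_inv c y) $ a $ b)
      in 1/2 * (\<Sum>m\<in>UNIV. matrix_inv (metric R c (chart_inv c x)) $ l $ m *
                  (pd i (G m j) x + pd j (G i m) x - pd m (G i j) x)))"

text \<open>\<open>R(\<partial>\<^sub>i,\<partial>\<^sub>j)\<partial>\<^sub>k = \<Sum>\<^sub>l curvature R c l k i j \<partial>\<^sub>l\<close>, with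
  \<open>R(X,Y)Z = \<nabla>\<^sub>X\<nabla>\<^sub>YZ - \<nabla>\<^sub>Y\<nabla>\<^sub>XZ - \<nabla>\<^bsub>[X,Y]\<^esub>Z\<close>.\<close>
definition curvature :: "'a riem \<Rightarrow> 'a chart \<Rightarrow> 2 \<Rightarrow> 2 \<Rightarrow> 2 \<Rightarrow> 2 \<Rightarrow> real^2 \<Rightarrow> real" where
  "curvature R c l k i j x =
     pd i (christoffel R c l j k) x - pd j (christoffel R c l i k) x +
     (\<Sum>m\<in>UNIV. christoffel R c l i m x * christoffel R c m j k x
              - christoffel R c l j m x * christoffel R c m i k x)"

text \<open>\<open>(R(\<partial>\<^sub>1,\<partial>\<^sub>2)\<partial>\<^sub>2,\<partial>\<^sub>1) / ((\<partial>\<^sub>1,\<partial>\<^sub>1)(\<partial>\<^sub>2,\<partial>\<^sub>2) - (\<partial>\<^sub>1,\<partial>\<^sub>2)\<^sup>2)\<close>\<close>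
definition sectional_curvature :: "'a riem \<Rightarrow> 'a chart \<Rightarrow> 'a \<Rightarrow> real" where
  "sectional_curvature R c q =
     (\<Sum>l\<in>UNIV. metric R c q $ l $ 1 * curvature R c l 2 1 2 (snd c q)) / det (metric R c q)"

definition constant_curvature :: "'a riem \<Rightarrow> real \<Rightarrow> bool" where
  "constant_curvature R K \<longleftrightarrow> (\<forall>c\<in>atlas R. \<forall>q\<in>fst c. sectional_curvature R c q = K)"

definition geodesic :: "('a::topological_space) riem \<Rightarrow> (real \<Rightarrow> 'a) \<Rightarrow> bool" where
  "geodesic R \<gamma> \<longleftrightarrow> continuous_on UNIV \<gamma> \<and>
     (\<forall>c\<in>atlas R. \<forall>t. \<gamma> t \<in> fst c \<longrightarrow>
        (let x = snd c \<circ> \<gamma>; x' = (\<lambda>s. vector_derivative x (at s))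
         in x differentiable (at t) \<and>
            (x' has_vector_derivative
               (\<chi> l. - (\<Sum>i\<in>UNIV. \<Sum>j\<in>UNIV. christoffel R c l i j (x t) * x' t $ i * x' t $ j)))
              (at t)))"

definition geodesically_complete :: "('a::topological_space) riem \<Rightarrow> bool" where
  "geodesically_complete R \<longleftrightarrow> (\<forall>c\<in>atlas R. \<forall>q\<in>fst c. \<forall>v.
     \<exists>\<gamma>. geodesic R \<gamma> \<and> \<gamma> 0 = q \<and> ((snd c \<circ> \<gamma>) has_vector_derivative v) (at 0))"


section \<open>Functions, covariant derivatives and parallel tensors\<close>

text \<open>Functions on \<open>U\<close> are extended by \<open>0\<close> outside \<open>U\<close>.\<close>
definition smooth_functions :: "'a riem \<Rightarrow> 'a set \<Rightarrow> ('a \<Rightarrow> complex) set" where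
  "smooth_functions R U = {g. (\<forall>q. q \<notin> U \<longrightarrow> g q = 0) \<and>
     (\<forall>c\<in>atlas R. smooth_on (snd c ` (fst c \<inter> U)) (g \<circ> chart_inv c))}"

text \<open>\<open>cov R c G [i\<^sub>1,\<dots>,i\<^sub>k]\<close> is the component \<open>(\<nabla>\<^sup>k g)(\<partial>\<^bsub>i\<^sub>1\<^esub>,\<dots>,\<partial>\<^bsub>i\<^sub>k\<^esub>)\<close> in the chart \<open>c\<close>, where
  \<open>G\<close> is \<open>g\<close> in coordinates; the newest derivative occupies the first slot.\<close>
fun cov :: "'a riem \<Rightarrow> 'a chart \<Rightarrow> (real^2 \<Rightarrow> complex) \<Rightarrow> 2 list \<Rightarrow> real^2 \<Rightarrow> complex" where
  "cov R c G [] = G"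
| "cov R c G (i # I) = (\<lambda>x. pd i (cov R c G I) x -
     (\<Sum>m<length I. \<Sum>l\<in>UNIV. of_real (christoffel R c l i (I ! m) x) * cov R c G (I[m := l]) x))"

text \<open>The trace of the Hessian.\<close>
definition laplacian :: "'a riem \<Rightarrow> 'a chart \<Rightarrow> ('a \<Rightarrow> complex) \<Rightarrow> 'a \<Rightarrow> complex" where
  "laplacian R c g q = (\<Sum>i\<in>UNIV. \<Sum>j\<in>UNIV.
     of_real (matrix_inv (metric R c q) $ i $ j) * cov R c (g \<circ> chart_inv c) [i, j] (snd c q))"

definition eigenfunction :: "'a riem \<Rightarrow> 'a set \<Rightarrow> ('a \<Rightarrow> complex) \<Rightarrow> bool" where
  "eigenfunction R U f \<longleftrightarrow> f \<in> smooth_functions R U \<and> (\<exists>q\<in>U. f q \<noteq> 0) \<and>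
     (\<exists>ev::complex. \<forall>c\<in>atlas R. \<forall>q\<in>fst c \<inter> U. - laplacian R c f q = ev * f q)"

text \<open>A smooth section of \<open>T(E) = \<Oplus>\<^sub>k E\<^sup>\<otimes>\<^sup>k\<close>: \<open>X c q [i\<^sub>1,\<dots>,i\<^sub>k]\<close> is the coefficient of
  \<open>\<partial>\<^bsub>i\<^sub>1\<^esub> \<otimes> \<dots> \<otimes> \<partial>\<^bsub>i\<^sub>k\<^esub>\<close> at \<open>q\<close> in the chart \<open>c\<close>.\<close>
type_synonym 'a tensor_field = "'a chart \<Rightarrow> 'a \<Rightarrow> 2 list \<Rightarrow> complex"

definition tensor_section :: "'a riem \<Rightarrow> 'a tensor_field \<Rightarrow> bool" where
  "tensor_section R X \<longleftrightarrow>
     (\<exists>N. \<forall>c\<in>atlas R. \<forall>q\<in>fst c. \<forall>I. N < length I \<longrightarrow> X c q I = 0) \<and>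
     (\<forall>c\<in>atlas R. \<forall>I. smooth_on (chart_range c) (\<lambda>x. X c (chart_inv c x) I)) \<and>
     (\<forall>c\<in>atlas R. \<forall>d\<in>atlas R. \<forall>q\<in>fst c \<inter> fst d. \<forall>J.
        X d q J = (\<Sum>I | length I = length J.
          (\<Prod>m<length J. of_real (jac c d q $ (J ! m) $ (I ! m))) * X c q I))"

text \<open>The parallel sections \<open>\<Pi>(T(E))\<close>.\<close>
definition parallel_sections :: "'a riem \<Rightarrow> 'a tensor_field set" where
  "parallel_sections R = {X. tensor_section R X \<and>
     (\<forall>c\<in>atlas R. \<forall>x\<in>chart_range c. \<forall>i J.
        pd i (\<lambda>y. X c (chart_inv c y) J) x +
        (\<Sum>m<length J. \<Sum>l\<in>UNIV. of_real (christoffel R c (J ! m) i l x) *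
            X c (chart_inv c x) (J[m := l])) = 0)}"

text \<open>The action \<open>g \<mapsto> \<Sum>\<^sub>k (\<nabla>\<^sup>k g)(X\<^sub>k)\<close> on functions on \<open>U\<close>; the contraction does not depend on
  the chart used to compute it.\<close>
definition par_act :: "'a riem \<Rightarrow> 'a set \<Rightarrow> 'a tensor_field \<Rightarrow> ('a \<Rightarrow> complex) \<Rightarrow> 'a \<Rightarrow> complex" where
  "par_act R U X g q =
     (if q \<in> U then
        let c = (SOME c. c \<in> atlas R \<and> q \<in> fst c)
        in \<Sum>I | X c q I \<noteq> 0. X c q I * cov R c (g \<circ> chart_inv c) I (snd c q)
      else 0)"


section \<open>The tensor algebra at a point\<close>

text \<open>Tangent vectors at \<open>p\<close> are given by their components in a chart \<open>c\<close> around \<open>p\<close>.\<close>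
definition orthonormal_basis :: "'a riem \<Rightarrow> 'a chart \<Rightarrow> 'a \<Rightarrow> real^2 \<Rightarrow> real^2 \<Rightarrow> bool" where
  "orthonormal_basis R c p e1 e2 \<longleftrightarrow>
     e1 \<bullet> (metric R c p *v e1) = 1 \<and> e2 \<bullet> (metric R c p *v e2) = 1 \<and>
     e1 \<bullet> (metric R c p *v e2) = 0"

definition bilinear_metric :: "'a riem \<Rightarrow> 'a chart \<Rightarrow> 'a \<Rightarrow> complex^2 \<Rightarrow> complex^2 \<Rightarrow> complex" where
  "bilinear_metric R c p v w =
     (\<Sum>i\<in>UNIV. \<Sum>j\<in>UNIV. of_real (metric R c p $ i $ j) * v $ i * w $ j)"

datatype sign = Plus | Minus

definition hvec :: "real^2 \<Rightarrow> real^2 \<Rightarrow> sign \<Rightarrow> complex^2" where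
  "hvec e1 e2 s = (case s of
      Plus \<Rightarrow> (\<chi> a. of_real (e1 $ a) - \<i> * of_real (e2 $ a))
    | Minus \<Rightarrow> (\<chi> a. of_real (e1 $ a) + \<i> * of_real (e2 $ a)))"

text \<open>\<open>T(E\<^sub>p)\<close> is the free algebra on the basis \<open>h\<^sub>+\<close>, \<open>h\<^sub>-\<close> of \<open>E\<^sub>p\<close>: an element is the finitely
  supported function giving the coefficient of each word \<open>h\<^bsub>i\<^sub>1\<^esub> \<otimes> \<dots> \<otimes> h\<^bsub>i\<^sub>k\<^esub>\<close>.\<close>
type_synonym tensor = "sign list \<Rightarrow> complex"

definition tensors :: "tensor set" where
  "tensors = {a. finite {w. a w \<noteq> 0}}"

definition tensor_mult :: "tensor \<Rightarrow> tensor \<Rightarrow> tensor" where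
  "tensor_mult a b w = (\<Sum>j\<le>length w. a (take j w) * b (drop j w))"

text \<open>The value at \<open>p\<close> of the section \<open>X\<close> is the element \<open>b\<close> of \<open>T(E\<^sub>p)\<close>: its coordinate
  components are those of the corresponding combination of words in \<open>h\<^sub>+\<close>, \<open>h\<^sub>-\<close>.\<close>
definition value_at ::
    "'a chart \<Rightarrow> 'a \<Rightarrow> (sign \<Rightarrow> complex^2) \<Rightarrow> 'a tensor_field \<Rightarrow> tensor \<Rightarrow> bool" where
  "value_at c p h X b \<longleftrightarrow> b \<in> tensors \<and>
     (\<forall>I. X c p I = (\<Sum>w | length w = length I. b w * (\<Prod>m<length I. h (w ! m) $ (I ! m))))"


section \<open>Complex vector spaces, spans, bases and quotients\<close>

text \<open>Complex vector spaces with explicit carrier are \<open>module\<close> records of HOL-Algebra with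
  scalar type \<^typ>\<open>complex\<close>; the multiplicative fields of the record play no role.\<close>
definition vspace :: "'v set \<Rightarrow> 'v \<Rightarrow> ('v \<Rightarrow> 'v \<Rightarrow> 'v) \<Rightarrow> (complex \<Rightarrow> 'v \<Rightarrow> 'v) \<Rightarrow> (complex, 'v) module"
  where "vspace C z pl sc =
    \<lparr>carrier = C, monoid.mult = undefined, one = undefined, zero = z, add = pl, smult = sc\<rparr>"

definition lin_span :: "(complex, 'v) module \<Rightarrow> 'v set \<Rightarrow> 'v set" where
  "lin_span M A = {finsum M (\<lambda>x. k x \<odot>\<^bsub>M\<^esub> x) F | k F. finite F \<and> F \<subseteq> A}"

text \<open>The family \<open>(b i)\<^bsub>i \<in> I\<^esub>\<close> is a basis of the subspace \<open>W\<close> of \<open>M\<close>.\<close>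
definition lin_basis :: "(complex, 'v) module \<Rightarrow> 'i set \<Rightarrow> ('i \<Rightarrow> 'v) \<Rightarrow> 'v set \<Rightarrow> bool" where
  "lin_basis M I b W \<longleftrightarrow> b ` I \<subseteq> carrier M \<and> lin_span M (b ` I) = W \<and>
     (\<forall>F k. finite F \<and> F \<subseteq> I \<and> finsum M (\<lambda>i. k i \<odot>\<^bsub>M\<^esub> b i) F = \<zero>\<^bsub>M\<^esub> \<longrightarrow> (\<forall>i\<in>F. k i = 0))"

definition quotient_space :: "(complex, 'v) module \<Rightarrow> 'v set \<Rightarrow> (complex, 'v set) module" where
  "quotient_space M N = vspace (a_rcosets\<^bsub>M\<^esub> N) N (set_add M)
     (\<lambda>k A. \<Union>x\<in>A. N +>\<^bsub>M\<^esub> (k \<odot>\<^bsub>M\<^esub> x))"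

definition quotient_map :: "(complex, 'v) module \<Rightarrow> 'v set \<Rightarrow> ('v \<Rightarrow> 'v) \<Rightarrow> 'v set \<Rightarrow> 'v set" where
  "quotient_map M N T A = (\<Union>x\<in>A. N +>\<^bsub>M\<^esub> T x)"


section \<open>The module \<open>S = T(E\<^sub>p) \<otimes>\<^bsub>\<Pi>(T(E))\<^esub> C\<^sup>\<infinity>(U)\<close>\<close>

text \<open>\<open>T(E\<^sub>p) \<otimes>\<^bsub>\<complex>\<^esub> C\<^sup>\<infinity>(U)\<close>: the function \<open>u\<close> stands for \<open>\<Sum>\<^sub>w w \<otimes> u w\<close>.\<close>
definition tensor_functions ::
    "'a riem \<Rightarrow> 'a set \<Rightarrow> (complex, sign list \<Rightarrow> 'a \<Rightarrow> complex) module" where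
  "tensor_functions R U = vspace
     {u. finite {w. u w \<noteq> (\<lambda>q. 0)} \<and> (\<forall>w. u w \<in> smooth_functions R U)}
     (\<lambda>w q. 0) (\<lambda>u v w q. u w q + v w q) (\<lambda>k u w q. k * u w q)"

definition pure_tensor :: "tensor \<Rightarrow> ('a \<Rightarrow> complex) \<Rightarrow> sign list \<Rightarrow> 'a \<Rightarrow> complex" where
  "pure_tensor a g w q = a w * g q"

text \<open>The span of all \<open>aX \<otimes> g - a \<otimes> Xg\<close>.\<close>
definition balancing ::
    "'a riem \<Rightarrow> 'a chart \<Rightarrow> 'a \<Rightarrow> (sign \<Rightarrow> complex^2) \<Rightarrow> 'a set \<Rightarrow> (sign list \<Rightarrow> 'a \<Rightarrow> complex) set" where
  "balancing R c p h U = lin_span (tensor_functions R U)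
     {(\<lambda>w q. pure_tensor (tensor_mult a b) g w q - pure_tensor a (par_act R U X g) w q)
       | a b X g. a \<in> tensors \<and> X \<in> parallel_sections R \<and> value_at c p h X b \<and>
                  g \<in> smooth_functions R U}"

definition S_space ::
    "'a riem \<Rightarrow> 'a chart \<Rightarrow> 'a \<Rightarrow> (sign \<Rightarrow> complex^2) \<Rightarrow> 'a set \<Rightarrow>
      (complex, (sign list \<Rightarrow> 'a \<Rightarrow> complex) set) module" where
  "S_space R c p h U = quotient_space (tensor_functions R U) (balancing R c p h U)"

text \<open>Left multiplication by \<open>h\<^sub>i\<close>.\<close>
definition left_mult :: "sign \<Rightarrow> (sign list \<Rightarrow> 'a \<Rightarrow> complex) \<Rightarrow> sign list \<Rightarrow> 'a \<Rightarrow> complex" where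
  "left_mult i u w = (case w of [] \<Rightarrow> (\<lambda>q. 0) | j # w' \<Rightarrow> if j = i then u w' else (\<lambda>q. 0))"

definition S_act ::
    "'a riem \<Rightarrow> 'a chart \<Rightarrow> 'a \<Rightarrow> (sign \<Rightarrow> complex^2) \<Rightarrow> 'a set \<Rightarrow> sign \<Rightarrow>
      (sign list \<Rightarrow> 'a \<Rightarrow> complex) set \<Rightarrow> (sign list \<Rightarrow> 'a \<Rightarrow> complex) set" where
  "S_act R c p h U i = quotient_map (tensor_functions R U) (balancing R c p h U) (left_mult i)"

text \<open>\<open>1 \<otimes> f\<close>\<close>
definition S_vec ::
    "'a riem \<Rightarrow> 'a chart \<Rightarrow> 'a \<Rightarrow> (sign \<Rightarrow> complex^2) \<Rightarrow> 'a set \<Rightarrow> ('a \<Rightarrow> complex) \<Rightarrow>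
      (sign list \<Rightarrow> 'a \<Rightarrow> complex) set" where
  "S_vec R c p h U f = balancing R c p h U +>\<^bsub>tensor_functions R U\<^esub>
     pure_tensor (\<lambda>w. if w = [] then 1 else 0) f"


section \<open>Modes on \<open>F(S)\<close>\<close>

text \<open>The letter \<open>(i, m)\<close>, \<open>m > 0\<close>, stands for \<open>h\<^sub>i \<otimes> t\<^sup>-\<^sup>m\<close>; these letters form a basis of
  \<open>E\<^sub>p \<otimes> t\<^sup>-\<^sup>1\<complex>[t\<^sup>-\<^sup>1]\<close>.\<close>
type_synonym mode_word = "(sign \<times> nat) list"

definition mode_words :: "mode_word set" where
  "mode_words = {w. \<forall>(i, m)\<in>set w. 0 < m}"

text \<open>The function \<open>u\<close> stands for \<open>\<Sum>\<^sub>w w \<otimes> u w\<close>.\<close>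
definition F_space :: "(complex, 's) module \<Rightarrow> (complex, mode_word \<Rightarrow> 's) module" where
  "F_space S = vspace
     {u. (\<forall>w. u w \<in> carrier S) \<and> finite {w. u w \<noteq> \<zero>\<^bsub>S\<^esub>} \<and> {w. u w \<noteq> \<zero>\<^bsub>S\<^esub>} \<subseteq> mode_words}
     (\<lambda>w. \<zero>\<^bsub>S\<^esub>) (\<lambda>u v w. u w \<oplus>\<^bsub>S\<^esub> v w) (\<lambda>k u w. k \<odot>\<^bsub>S\<^esub> u w)"

definition F_vec :: "(complex, 's) module \<Rightarrow> 's \<Rightarrow> mode_word \<Rightarrow> 's" where
  "F_vec S s w = (if w = [] then s else \<zero>\<^bsub>S\<^esub>)"

definition neg_mode :: "(complex, 's) module \<Rightarrow> sign \<Rightarrow> nat \<Rightarrow> (mode_word \<Rightarrow> 's) \<Rightarrow> mode_word \<Rightarrow> 's" where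
  "neg_mode S i m u w = (case w of [] \<Rightarrow> \<zero>\<^bsub>S\<^esub> | x # w' \<Rightarrow> if x = (i, m) then u w' else \<zero>\<^bsub>S\<^esub>)"

definition zero_mode :: "(sign \<Rightarrow> 's \<Rightarrow> 's) \<Rightarrow> sign \<Rightarrow> (mode_word \<Rightarrow> 's) \<Rightarrow> mode_word \<Rightarrow> 's" where
  "zero_mode act i u w = act i (u w)"

text \<open>\<open>pos_mode S B l i m w u\<close> is the coefficient of \<open>w\<close> in \<open>h\<^sub>i(m)u\<close> for \<open>m > 0\<close>, where
  \<open>B i j = (h\<^sub>i, h\<^sub>j)\<close>. Writing \<open>u = 1 \<otimes> s + \<Sum>\<^sub>y y\<cdot>u\<^sub>y\<close>, \<open>y = (j, n)\<close>, it is read off from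
  \<open>h\<^sub>i(m)(y\<cdot>u\<^sub>y) = y\<cdot>h\<^sub>i(m)u\<^sub>y + m (h\<^sub>i, h\<^sub>j) \<delta>\<^bsub>m,n\<^esub> l u\<^sub>y\<close> and \<open>h\<^sub>i(m)(1 \<otimes> s) = 0\<close>.\<close>
primrec pos_mode ::
    "(complex, 's) module \<Rightarrow> (sign \<Rightarrow> sign \<Rightarrow> complex) \<Rightarrow> complex \<Rightarrow> sign \<Rightarrow> nat \<Rightarrow>
      mode_word \<Rightarrow> (mode_word \<Rightarrow> 's) \<Rightarrow> 's" where
  "pos_mode S B l i m [] u =
     finsum S (\<lambda>j. (of_nat m * B i j * l) \<odot>\<^bsub>S\<^esub> u [(j, m)]) {Plus, Minus}"
| "pos_mode S B l i m (x # w) u =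
     pos_mode S B l i m w (\<lambda>v. u (x # v)) \<oplus>\<^bsub>S\<^esub>
     finsum S (\<lambda>j. (of_nat m * B i j * l) \<odot>\<^bsub>S\<^esub> u ((j, m) # x # w)) {Plus, Minus}"

definition mode ::
    "(complex, 's) module \<Rightarrow> (sign \<Rightarrow> 's \<Rightarrow> 's) \<Rightarrow> (sign \<Rightarrow> sign \<Rightarrow> complex) \<Rightarrow> complex \<Rightarrow>
      sign \<times> int \<Rightarrow> (mode_word \<Rightarrow> 's) \<Rightarrow> mode_word \<Rightarrow> 's" where
  "mode S act B l x u =
     (let i = fst x; n = snd x in
      if n < 0 then neg_mode S i (nat (- n)) u
      else if n = 0 then zero_mode act i u
      else (\<lambda>w. pos_mode S B l i (nat n) w u))"

definition apply_modes ::
    "(complex, 's) module \<Rightarrow> (sign \<Rightarrow> 's \<Rightarrow> 's) \<Rightarrow> (sign \<Rightarrow> sign \<Rightarrow> complex) \<Rightarrow> complex \<Rightarrow>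
      (sign \<times> int) list \<Rightarrow> (mode_word \<Rightarrow> 's) \<Rightarrow> mode_word \<Rightarrow> 's" where
  "apply_modes S act B l xs u = foldr (mode S act B l) xs u"

definition normal_order :: "(sign \<times> int) list \<Rightarrow> (sign \<times> int) list" where
  "normal_order xs = filter (\<lambda>x. snd x < 0) xs @ filter (\<lambda>x. snd x > 0) xs @ filter (\<lambda>x. snd x = 0) xs"


section \<open>The vertex algebra \<open>V(l,1)\<close> and the submodule generated by \<open>f\<close>\<close>

definition balanced :: "sign list \<Rightarrow> bool" where
  "balanced w \<longleftrightarrow> count_list w Plus = count_list w Minus"

definition V_elements :: "(mode_word \<Rightarrow> complex) set" where
  "V_elements = {v. finite {w. v w \<noteq> 0} \<and>
     {w. v w \<noteq> 0} \<subseteq> {w \<in> mode_words. balanced (map fst w)}}"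

text \<open>The operator \<open>v\<^sub>n\<close> for \<open>v = h\<^bsub>i\<^sub>1\<^esub>(-m\<^sub>1)\<dots>h\<^bsub>i\<^sub>s\<^esub>(-m\<^sub>s)1\<close>. The coefficient of \<open>h(\<nu>)\<close> in
  \<open>1/(m-1)! (d/dx)\<^sup>m\<^sup>-\<^sup>1 h(x)\<close> is \<open>(-\<nu>-1 choose m-1) x\<^sup>-\<^sup>\<nu>\<^sup>-\<^sup>m\<close>, so the power \<open>x\<^sup>-\<^sup>n\<^sup>-\<^sup>1\<close> in the product
  collects the mode numbers with \<open>\<Sum>(\<nu>\<^sub>j + m\<^sub>j) = n + 1\<close>. On a given \<open>u\<close> only finitely many terms
  do not vanish, and the sum is taken over those.\<close>
definition word_vertex_mode ::
    "(complex, 's) module \<Rightarrow> (sign \<Rightarrow> 's \<Rightarrow> 's) \<Rightarrow> (sign \<Rightarrow> sign \<Rightarrow> complex) \<Rightarrow> complex \<Rightarrow>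
      mode_word \<Rightarrow> int \<Rightarrow> (mode_word \<Rightarrow> 's) \<Rightarrow> mode_word \<Rightarrow> 's" where
  "word_vertex_mode S act B l v n u =
     (let term = (\<lambda>\<nu>. (\<Prod>j<length v. (of_int (- (\<nu> ! j) - 1) :: complex) gchoose (snd (v ! j) - 1))
                    \<odot>\<^bsub>F_space S\<^esub> apply_modes S act B l (normal_order (zip (map fst v) \<nu>)) u)
      in finsum (F_space S) term
           {\<nu>. length \<nu> = length v \<and> (\<Sum>j<length v. \<nu> ! j + int (snd (v ! j))) = n + 1 \<and>
               term \<nu> \<noteq> \<zero>\<^bsub>F_space S\<^esub>})"

definition vertex_mode ::
    "(complex, 's) module \<Rightarrow> (sign \<Rightarrow> 's \<Rightarrow> 's) \<Rightarrow> (sign \<Rightarrow> sign \<Rightarrow> complex) \<Rightarrow> complex \<Rightarrow>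
      (mode_word \<Rightarrow> complex) \<Rightarrow> int \<Rightarrow> (mode_word \<Rightarrow> 's) \<Rightarrow> mode_word \<Rightarrow> 's" where
  "vertex_mode S act B l v n u =
     finsum (F_space S) (\<lambda>w. v w \<odot>\<^bsub>F_space S\<^esub> word_vertex_mode S act B l w n u) {w. v w \<noteq> 0}"

definition generated_module ::
    "(complex, 's) module \<Rightarrow> (sign \<Rightarrow> 's \<Rightarrow> 's) \<Rightarrow> (sign \<Rightarrow> sign \<Rightarrow> complex) \<Rightarrow> complex \<Rightarrow>
      (mode_word \<Rightarrow> 's) \<Rightarrow> (mode_word \<Rightarrow> 's) set" where
  "generated_module S act B l u =
     lin_span (F_space S) {vertex_mode S act B l v n u | v n. v \<in> V_elements}"

text \<open>The pair \<open>([t\<^sub>1,\<dots>,t\<^sub>k], [i\<^sub>1,\<dots>,i\<^sub>r])\<close> indexes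
  \<open>h\<^bsub>i\<^sub>1\<^esub>(-t\<^sub>1)\<dots>h\<^bsub>i\<^sub>k\<^esub>(-t\<^sub>k)h\<^bsub>i\<^sub>k\<^sub>+\<^sub>1\<^esub>(0)\<dots>h\<^bsub>i\<^sub>r\<^esub>(0)f\<close>, and \<open>([], [])\<close> indexes \<open>f\<close>.\<close>
definition basis_indices :: "(nat list \<times> sign list) set" where
  "basis_indices = insert ([], [])
     {(t, i). 1 \<le> length t \<and> length t \<le> length i \<and> (\<forall>m\<in>set t. 0 < m) \<and> balanced i \<and>
              (\<forall>q\<in>{length t + 1..length i}. \<not> balanced (drop (q - 1) i))}"

definition basis_modes :: "nat list \<times> sign list \<Rightarrow> (sign \<times> int) list" where
  "basis_modes x = (let t = fst x; i = snd x in
     zip i (map (\<lambda>m. - int m) t @ replicate (length i - length t) 0))"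

end

theory Submission
  imports Defs
begin

text \<open>
  In an oriented orthonormal frame \<open>h\<^sub>\<plusminus> = e\<^sub>1 \<mp> i e\<^sub>2\<close> the Levi-Civita connection is a single 1-form:
  \<open>\<nabla>h\<^sub>\<plusminus> = \<plusminus>\<omega> h\<^sub>\<plusminus>\<close>. Hence the components \<open>(\<nabla>\<^sup>k g)(h\<^sub>w)\<close> are obtained letter by letter, a letter \<open>h\<^sub>s\<close> acting on a
  component of charge \<open>n\<close> (number of \<open>+\<close> minus number of \<open>-\<close>) as \<open>h\<^sub>s - n \<omega>(h\<^sub>s)\<close>; if \<open>v\<close> is balanced, the
  word \<open>w v\<close> acts as \<open>w\<close> after \<open>v\<close>. The same frame turns the equation of a parallel tensor into
  \<open>d\<xi>\<^sub>w = - charge(w) \<omega> \<xi>\<^sub>w\<close>. As \<open>d\<omega>\<close> is the curvature, which does not vanish, the parallel tensors are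
  the constant combinations of balanced words. Two letters of opposite sign commute up to \<open>2K\<close> times
  the charge to their right, so a balanced word acts on an eigenfunction by a scalar.

  Every word is uniquely \<open>w = v b\<close> with \<open>b\<close> balanced and \<open>v\<close> without nonempty balanced suffix, so
  \<open>T(E\<^sub>p)\<close> is free over \<open>\<Pi>(T(E))\<close> on these \<open>v\<close>; the vectors \<open>v \<otimes> f\<close> are separated by the functionals
  \<open>v b \<otimes> g \<mapsto> (b g)(q)\<close> with \<open>f(q) \<noteq> 0\<close>. Positive modes kill \<open>f\<close>, so \<open>v\<^sub>n f\<close> is a combination of
  products of negative modes followed by zero modes, with coefficients that are polynomial in the mode
  numbers; varying \<open>v\<close> over all weights interpolates each single product.
\<close>

section \<open>Calculus of smooth functions on the plane\<close>

text \<open>Only an orientation tells the two null directions apart consistently, but the charts of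
  \<open>R\<close> need be neither oriented nor connected. So the orientation is carried as a
  locally constant sign of each chart at each point; Gram-Schmidt with this sign gives null frames
  that differ on overlaps by a rotation (u, 1/u). Balanced components do not see u. This makes them
  comparable between charts, and it links the point \<open>p\<close>, where \<open>T(E_p)\<close>
  lives, to the points of \<open>U\<close>, to which \<open>p\<close> need not belong.

  No basis of the smooth functions on \<open>U\<close> over the parallel sections is available, so
  independence is not read off from a basis of the tensor product: each separating functional is a
  value at one point, and it respects the balancing relations because appending a balanced word
  cannot complete a reduced prefix.

  In the interpolation the mode number 0 is the delicate one. At positive numbers the binomial
  coefficients form a triangular matrix; one more of them, which vanishes there and is a sign at 0,
  supplies the missing condition.\<close>

lemma pd_eqI: "(F has_derivative D) (at x) \<Longrightarrow> pd i F x = D (axis i 1)"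
  by (metis frechet_derivative_at pd_def)

lemma has_derivative_cong_open:
  assumes "open S" "x \<in> S" "\<And>y. y \<in> S \<Longrightarrow> F y = G y"
  shows "(F has_derivative D) (at x) \<longleftrightarrow> (G has_derivative D) (at x)"
  using has_derivative_transform_within_open[OF _ assms(1,2), of F D UNIV G]
    has_derivative_transform_within_open[OF _ assms(1,2), of G D UNIV F] assms(3) by auto

text \<open>No differentiability is assumed: \<open>frechet_derivative\<close> is a choice among all
  derivatives, and locally equal functions have the same ones.\<close>

lemma pd_cong:
  assumes "open S" "x \<in> S" "\<And>y. y \<in> S \<Longrightarrow> F y = G y"
  shows "pd i F x = pd i G x"
proof -
  have "(F has_derivative D) (at x) \<longleftrightarrow> (G has_derivative D) (at x)" for D
    using assms by (intro has_derivative_cong_open) auto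
  then show ?thesis unfolding pd_def frechet_derivative_def by simp
qed

lemma differentiable_cong_open:
  assumes "open S" "x \<in> S" "\<And>y. y \<in> S \<Longrightarrow> F y = G y" "F differentiable (at x)"
  shows "G differentiable (at x)"
proof -
  have "(F has_derivative D) (at x) \<longleftrightarrow> (G has_derivative D) (at x)" for D
    using assms(1-3) by (intro has_derivative_cong_open) auto
  then show ?thesis using assms(4) unfolding differentiable_def by blast
qed

lemma Ck_on_cong:
  assumes "open S"
  shows "Ck_on n S F \<Longrightarrow> (\<And>y. y \<in> S \<Longrightarrow> F y = G y) \<Longrightarrow> Ck_on n S G"
proof (induction n arbitrary: F G)
  case 0
  then show ?case using continuous_on_cong[of S S F G] by simp
next
  case (Suc n)
  have "Ck_on n S (pd i G)" for i
  proof (rule Suc.IH)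
    show "Ck_on n S (pd i F)" using Suc.prems(1) by simp
    show "pd i F y = pd i G y" if "y \<in> S" for y
      by (rule pd_cong[OF assms that Suc.prems(2)])
  qed
  moreover have "G differentiable (at x)" if "x \<in> S" for x
    by (rule differentiable_cong_open[OF assms that Suc.prems(2)]) (use Suc.prems(1) that in auto)
  ultimately show ?case by simp
qed

lemma Ck_on_subset: "Ck_on n S F \<Longrightarrow> T \<subseteq> S \<Longrightarrow> Ck_on n T F"
  by (induction n arbitrary: F) (auto intro: continuous_on_subset)

lemma Ck_on_Suc_D: "Ck_on (Suc n) S F \<Longrightarrow> Ck_on n S F"
proof (induction n arbitrary: F)
  case 0
  then show ?case
    by (auto intro!: continuous_at_imp_continuous_on differentiable_imp_continuous_within)
next
  case (Suc n)
  then have "\<forall>i. Ck_on (Suc n) S (pd i F)" "\<forall>x\<in>S. F differentiable (at x)"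
    unfolding Ck_on.simps(2)[of "Suc n"] by auto
  with Suc.IH show ?case unfolding Ck_on.simps(2)[of n] by blast
qed

lemma differentiable_pd:
  "F differentiable (at x) \<Longrightarrow> (F has_derivative (\<lambda>v. \<Sum>a\<in>UNIV. v $ a *\<^sub>R pd a F x)) (at x)"
  for F :: "real^2 \<Rightarrow> 'b::real_normed_vector"
proof -
  assume "F differentiable (at x)"
  then have D: "(F has_derivative frechet_derivative F (at x)) (at x)"
    by (rule frechet_derivative_works[THEN iffD1])
  have "frechet_derivative F (at x) v = (\<Sum>a\<in>UNIV. v $ a *\<^sub>R pd a F x)" for v
  proof -
    have "v = (\<Sum>a\<in>UNIV. v $ a *\<^sub>R axis a 1)"
      using basis_expansion[of v, unfolded scalar_mult_eq_scaleR] by (rule sym)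
    then have "frechet_derivative F (at x) v = frechet_derivative F (at x) (\<Sum>a\<in>UNIV. v $ a *\<^sub>R axis a 1)"
      by (rule arg_cong)
    also have "\<dots> = (\<Sum>a\<in>UNIV. v $ a *\<^sub>R pd a F x)"
      by (simp only: linear_sum[OF has_derivative_linear[OF D]]
          linear_scale[OF has_derivative_linear[OF D]] pd_def)
    finally show ?thesis .
  qed
  then have eq: "frechet_derivative F (at x) = (\<lambda>v. \<Sum>a\<in>UNIV. v $ a *\<^sub>R pd a F x)"
    by (rule ext)
  show ?thesis using D unfolding eq .
qed

lemma pd_add:
  assumes "F differentiable (at x)" "G differentiable (at x)"
  shows "pd i (\<lambda>x. F x + G x) x = pd i F x + pd i G x"
  using pd_eqI[OF has_derivative_add[OF assms[unfolded frechet_derivative_works]]]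
  by (simp add: pd_def)

lemma pd_mult:
  fixes F G :: "real^2 \<Rightarrow> 'b::real_normed_algebra"
  assumes "F differentiable (at x)" "G differentiable (at x)"
  shows "pd i (\<lambda>x. F x * G x) x = F x * pd i G x + pd i F x * G x"
  using pd_eqI[OF has_derivative_mult[OF assms[unfolded frechet_derivative_works]]]
  by (simp add: pd_def)

lemma pd_const [simp]: "pd i (\<lambda>x. k) x = 0"
  by (rule pd_eqI) auto

lemma pd_bounded_linear:
  assumes "bounded_linear L" "F differentiable (at x)"
  shows "pd i (\<lambda>x. L (F x)) x = L (pd i F x)"
  using pd_eqI[OF bounded_linear.has_derivative[OF assms(1) assms(2)[unfolded frechet_derivative_works]]]
  by (simp add: pd_def)

lemma pd_sum:
  "(\<And>a. a \<in> A \<Longrightarrow> F a differentiable (at x)) \<Longrightarrow>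
    pd i (\<lambda>x. \<Sum>a\<in>A. F a x) x = (\<Sum>a\<in>A. pd i (F a) x)"
  by (induction A rule: infinite_finite_induct) (auto simp: pd_add differentiable_sum)

lemma Ck_on_const: "Ck_on n S (\<lambda>x. k)"
proof (induction n arbitrary: k)
  case (Suc n)
  have "pd i (\<lambda>x. k) = (\<lambda>x. 0)" for i by auto
  with Suc show ?case by auto
qed auto

lemma Ck_on_add:
  assumes "open S"
  shows "Ck_on n S F \<Longrightarrow> Ck_on n S G \<Longrightarrow> Ck_on n S (\<lambda>x. F x + G x)"
proof (induction n arbitrary: F G)
  case (Suc n)
  have "Ck_on n S (pd i (\<lambda>x. F x + G x))" for i
    by (rule Ck_on_cong[OF assms Suc.IH[of "pd i F" "pd i G"]])
      (use Suc.prems in \<open>auto simp: pd_add\<close>)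
  with Suc.prems show ?case by auto
qed (auto intro: continuous_on_add)

lemma Ck_on_mult:
  fixes F G :: "real^2 \<Rightarrow> 'b::real_normed_algebra"
  assumes "open S"
  shows "Ck_on n S F \<Longrightarrow> Ck_on n S G \<Longrightarrow> Ck_on n S (\<lambda>x. F x * G x)"
proof (induction n arbitrary: F G)
  case (Suc n)
  have "Ck_on n S (pd i (\<lambda>x. F x * G x))" for i
  proof (rule Ck_on_cong[OF assms])
    show "Ck_on n S (\<lambda>x. F x * pd i G x + pd i F x * G x)"
      using Suc.prems Ck_on_Suc_D[OF Suc.prems(1)] Ck_on_Suc_D[OF Suc.prems(2)]
      by (intro Ck_on_add[OF assms] Suc.IH) auto
    show "F y * pd i G y + pd i F y * G y = pd i (\<lambda>x. F x * G x) y" if "y \<in> S" for y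
      using Suc.prems that by (subst pd_mult) auto
  qed
  with Suc.prems show ?case by auto
qed (auto intro: continuous_on_mult)

lemma Ck_on_bounded_linear:
  assumes "open S" "bounded_linear L"
  shows "Ck_on n S F \<Longrightarrow> Ck_on n S (\<lambda>x. L (F x))"
proof (induction n arbitrary: F)
  case 0
  then show ?case by (auto intro: bounded_linear.continuous_on[OF assms(2)])
next
  case (Suc n)
  have "Ck_on n S (pd i (\<lambda>x. L (F x)))" for i
    by (rule Ck_on_cong[OF assms(1) Suc.IH[of "pd i F"]])
      (use Suc.prems in \<open>auto simp: pd_bounded_linear[OF assms(2)]\<close>)
  moreover have "(\<lambda>x. L (F x)) differentiable (at x)" if "x \<in> S" for x
  proof -
    have "F differentiable (at x)" using Suc.prems that by simp
    then obtain D where "(F has_derivative D) (at x)" unfolding differentiable_def by blast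
    from bounded_linear.has_derivative[OF assms(2) this] show ?thesis
      unfolding differentiable_def by blast
  qed
  ultimately show ?case by auto
qed

text \<open>For G = F^(-1/2) the derivative is -1/2 F' G^3, a polynomial in F' and G, so smoothness
  of order n of G yields the next order. The function gives the Gram-Schmidt factors, and its square
  the reciprocal of the metric determinant.\<close>

lemma Ck_on_inverse_sqrt:
  fixes F :: "real^2 \<Rightarrow> real"
  assumes "open S" "\<And>n. Ck_on n S F" "\<And>x. x \<in> S \<Longrightarrow> F x > 0"
  shows "Ck_on n S (\<lambda>x. inverse (sqrt (F x)))"
proof (induction n)
  case 0
  have "continuous_on S F" using assms(2)[of 0] by simp
  then show ?case using assms(3) by (auto intro!: continuous_intros simp: less_imp_neq[symmetric])
next
  case (Suc n)
  define G where "G x = inverse (sqrt (F x))" for x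
  have IH: "Ck_on n S G" using Suc unfolding G_def .
  have D: "(G has_derivative (\<lambda>v. - (1/2) * frechet_derivative F (at x) v * G x * G x * G x)) (at x)"
    if "x \<in> S" for x
  proof -
    have "F differentiable (at x)" using assms(2)[of 1] that by simp
    then have F: "(F has_derivative frechet_derivative F (at x)) (at x)"
      using frechet_derivative_works by blast
    have "sqrt (F x) * sqrt (F x) = F x" "sqrt (F x) > 0" using assms(3)[OF that] by auto
    then have "((\<lambda>y. inverse (sqrt y)) has_real_derivative (- (1/2) * G x * G x * G x)) (at (F x))"
      unfolding G_def using assms(3)[OF that]
      by (auto intro!: derivative_eq_intros simp: field_simps)
    from has_derivative_compose[OF F this[unfolded has_field_derivative_def]]
    show ?thesis unfolding G_def by (simp add: mult_ac)
  qed
  have "Ck_on n S (\<lambda>x. - (1/2) * pd i F x * G x * G x * G x)" for i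
    using assms(2)[of "Suc n"]
    by (intro Ck_on_mult[OF assms(1)] IH Ck_on_const) auto
  then have "Ck_on n S (pd i G)" for i
    by (rule Ck_on_cong[OF assms(1)]) (use pd_eqI[OF D] in \<open>auto simp: pd_def\<close>)
  moreover have "G differentiable (at x)" if "x \<in> S" for x
    using D[OF that] differentiable_def by blast
  ultimately have "Ck_on (Suc n) S G" by simp
  then show ?case unfolding G_def .
qed

lemma smooth_on_differentiable: "smooth_on S F \<Longrightarrow> x \<in> S \<Longrightarrow> F differentiable (at x)"
  unfolding smooth_on_def using Ck_on.simps(2) by blast

lemma smooth_on_pd: "smooth_on S F \<Longrightarrow> smooth_on S (pd i F)"
  unfolding smooth_on_def using Ck_on.simps(2) by blast

lemma smooth_on_continuous: "smooth_on S F \<Longrightarrow> continuous_on S F"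
  unfolding smooth_on_def using Ck_on.simps(1) by blast

lemma smooth_on_subset: "smooth_on S F \<Longrightarrow> T \<subseteq> S \<Longrightarrow> smooth_on T F"
  unfolding smooth_on_def using Ck_on_subset by blast

lemma smooth_on_cong:
  "open S \<Longrightarrow> smooth_on S F \<Longrightarrow> (\<And>y. y \<in> S \<Longrightarrow> F y = G y) \<Longrightarrow> smooth_on S G"
  unfolding smooth_on_def using Ck_on_cong by blast

lemma smooth_on_const [simp]: "smooth_on S (\<lambda>x. k)"
  unfolding smooth_on_def using Ck_on_const by blast

lemma smooth_on_add:
  "open S \<Longrightarrow> smooth_on S F \<Longrightarrow> smooth_on S G \<Longrightarrow> smooth_on S (\<lambda>x. F x + G x)"
  unfolding smooth_on_def using Ck_on_add by blast

lemma smooth_on_mult: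
  fixes F G :: "real^2 \<Rightarrow> 'b::real_normed_algebra"
  shows "open S \<Longrightarrow> smooth_on S F \<Longrightarrow> smooth_on S G \<Longrightarrow> smooth_on S (\<lambda>x. F x * G x)"
  unfolding smooth_on_def using Ck_on_mult by blast

lemma smooth_on_bounded_linear:
  "open S \<Longrightarrow> bounded_linear L \<Longrightarrow> smooth_on S F \<Longrightarrow> smooth_on S (\<lambda>x. L (F x))"
  unfolding smooth_on_def using Ck_on_bounded_linear by blast

lemma smooth_on_minus: "open S \<Longrightarrow> smooth_on S F \<Longrightarrow> smooth_on S (\<lambda>x. - F x)"
  by (rule smooth_on_bounded_linear[OF _ bounded_linear_minus[OF bounded_linear_ident]])

lemma smooth_on_diff:
  "open S \<Longrightarrow> smooth_on S F \<Longrightarrow> smooth_on S G \<Longrightarrow> smooth_on S (\<lambda>x. F x - G x)"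
  using smooth_on_add[of S F "\<lambda>x. - G x"] smooth_on_minus[of S G] by simp

lemma smooth_on_of_real:
  "open S \<Longrightarrow> smooth_on S F \<Longrightarrow> smooth_on S (\<lambda>x. of_real (F x) :: complex)"
  by (rule smooth_on_bounded_linear[OF _ bounded_linear_of_real])

lemma smooth_on_sum:
  "open S \<Longrightarrow> (\<And>a. a \<in> A \<Longrightarrow> smooth_on S (F a)) \<Longrightarrow> smooth_on S (\<lambda>x. \<Sum>a\<in>A. F a x)"
  by (induction A rule: infinite_finite_induct) (auto simp: smooth_on_add)

lemma smooth_on_inverse_sqrt:
  fixes F :: "real^2 \<Rightarrow> real"
  shows "open S \<Longrightarrow> smooth_on S F \<Longrightarrow> (\<And>x. x \<in> S \<Longrightarrow> F x > 0) \<Longrightarrow>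
    smooth_on S (\<lambda>x. inverse (sqrt (F x)))"
  using Ck_on_inverse_sqrt unfolding smooth_on_def by blast

text \<open>Meant for the orientation sign of a chart, which is constant only near each point
  because the domain may be disconnected.\<close>

lemma smooth_on_locally_constant:
  assumes S: "open S" and
    loc: "\<And>x. x \<in> S \<Longrightarrow> \<exists>N. open N \<and> x \<in> N \<and> N \<subseteq> S \<and> (\<forall>y\<in>N. F y = F x)"
  shows "smooth_on S F"
proof -
  have D: "(F has_derivative (\<lambda>v. 0)) (at x)" if xS: "x \<in> S" for x
  proof -
    obtain N where N: "open N" "x \<in> N" "N \<subseteq> S" "\<forall>y\<in>N. F y = F x" using loc[OF xS] by blast
    have "(F has_derivative (\<lambda>v. 0)) (at x) \<longleftrightarrow> ((\<lambda>y. F x) has_derivative (\<lambda>v. 0)) (at x)"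
      by (rule has_derivative_cong_open[OF N(1,2)]) (rule N(4)[rule_format])
    then show ?thesis by simp
  qed
  have "Ck_on n S F" for n
  proof (cases n)
    case 0
    have "\<forall>x\<in>S. isCont F x" using has_derivative_continuous[OF D] by blast
    then show ?thesis unfolding 0 Ck_on.simps by (rule continuous_at_imp_continuous_on)
  next
    case (Suc m)
    have "Ck_on m S (pd i F)" for i
      by (rule Ck_on_cong[OF S Ck_on_const[of _ _ 0]]) (use pd_eqI[OF D] in auto)
    moreover have "F differentiable (at x)" if "x \<in> S" for x
      using D[OF that] unfolding differentiable_def by blast
    ultimately show ?thesis unfolding Suc by simp
  qed
  then show ?thesis unfolding smooth_on_def by blast
qed

lemma pd_chain:
  fixes T :: "real^2 \<Rightarrow> real^2" and F :: "real^2 \<Rightarrow> 'b::real_normed_vector"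
  assumes "T differentiable (at x)" "F differentiable (at (T x))"
  shows "pd i (\<lambda>x. F (T x)) x = (\<Sum>a\<in>UNIV. (pd i T x $ a) *\<^sub>R pd a F (T x))"
  using pd_eqI[OF has_derivative_compose[OF assms(1)[unfolded frechet_derivative_works]
      differentiable_pd[OF assms(2)]]] unfolding pd_def .

lemma pd_component:
  "T differentiable (at x) \<Longrightarrow> pd i (\<lambda>x. T x $ a) x = pd i T x $ a" for T :: "real^2 \<Rightarrow> real^2"
  by (rule pd_bounded_linear[OF bounded_linear_vec_nth])

section \<open>Symmetry of mixed partial derivatives\<close>

lemma pd_mvt:
  fixes F :: "real^2 \<Rightarrow> real"
  assumes "0 < h" "\<And>t. 0 \<le> t \<Longrightarrow> t \<le> h \<Longrightarrow> F differentiable (at (x + t *\<^sub>R axis i 1))"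
  shows "\<exists>t. 0 < t \<and> t < h \<and> F (x + h *\<^sub>R axis i 1) - F x = h * pd i F (x + t *\<^sub>R axis i 1)"
proof -
  have D: "((\<lambda>t. F (x + t *\<^sub>R axis i 1)) has_real_derivative pd i F (x + t *\<^sub>R axis i 1)) (at t)"
    if t: "0 \<le> t" "t \<le> h" for t
  proof -
    have l: "((\<lambda>t. x + t *\<^sub>R axis i 1) has_derivative (\<lambda>s. s *\<^sub>R axis i 1)) (at t)"
      by (auto intro!: derivative_eq_intros)
    have F: "(F has_derivative frechet_derivative F (at (x + t *\<^sub>R axis i 1))) (at (x + t *\<^sub>R axis i 1))"
      using assms(2)[OF t] frechet_derivative_works by blast
    have "((\<lambda>t. F (x + t *\<^sub>R axis i 1)) has_derivative
        (\<lambda>s. frechet_derivative F (at (x + t *\<^sub>R axis i 1)) (s *\<^sub>R axis i 1))) (at t)"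
      by (rule has_derivative_compose[OF l F])
    moreover have "(\<lambda>s. frechet_derivative F (at (x + t *\<^sub>R axis i 1)) (s *\<^sub>R axis i 1))
        = (*) (pd i F (x + t *\<^sub>R axis i 1))"
      by (simp add: fun_eq_iff pd_def linear_scale[OF has_derivative_linear[OF F]])
    ultimately show ?thesis unfolding has_field_derivative_def by simp
  qed
  obtain z where "0 < z" "z < h"
    "F (x + h *\<^sub>R axis i 1) - F (x + 0 *\<^sub>R axis i 1) = (h - 0) * pd i F (x + z *\<^sub>R axis i 1)"
    using MVT2[OF assms(1), of "\<lambda>t. F (x + t *\<^sub>R axis i 1)" "\<lambda>t. pd i F (x + t *\<^sub>R axis i 1)"] D by auto
  then show ?thesis by auto
qed

text \<open>The mean value theorem is applied to the increment in direction \<open>j\<close>, taken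
  along \<open>i\<close>, and then to \<open>pd i F\<close> along \<open>j\<close>. The second
  difference itself is symmetric in \<open>i\<close> and \<open>j\<close>, which is what makes it
  useful.\<close>

lemma second_difference_mvt:
  fixes F :: "real^2 \<Rightarrow> real"
  assumes d: "0 < d" "cball x (2 * d) \<subseteq> S" and F: "Ck_on 2 S F"
  shows "\<exists>z\<in>cball x (2 * d). F (x + d *\<^sub>R axis i 1 + d *\<^sub>R axis j 1) - F (x + d *\<^sub>R axis j 1)
      - (F (x + d *\<^sub>R axis i 1) - F x) = d * d * pd j (pd i F) z"
proof -
  have mem: "x + t *\<^sub>R axis i 1 + s *\<^sub>R axis j 1 \<in> cball x (2 * d)"
    if "0 \<le> t" "t \<le> d" "0 \<le> s" "s \<le> d" for t s
  proof -
    have "norm (t *\<^sub>R axis i (1::real) + s *\<^sub>R axis j 1 :: real^2) \<le> t + s"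
      by (rule order.trans[OF norm_triangle_ineq]) (use that in auto)
    moreover have "dist x (x + v) = norm v" for v by (simp add: dist_norm)
    ultimately have "dist x (x + (t *\<^sub>R axis i 1 + s *\<^sub>R axis j 1)) \<le> 2 * d"
      using that by simp
    then show ?thesis by (simp add: add.assoc)
  qed
  have C: "\<And>y. y \<in> S \<Longrightarrow> F differentiable (at y)" "\<And>i y. y \<in> S \<Longrightarrow> pd i F differentiable (at y)"
    using F by (auto simp: numeral_2_eq_2)
  define G where "G = (\<lambda>y. F (d *\<^sub>R axis j 1 + y) - F y)"
  have shift: "((\<lambda>y. F (d *\<^sub>R axis j 1 + y)) has_derivative frechet_derivative F (at (d *\<^sub>R axis j 1 + y))) (at y)"
    if "d *\<^sub>R axis j 1 + y \<in> S" for y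
  proof -
    have "((\<lambda>y. d *\<^sub>R axis j 1 + y) has_derivative (\<lambda>v. v)) (at y)"
      by (auto intro!: derivative_eq_intros)
    from has_derivative_compose[OF this C(1)[OF that, unfolded frechet_derivative_works]]
    show ?thesis .
  qed
  have G: "(G has_derivative (\<lambda>v. frechet_derivative F (at (d *\<^sub>R axis j 1 + y)) v - frechet_derivative F (at y) v)) (at y)"
    if "d *\<^sub>R axis j 1 + y \<in> S" "y \<in> S" for y
    unfolding G_def
    by (intro has_derivative_diff shift that C(1)[OF that(2), unfolded frechet_derivative_works])
  have inS: "d *\<^sub>R axis j 1 + (x + t *\<^sub>R axis i 1) \<in> S" "x + t *\<^sub>R axis i 1 \<in> S"
    if "0 \<le> t" "t \<le> d" for t
    using mem[of t d] mem[of t 0] that d by (auto simp: algebra_simps)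
  have Gd: "G differentiable (at (x + t *\<^sub>R axis i 1))" if "0 \<le> t" "t \<le> d" for t
    using G[OF inS[OF that]] unfolding differentiable_def by blast
  obtain t where t: "0 < t" "t < d" "G (x + d *\<^sub>R axis i 1) - G x = d * pd i G (x + t *\<^sub>R axis i 1)"
    using pd_mvt[OF d(1) Gd] by blast
  have "pd i G (x + t *\<^sub>R axis i 1) = pd i F (x + t *\<^sub>R axis i 1 + d *\<^sub>R axis j 1) - pd i F (x + t *\<^sub>R axis i 1)"
    using pd_eqI[OF G[OF inS(1)[of t] inS(2)[of t]], of i] t by (simp add: pd_def add.commute)
  moreover have "pd i F differentiable (at (x + t *\<^sub>R axis i 1 + s *\<^sub>R axis j 1))"
    if "0 \<le> s" "s \<le> d" for s
    using C(2) mem[of t s] t that d(2) by auto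
  then obtain s where s: "0 < s" "s < d"
    "pd i F (x + t *\<^sub>R axis i 1 + d *\<^sub>R axis j 1) - pd i F (x + t *\<^sub>R axis i 1)
      = d * pd j (pd i F) (x + t *\<^sub>R axis i 1 + s *\<^sub>R axis j 1)"
    using pd_mvt[OF d(1), of "pd i F" "x + t *\<^sub>R axis i 1" j] by blast
  ultimately have "G (x + d *\<^sub>R axis i 1) - G x = d * d * pd j (pd i F) (x + t *\<^sub>R axis i 1 + s *\<^sub>R axis j 1)"
    using t by simp
  then show ?thesis
    using mem[of t s] t s unfolding G_def by (intro bexI[of _ "x + t *\<^sub>R axis i 1 + s *\<^sub>R axis j 1"]) (auto simp: algebra_simps)
qed

lemma pd_commute_real:
  fixes F :: "real^2 \<Rightarrow> real"
  assumes "open S" "x \<in> S" and F: "smooth_on S F"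
  shows "pd i (pd j F) x = pd j (pd i F) x"
proof (rule ccontr)
  assume neq: "pd i (pd j F) x \<noteq> pd j (pd i F) x"
  define e where "e = \<bar>pd i (pd j F) x - pd j (pd i F) x\<bar> / 2"
  have e: "e > 0" using neq by (simp add: e_def)
  have F2: "Ck_on 2 S F" using F smooth_on_def by blast
  have c: "isCont (pd i (pd j F)) x" for i j
    using smooth_on_continuous[OF smooth_on_pd[OF smooth_on_pd[OF F]]] assms(1,2)
    by (simp add: continuous_on_eq_continuous_at)
  obtain r where r: "r > 0" "ball x r \<subseteq> S" using assms(1,2) open_contains_ball by blast
  obtain s1 where s1: "s1 > 0" "\<And>y. dist y x < s1 \<Longrightarrow> dist (pd i (pd j F) y) (pd i (pd j F) x) < e"
    using c[of i j] e unfolding continuous_at_eps_delta by metis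
  obtain s2 where s2: "s2 > 0" "\<And>y. dist y x < s2 \<Longrightarrow> dist (pd j (pd i F) y) (pd j (pd i F) x) < e"
    using c[of j i] e unfolding continuous_at_eps_delta by metis
  \<comment> \<open>The intermediate points lie within 2d of x; with one quarter, 2d stays strictly
    below all three radii.\<close>
  define d where "d = min r (min s1 s2) / 4"
  have d: "d > 0" "2 * d < r" "2 * d < s1" "2 * d < s2" using r s1 s2 by (auto simp: d_def)
  have sub: "cball x (2 * d) \<subseteq> S" using d r by force
  obtain z where z: "z \<in> cball x (2*d)" "F (x + d *\<^sub>R axis i 1 + d *\<^sub>R axis j 1) - F (x + d *\<^sub>R axis j 1)
      - (F (x + d *\<^sub>R axis i 1) - F x) = d * d * pd j (pd i F) z"
    using second_difference_mvt[OF d(1) sub F2] by blast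
  obtain w where w: "w \<in> cball x (2*d)" "F (x + d *\<^sub>R axis j 1 + d *\<^sub>R axis i 1) - F (x + d *\<^sub>R axis i 1)
      - (F (x + d *\<^sub>R axis j 1) - F x) = d * d * pd i (pd j F) w"
    using second_difference_mvt[OF d(1) sub F2] by blast
  have "d * d * pd j (pd i F) z = d * d * pd i (pd j F) w"
    using z(2) w(2) by (simp add: algebra_simps)
  then have "pd j (pd i F) z = pd i (pd j F) w" using d by simp
  moreover have "dist (pd j (pd i F) z) (pd j (pd i F) x) < e" "dist (pd i (pd j F) w) (pd i (pd j F) x) < e"
    using z(1) w(1) d s1(2)[of w] s2(2)[of z] by (auto simp: dist_commute)
  ultimately show False unfolding e_def dist_real_def by (auto simp: field_simps abs_if split: if_splits)
qed

text \<open>The mean value theorem needs real values, so the complex case passes through real and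
  imaginary parts.\<close>

lemma pd_commute:
  fixes F :: "real^2 \<Rightarrow> complex"
  assumes "open S" "x \<in> S" and F: "smooth_on S F"
  shows "pd i (pd j F) x = pd j (pd i F) x"
proof -
  have "L (pd i (pd j F) x) = L (pd j (pd i F) x)" if L: "bounded_linear L" for L :: "complex \<Rightarrow> real"
  proof -
    have 1: "pd i (\<lambda>y. L (F y)) y = L (pd i F y)" if "y \<in> S" for y i
      using pd_bounded_linear[OF L] smooth_on_differentiable[OF F that] by blast
    have 2: "pd i (pd j (\<lambda>y. L (F y))) x = L (pd i (pd j F) x)" for i j
    proof -
      have "pd i (pd j (\<lambda>y. L (F y))) x = pd i (\<lambda>y. L (pd j F y)) x"
        by (rule pd_cong[OF assms(1,2) 1])
      also have "\<dots> = L (pd i (pd j F) x)"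
        by (rule pd_bounded_linear[OF L smooth_on_differentiable[OF smooth_on_pd[OF F] assms(2)]])
      finally show ?thesis .
    qed
    show ?thesis
      using pd_commute_real[OF assms(1,2) smooth_on_bounded_linear[OF assms(1) L F], of i j] 2 by simp
  qed
  from this[OF bounded_linear_Re] this[OF bounded_linear_Im] show ?thesis
    by (simp add: complex_eq_iff)
qed

section \<open>Metric, connection and null frames in a chart\<close>

text \<open>\<open>matrix_inv\<close> is defined by choice; the adjugate formula shows that its
  entries depend smoothly on the metric.\<close>

lemma matrix_inv_2:
  fixes A :: "real^2^2"
  assumes "det A \<noteq> 0"
  shows "A ** matrix_inv A = mat 1" "matrix_inv A ** A = mat 1"
    "matrix_inv A $ 1 $ 1 = A $ 2 $ 2 / det A" "matrix_inv A $ 1 $ 2 = - A $ 1 $ 2 / det A"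
    "matrix_inv A $ 2 $ 1 = - A $ 2 $ 1 / det A" "matrix_inv A $ 2 $ 2 = A $ 1 $ 1 / det A"
proof -
  have inv: "invertible A" using assms invertible_det_nz by blast
  then have rl: "A ** matrix_inv A = mat 1 \<and> matrix_inv A ** A = mat 1"
    unfolding invertible_def matrix_inv_def by (rule someI_ex)
  then show "A ** matrix_inv A = mat 1" and l: "matrix_inv A ** A = mat 1" by auto
  define B :: "real^2^2" where "B = vector [vector [A $ 2 $ 2 / det A, - A $ 1 $ 2 / det A],
    vector [- A $ 2 $ 1 / det A, A $ 1 $ 1 / det A]]"
  have B: "B $ 1 $ 1 = A $ 2 $ 2 / det A" "B $ 1 $ 2 = - A $ 1 $ 2 / det A"
    "B $ 2 $ 1 = - A $ 2 $ 1 / det A" "B $ 2 $ 2 = A $ 1 $ 1 / det A"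
    unfolding B_def by simp_all
  have d: "A $ 1 $ 1 * A $ 2 $ 2 - A $ 1 $ 2 * A $ 2 $ 1 = det A" by (simp add: det_2)
  have "(A ** B) $ i $ j = mat 1 $ i $ j" for i j
    using assms d exhaust_2[of i] exhaust_2[of j]
    by (auto simp: matrix_matrix_mult_def mat_def sum_2 B field_simps)
  then have "A ** B = mat 1" by (simp add: vec_eq_iff)
  then have "matrix_inv A = matrix_inv A ** (A ** B)" by simp
  also have "\<dots> = B" unfolding matrix_mul_assoc l by simp
  finally have "matrix_inv A = B" .
  with B show "matrix_inv A $ 1 $ 1 = A $ 2 $ 2 / det A" "matrix_inv A $ 1 $ 2 = - A $ 1 $ 2 / det A"
    "matrix_inv A $ 2 $ 1 = - A $ 2 $ 1 / det A" "matrix_inv A $ 2 $ 2 = A $ 1 $ 1 / det A" by simp_all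
qed

section \<open>The Levi-Civita connection in one chart\<close>

locale coord_chart =
  fixes R :: "('a::{t2_space,second_countable_topology}) riem" and c :: "'a chart"
  assumes riem: "riemannian_surface R" and atlas: "c \<in> atlas R"
begin

abbreviation W :: "(real^2) set" where "W \<equiv> chart_range c"

definition gg :: "2 \<Rightarrow> 2 \<Rightarrow> real^2 \<Rightarrow> real" where
  "gg i j x = metric R c (chart_inv c x) $ i $ j"

abbreviation chr :: "2 \<Rightarrow> 2 \<Rightarrow> 2 \<Rightarrow> real^2 \<Rightarrow> real" where "chr \<equiv> christoffel R c"

lemma open_W: "open W"
  using riem atlas unfolding riemannian_surface_def smooth_atlas_def by blast

lemma open_dom: "open (fst c)"
  using riem atlas unfolding riemannian_surface_def smooth_atlas_def by blast

lemma homeo: "homeomorphism (fst c) W (snd c) (chart_inv c)"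
  using riem atlas unfolding riemannian_surface_def smooth_atlas_def by blast

lemma inv_coord [simp]: "q \<in> fst c \<Longrightarrow> chart_inv c (snd c q) = q"
  using homeo by (rule homeomorphism_apply1)

lemma coord_inv [simp]: "x \<in> W \<Longrightarrow> snd c (chart_inv c x) = x"
  using homeo by (rule homeomorphism_apply2)

lemma inv_in_dom [simp]: "x \<in> W \<Longrightarrow> chart_inv c x \<in> fst c"
  using homeo homeomorphism_image2 by blast

lemma coord_in_W [simp]: "q \<in> fst c \<Longrightarrow> snd c q \<in> W"
  unfolding chart_range_def by blast

lemma open_coord_image: "open V \<Longrightarrow> open (snd c ` (fst c \<inter> V))"
  using homeomorphism_imp_open_map[OF homeo, of "fst c \<inter> V"] open_W open_dom
  by (metis open_Int openin_open_Int openin_open_trans)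

lemma gg_smooth: "smooth_on W (gg i j)"
  using riem atlas unfolding riemannian_surface_def gg_def by blast

lemma metric_sym: "q \<in> fst c \<Longrightarrow> metric R c q $ i $ j = metric R c q $ j $ i"
  using riem atlas unfolding riemannian_surface_def
  by (metis (no_types, lifting) transpose_def vec_lambda_beta)

lemma gg_sym: "x \<in> W \<Longrightarrow> gg i j x = gg j i x"
  unfolding gg_def by (rule metric_sym) simp

lemma metric_pos: "q \<in> fst c \<Longrightarrow> v \<noteq> 0 \<Longrightarrow> v \<bullet> (metric R c q *v v) > 0"
  using riem atlas unfolding riemannian_surface_def by blast

lemma metric_11_pos:
  assumes "q \<in> fst c" shows "metric R c q $ 1 $ 1 > 0"
proof -
  have "axis 1 1 \<noteq> (0 :: real^2)" by (simp add: axis_eq_0_iff)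
  from metric_pos[OF assms this] show ?thesis
    by (simp add: inner_vec_def matrix_vector_mult_def sum_2 axis_def)
qed

lemma metric_det_pos:
  assumes "q \<in> fst c" shows "det (metric R c q) > 0"
proof -
  let ?g = "metric R c q"
  have a: "?g $ 1 $ 1 > 0" by (rule metric_11_pos[OF assms])
  \<comment> \<open>This vector is orthogonal to the first coordinate vector; its squared length is
    g_11 times the determinant.\<close>
  define v :: "real^2" where "v = vector [- ?g $ 1 $ 2, ?g $ 1 $ 1]"
  have v: "v $ 1 = - ?g $ 1 $ 2" "v $ 2 = ?g $ 1 $ 1" unfolding v_def by simp_all
  have "v \<noteq> 0" using v a by auto
  from metric_pos[OF assms this] have "?g $ 1 $ 1 * det ?g > 0"
    using metric_sym[OF assms, of 1 2]
    by (simp add: inner_vec_def matrix_vector_mult_def sum_2 v det_2 algebra_simps)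
  with a show ?thesis by (simp add: zero_less_mult_iff)
qed

lemma gg_det_pos:
  assumes "x \<in> W" shows "gg 1 1 x * gg 2 2 x - gg 1 2 x * gg 2 1 x > 0"
  using metric_det_pos[OF inv_in_dom[OF assms]] by (simp add: det_2 gg_def)

lemma gg_11_pos: "x \<in> W \<Longrightarrow> gg 1 1 x > 0"
  unfolding gg_def by (simp add: metric_11_pos)

lemma smooth_inverse_det: "smooth_on W (\<lambda>x. inverse (gg 1 1 x * gg 2 2 x - gg 1 2 x * gg 2 1 x))"
proof -
  have s: "smooth_on W (\<lambda>x. gg 1 1 x * gg 2 2 x - gg 1 2 x * gg 2 1 x)"
    by (intro smooth_on_diff smooth_on_mult gg_smooth open_W)
  have "smooth_on W (\<lambda>x. inverse (sqrt (gg 1 1 x * gg 2 2 x - gg 1 2 x * gg 2 1 x))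
      * inverse (sqrt (gg 1 1 x * gg 2 2 x - gg 1 2 x * gg 2 1 x)))"
    by (intro smooth_on_mult smooth_on_inverse_sqrt s open_W gg_det_pos)
  then show ?thesis
    by (rule smooth_on_cong[OF open_W])
      (use gg_det_pos in \<open>auto simp: inverse_mult_distrib[symmetric] less_imp_le simp del: inverse_mult_distrib\<close>)
qed

definition ginv :: "2 \<Rightarrow> 2 \<Rightarrow> real^2 \<Rightarrow> real" where
  "ginv i j x = matrix_inv (metric R c (chart_inv c x)) $ i $ j"

lemma ginv_gg:
  assumes "x \<in> W"
  shows "(\<Sum>m\<in>UNIV. gg i m x * ginv m j x) = (if i = j then 1 else 0)"
proof -
  have "metric R c (chart_inv c x) ** matrix_inv (metric R c (chart_inv c x)) = mat 1"
    using matrix_inv_2(1) metric_det_pos[OF inv_in_dom[OF assms]] by fastforce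
  then have "(metric R c (chart_inv c x) ** matrix_inv (metric R c (chart_inv c x))) $ i $ j = mat 1 $ i $ j"
    by simp
  then show ?thesis by (simp add: matrix_matrix_mult_def mat_def gg_def ginv_def)
qed

lemma ginv_smooth: "smooth_on W (ginv i j)"
proof -
  have d: "det (metric R c (chart_inv c x)) = gg 1 1 x * gg 2 2 x - gg 1 2 x * gg 2 1 x" for x
    by (simp add: det_2 gg_def)
  have nz: "x \<in> W \<Longrightarrow> det (metric R c (chart_inv c x)) \<noteq> 0" for x
    using metric_det_pos[OF inv_in_dom] by fastforce
  have s: "smooth_on W (\<lambda>x. gg 2 2 x * inverse (gg 1 1 x * gg 2 2 x - gg 1 2 x * gg 2 1 x))"
    "smooth_on W (\<lambda>x. gg 1 1 x * inverse (gg 1 1 x * gg 2 2 x - gg 1 2 x * gg 2 1 x))"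
    "smooth_on W (\<lambda>x. - gg 1 2 x * inverse (gg 1 1 x * gg 2 2 x - gg 1 2 x * gg 2 1 x))"
    "smooth_on W (\<lambda>x. - gg 2 1 x * inverse (gg 1 1 x * gg 2 2 x - gg 1 2 x * gg 2 1 x))"
    by (intro smooth_on_mult smooth_on_minus gg_smooth smooth_inverse_det open_W)+
  have "smooth_on W (ginv 1 1)"
    by (rule smooth_on_cong[OF open_W s(1)])
      (use matrix_inv_2(3-6)[OF nz] in \<open>simp add: ginv_def gg_def divide_inverse det_2\<close>)
  moreover have "smooth_on W (ginv 2 2)"
    by (rule smooth_on_cong[OF open_W s(2)])
      (use matrix_inv_2(3-6)[OF nz] in \<open>simp add: ginv_def gg_def divide_inverse det_2\<close>)
  moreover have "smooth_on W (ginv 1 2)"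
    by (rule smooth_on_cong[OF open_W s(3)])
      (use matrix_inv_2(3-6)[OF nz] in \<open>simp add: ginv_def gg_def divide_inverse det_2\<close>)
  moreover have "smooth_on W (ginv 2 1)"
    by (rule smooth_on_cong[OF open_W s(4)])
      (use matrix_inv_2(3-6)[OF nz] in \<open>simp add: ginv_def gg_def divide_inverse det_2\<close>)
  ultimately show ?thesis using exhaust_2[of i] exhaust_2[of j] by auto
qed

lemma chr_eq:
  "chr l i j x = 1/2 * (\<Sum>m\<in>UNIV. ginv l m x * (pd i (gg m j) x + pd j (gg i m) x - pd m (gg i j) x))"
  unfolding christoffel_def Let_def ginv_def gg_def ..

lemma chr_smooth: "smooth_on W (chr l i j)"
proof -
  have eq: "chr l i j = (\<lambda>x. 1/2 * (\<Sum>m\<in>UNIV. ginv l m x * (pd i (gg m j) x + pd j (gg i m) x - pd m (gg i j) x)))"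
    by (rule ext) (rule chr_eq)
  show ?thesis unfolding eq
    by (intro smooth_on_mult smooth_on_sum smooth_on_add smooth_on_diff smooth_on_pd smooth_on_const
        gg_smooth ginv_smooth open_W)
qed

lemma pd_gg_sym:
  assumes "x \<in> W" shows "pd k (gg i j) x = pd k (gg j i) x"
  by (rule pd_cong[OF open_W assms gg_sym])

lemma chr_sym:
  assumes "x \<in> W" shows "chr l i j x = chr l j i x"
proof -
  have "pd i (gg m j) x + pd j (gg i m) x - pd m (gg i j) x
      = pd j (gg m i) x + pd i (gg j m) x - pd m (gg j i) x" for m
    using pd_gg_sym[OF assms, of i m j] pd_gg_sym[OF assms, of j i m] pd_gg_sym[OF assms, of m i j]
    by simp
  then show ?thesis unfolding chr_eq by simp
qed

text \<open>Lowering the upper index cancels the inverse metric and leaves the Christoffel symbols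
  of the first kind.\<close>

lemma chr_lower:
  assumes x: "x \<in> W"
  shows "(\<Sum>m\<in>UNIV. gg j m x * chr m k i x) = (pd k (gg j i) x + pd i (gg k j) x - pd j (gg k i) x) / 2"
proof -
  let ?P = "\<lambda>n. pd k (gg n i) x + pd i (gg k n) x - pd n (gg k i) x"
  have "(\<Sum>m\<in>UNIV. gg j m x * chr m k i x) = (\<Sum>m\<in>UNIV. \<Sum>n\<in>UNIV. gg j m x * ginv m n x * ?P n / 2)"
    unfolding chr_eq by (simp add: sum_distrib_left mult_ac)
  also have "\<dots> = (\<Sum>n\<in>UNIV. (\<Sum>m\<in>UNIV. gg j m x * ginv m n x) * ?P n / 2)"
    by (subst sum.swap) (simp add: sum_distrib_right sum_divide_distrib)
  also have "\<dots> = (\<Sum>n\<in>UNIV. (if j = n then ?P n / 2 else 0))"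
    unfolding ginv_gg[OF x] by (intro sum.cong) auto
  also have "\<dots> = ?P j / 2" by simp
  finally show ?thesis .
qed

text \<open>Metric compatibility: in the sum of the two symbols of the first kind the derivatives in
  the directions \<open>i\<close> and \<open>j\<close> cancel.\<close>

lemma pd_gg:
  assumes x: "x \<in> W"
  shows "pd k (gg i j) x = (\<Sum>m\<in>UNIV. chr m k i x * gg m j x) + (\<Sum>m\<in>UNIV. chr m k j x * gg i m x)"
proof -
  have "(\<Sum>m\<in>UNIV. chr m k i x * gg m j x) = (\<Sum>m\<in>UNIV. gg j m x * chr m k i x)"
    by (intro sum.cong refl) (simp add: gg_sym[OF x, of _ j])
  moreover have "(\<Sum>m\<in>UNIV. chr m k j x * gg i m x) = (\<Sum>m\<in>UNIV. gg i m x * chr m k j x)"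
    by (simp add: mult.commute)
  ultimately show ?thesis
    unfolding chr_lower[OF x]
    using pd_gg_sym[OF x, of k i j] pd_gg_sym[OF x, of i j k] pd_gg_sym[OF x, of j i k] by simp
qed

end

section \<open>Signs, charges and derivatives along words\<close>

fun neg :: "sign \<Rightarrow> sign" where
  "neg Plus = Minus"
| "neg Minus = Plus"

fun sg :: "sign \<Rightarrow> int" where
  "sg Plus = 1"
| "sg Minus = -1"

definition charge :: "sign list \<Rightarrow> int" where
  "charge w = (\<Sum>s\<leftarrow>w. sg s)"

lemma charge_simps [simp]: "charge [] = 0" "charge (s # w) = sg s + charge w"
    "charge (v @ w) = charge v + charge w"
  by (simp_all add: charge_def)

lemma UNIV_sign: "(UNIV :: sign set) = {Plus, Minus}"
  using sign.exhaust by auto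

instance sign :: finite
  by standard (simp add: UNIV_sign)

lemma sum_sign: "(\<Sum>s\<in>UNIV. F s) = F Plus + F Minus"
  by (simp add: UNIV_sign)

lemma balanced_iff: "balanced w \<longleftrightarrow> charge w = 0"
proof -
  have "charge w = int (count_list w Plus) - int (count_list w Minus)"
  proof (induction w)
    case (Cons s w)
    then show ?case by (cases s) auto
  qed simp
  then show ?thesis unfolding balanced_def by auto
qed

lemma neg_neg [simp]: "neg (neg s) = s" and neg_neq [simp]: "neg s \<noteq> s" "s \<noteq> neg s"
  and sg_neg [simp]: "sg (neg s) = - sg s"
  by (cases s; simp)+

lemma smooth_on_cnst_mult: "open S \<Longrightarrow> smooth_on S F \<Longrightarrow> smooth_on S (\<lambda>x. k * F x)"
  for F :: "real^2 \<Rightarrow> 'b::real_normed_algebra"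
  by (intro smooth_on_mult smooth_on_const)

text \<open>Covariant differentiation along \<open>h\<^sub>s\<close> of a tensor component of charge \<open>n\<close>: the frame is
  rotated by \<open>\<nabla>h\<^sub>\<plusminus> = \<plusminus>om h\<^sub>\<plusminus>\<close>, so the connection form enters with weight \<open>n\<close>.\<close>
definition spin_deriv ::
  "(sign \<Rightarrow> 2 \<Rightarrow> real^2 \<Rightarrow> complex) \<Rightarrow> (2 \<Rightarrow> real^2 \<Rightarrow> complex) \<Rightarrow> int \<Rightarrow> sign \<Rightarrow>
    (real^2 \<Rightarrow> complex) \<Rightarrow> real^2 \<Rightarrow> complex" where
  "spin_deriv H om n s F x = (\<Sum>k\<in>UNIV. H s k x * (pd k F x - of_int n * om k x * F x))"

text \<open>The component \<open>(\<nabla>\<^sup>k G)(h\<^bsub>w\<^esub>)\<close>, cf. lemma \<open>contr_cov\<close> below.\<close>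
primrec frame_deriv ::
  "(sign \<Rightarrow> 2 \<Rightarrow> real^2 \<Rightarrow> complex) \<Rightarrow> (2 \<Rightarrow> real^2 \<Rightarrow> complex) \<Rightarrow> sign list \<Rightarrow>
    (real^2 \<Rightarrow> complex) \<Rightarrow> real^2 \<Rightarrow> complex" where
  "frame_deriv H om [] G = G"
| "frame_deriv H om (s # w) G = spin_deriv H om (charge w) s (frame_deriv H om w G)"

lemma spin_deriv_cong:
  assumes "open V" "x \<in> V" "\<And>y. y \<in> V \<Longrightarrow> F y = G y"
  shows "spin_deriv H om n s F x = spin_deriv H om n s G x"
proof -
  have "pd k F x = pd k G x" for k by (rule pd_cong[OF assms])
  then show ?thesis unfolding spin_deriv_def using assms(2,3) by simp
qed

lemma spin_deriv_cmult:
  assumes "F differentiable (at x)"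
  shows "spin_deriv H om n s (\<lambda>y. k * F y) x = k * spin_deriv H om n s F x"
proof -
  have "pd i (\<lambda>y. k * F y) x = k * pd i F x" for i
    by (rule pd_bounded_linear[OF bounded_linear_mult_right assms])
  then show ?thesis unfolding spin_deriv_def by (simp add: sum_distrib_left algebra_simps)
qed

lemma spin_deriv_add:
  assumes "F differentiable (at x)" "G differentiable (at x)"
  shows "spin_deriv H om n s (\<lambda>y. F y + G y) x = spin_deriv H om n s F x + spin_deriv H om n s G x"
  unfolding spin_deriv_def pd_add[OF assms] by (simp add: sum_2 algebra_simps)

text \<open>A letter sees the charge of everything to its right, and a balanced \<open>v\<close>
  adds nothing to it. For unbalanced \<open>v\<close> the connection terms of the two sides may
  differ.\<close>

lemma frame_deriv_append:
  assumes "balanced v"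
  shows "frame_deriv H om (w @ v) G = frame_deriv H om w (frame_deriv H om v G)"
  using assms by (induction w) (auto simp: balanced_iff)

lemma frame_deriv_cong:
  assumes "open V" "\<And>y. y \<in> V \<Longrightarrow> F y = G y"
  shows "x \<in> V \<Longrightarrow> frame_deriv H om w F x = frame_deriv H om w G x"
proof (induction w arbitrary: x)
  case Nil
  then show ?case using assms(2) by simp
next
  case (Cons s w)
  then show ?case using spin_deriv_cong[OF assms(1) Cons.prems Cons.IH] by simp
qed

text \<open>A one-sided inverse of a 2x2 matrix is two-sided. It is spelled out in scalars because
  rows are indexed by signs and columns by coordinates.\<close>

lemma inverse_2x2:
  fixes a b a' b' p q r s :: "'k::field"
  assumes "a * p + b * r = 1" "a * q + b * s = 0" "a' * p + b' * r = 0" "a' * q + b' * s = 1"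
  shows "p * a + q * a' = 1" "p * b + q * b' = 0" "r * a + s * a' = 0" "r * b + s * b' = 1"
    "(a * b' - b * a') * (p * s - q * r) = 1"
proof -
  let ?D = "a * b' - b * a'"
  have "?D * (p * s - q * r) = (a * p + b * r) * (a' * q + b' * s) - (a * q + b * s) * (a' * p + b' * r)"
    by (simp add: algebra_simps)
  then show D: "?D * (p * s - q * r) = 1" using assms by simp
  then have D0: "?D \<noteq> 0" by auto
  have "p * ?D = b' * (a * p + b * r) - b * (a' * p + b' * r)"
    "r * ?D = a * (a' * p + b' * r) - a' * (a * p + b * r)"
    "q * ?D = b' * (a * q + b * s) - b * (a' * q + b' * s)"
    "s * ?D = a * (a' * q + b' * s) - a' * (a * q + b * s)"
    by (simp_all add: algebra_simps)
  then have c: "p * ?D = b'" "r * ?D = - a'" "q * ?D = - b" "s * ?D = a" using assms by simp_all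
  have "(p * a + q * a') * ?D = (p * ?D) * a + (q * ?D) * a'" "(p * b + q * b') * ?D = (p * ?D) * b + (q * ?D) * b'"
    "(r * a + s * a') * ?D = (r * ?D) * a + (s * ?D) * a'" "(r * b + s * b') * ?D = (r * ?D) * b + (s * ?D) * b'"
    by (simp_all add: algebra_simps)
  then have "(p * a + q * a') * ?D = 1 * ?D" "(p * b + q * b') * ?D = 0"
    "(r * a + s * a') * ?D = 0" "(r * b + s * b') * ?D = 1 * ?D"
    unfolding c by (simp_all add: algebra_simps)
  then show "p * a + q * a' = 1" "p * b + q * b' = 0" "r * a + s * a' = 0" "r * b + s * b' = 1"
    using D0 by (simp_all only: mult_cancel_right mult_eq_0_iff) auto
qed

section \<open>Null frames and their connection form\<close>

locale framed_chart = coord_chart R c for R :: "('a::{t2_space,second_countable_topology}) riem" and c +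
  fixes H :: "sign \<Rightarrow> 2 \<Rightarrow> real^2 \<Rightarrow> complex"
  assumes H_smooth: "smooth_on W (H s i)"
    and H_null: "x \<in> W \<Longrightarrow> (\<Sum>i\<in>UNIV. \<Sum>j\<in>UNIV. of_real (gg i j x) * H s i x * H t j x)
        = (if s = t then 0 else 2)"
begin

text \<open>The dual coframe: as \<open>h_s\<close> is null and pairs to 2 with
  \<open>h_(neg s)\<close>, half the pairing with the latter reads off the coefficient of
  \<open>h_s\<close>.\<close>

definition dual :: "sign \<Rightarrow> 2 \<Rightarrow> real^2 \<Rightarrow> complex" where
  "dual s i x = 1/2 * (\<Sum>j\<in>UNIV. of_real (gg i j x) * H (neg s) j x)"

text \<open>Component \<open>i\<close> of the covariant derivative of \<open>h_s\<close> along the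
  \<open>k\<close>-th coordinate.\<close>

definition nab :: "2 \<Rightarrow> sign \<Rightarrow> 2 \<Rightarrow> real^2 \<Rightarrow> complex" where
  "nab k s i x = pd k (H s i) x + (\<Sum>n\<in>UNIV. of_real (chr i k n x) * H s n x)"

text \<open>The connection form, as the coefficient of \<open>h_+\<close> in the covariant
  derivative of \<open>h_+\<close>.\<close>

definition om :: "2 \<Rightarrow> real^2 \<Rightarrow> complex" where
  "om k x = 1/2 * (\<Sum>i\<in>UNIV. \<Sum>j\<in>UNIV. of_real (gg i j x) * nab k Plus i x * H Minus j x)"

lemma H_differentiable: "x \<in> W \<Longrightarrow> H s i differentiable (at x)"
  by (rule smooth_on_differentiable[OF H_smooth])

lemma nab_smooth: "smooth_on W (nab k s i)"
  unfolding nab_def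
  by (intro smooth_on_add smooth_on_sum smooth_on_mult smooth_on_pd smooth_on_of_real H_smooth
      chr_smooth open_W)

lemma om_smooth: "smooth_on W (om k)"
  unfolding om_def
  by (intro smooth_on_cnst_mult smooth_on_sum smooth_on_mult smooth_on_of_real H_smooth
      gg_smooth nab_smooth open_W)

lemma dual_smooth: "smooth_on W (dual s i)"
  unfolding dual_def
  by (intro smooth_on_cnst_mult smooth_on_sum smooth_on_mult smooth_on_of_real H_smooth
      gg_smooth open_W)

lemma gg_H: "(\<Sum>j\<in>UNIV. of_real (gg i j x) * H s j x) = 2 * dual (neg s) i x"
  by (simp add: dual_def)

lemma dual_H:
  assumes "x \<in> W" shows "(\<Sum>i\<in>UNIV. dual s i x * H t i x) = (if s = t then 1 else 0)"
proof -
  have "(\<Sum>i\<in>UNIV. dual s i x * H t i x)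
      = 1/2 * (\<Sum>i\<in>UNIV. \<Sum>j\<in>UNIV. of_real (gg i j x) * H t i x * H (neg s) j x)"
    by (simp add: dual_def sum_distrib_left sum_distrib_right mult_ac)
  also have "\<dots> = (if s = t then 1 else 0)"
    unfolding H_null[OF assms] by (cases s; cases t) auto
  finally show ?thesis .
qed

lemma H_dual_explicit:
  assumes "x \<in> W"
  shows "dual Plus 1 x * H Plus 1 x + dual Plus 2 x * H Plus 2 x = 1"
    "dual Plus 1 x * H Minus 1 x + dual Plus 2 x * H Minus 2 x = 0"
    "dual Minus 1 x * H Plus 1 x + dual Minus 2 x * H Plus 2 x = 0"
    "dual Minus 1 x * H Minus 1 x + dual Minus 2 x * H Minus 2 x = 1"
  using dual_H[OF assms, of Plus Plus] dual_H[OF assms, of Plus Minus]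
    dual_H[OF assms, of Minus Plus] dual_H[OF assms, of Minus Minus] by (simp_all add: sum_2)

lemma H_dual:
  assumes "x \<in> W" shows "(\<Sum>s\<in>UNIV. dual s i x * H s j x) = (if i = j then 1 else 0)"
  using inverse_2x2[OF H_dual_explicit[OF assms]] exhaust_2[of i] exhaust_2[of j]
  by (auto simp: sum_sign mult.commute)

lemma det_dual_H:
  assumes "x \<in> W"
  shows "(dual Plus 1 x * dual Minus 2 x - dual Minus 1 x * dual Plus 2 x)
    * (H Plus 1 x * H Minus 2 x - H Plus 2 x * H Minus 1 x) = 1"
  using inverse_2x2(5)[OF H_dual_explicit[OF assms]] by (simp add: algebra_simps)

text \<open>The Gram matrix of the frame is constant. In its derivative, metric compatibility turns
  the derivatives of \<open>gg\<close> into the Christoffel terms of \<open>nab\<close>.\<close>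

lemma nab_skew:
  assumes x: "x \<in> W"
  shows "(\<Sum>i\<in>UNIV. \<Sum>j\<in>UNIV. of_real (gg i j x) * nab k s i x * H t j x)
    + (\<Sum>i\<in>UNIV. \<Sum>j\<in>UNIV. of_real (gg i j x) * H s i x * nab k t j x) = 0"
proof -
  define Q where "Q = (\<lambda>x. \<Sum>i\<in>UNIV. \<Sum>j\<in>UNIV. of_real (gg i j x) * H s i x * H t j x)"
  have g: "(\<lambda>x. of_real (gg i j x) :: complex) differentiable (at x)" for i j
    by (rule smooth_on_differentiable[OF smooth_on_of_real[OF open_W gg_smooth] x])
  have pg: "pd k (\<lambda>x. of_real (gg i j x) :: complex) x = of_real (pd k (gg i j) x)" for i j
    by (rule pd_bounded_linear[OF bounded_linear_of_real smooth_on_differentiable[OF gg_smooth x]])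
  have d1: "(\<lambda>x. of_real (gg i j x) * H s i x) differentiable (at x)" for i j
    by (rule differentiable_mult[OF g H_differentiable[OF x]])
  have d2: "(\<lambda>x. of_real (gg i j x) * H s i x * H t j x) differentiable (at x)" for i j
    by (rule differentiable_mult[OF d1 H_differentiable[OF x]])
  have t: "pd k (\<lambda>x. of_real (gg i j x) * H s i x * H t j x) x =
      of_real (gg i j x) * H s i x * pd k (H t j) x + of_real (gg i j x) * pd k (H s i) x * H t j x
      + of_real (pd k (gg i j) x) * H s i x * H t j x" for i j
    unfolding pd_mult[OF d1 H_differentiable[OF x]] pd_mult[OF g H_differentiable[OF x]] pg
    by (simp add: algebra_simps)
  have "pd k Q x = (\<Sum>i\<in>UNIV. \<Sum>j\<in>UNIV. pd k (\<lambda>x. of_real (gg i j x) * H s i x * H t j x) x)"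
    unfolding Q_def by (subst pd_sum | intro differentiable_sum ballI d2 finite | simp)+
  moreover have "pd k Q x = pd k (\<lambda>x. if s = t then 0 else 2) x"
    unfolding Q_def by (rule pd_cong[OF open_W x H_null])
  ultimately have "(\<Sum>i\<in>UNIV. \<Sum>j\<in>UNIV. of_real (gg i j x) * H s i x * pd k (H t j) x
      + of_real (gg i j x) * pd k (H s i) x * H t j x
      + of_real (pd k (gg i j) x) * H s i x * H t j x) = 0"
    unfolding t by simp
  then show ?thesis
    unfolding pd_gg[OF x] nab_def sum_2 using gg_sym[OF x, of 1 2]
    by (simp add: algebra_simps)
qed

text \<open>The matrix \<open>A\<close> of the connection in the frame is skew for the metric. Hence
  \<open>A s s = 0\<close>, so the derivative of \<open>h_s\<close> has no component along the other
  null direction, and the two remaining entries are opposite.\<close>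

lemma nab_eq:
  assumes x: "x \<in> W"
  shows "nab k s i x = of_int (sg s) * om k x * H s i x"
proof -
  define A where "A s t = (\<Sum>i\<in>UNIV. \<Sum>j\<in>UNIV. of_real (gg i j x) * nab k s i x * H t j x)" for s t
  have skew: "A s t + A t s = 0" for s t
  proof -
    have "(\<Sum>i\<in>UNIV. \<Sum>j\<in>UNIV. of_real (gg i j x) * H s i x * nab k t j x) = A t s"
      unfolding A_def by (subst sum.swap) (simp add: gg_sym[OF x, of 1 2] sum_2 mult_ac)
    with nab_skew[OF x, of k s t] show ?thesis unfolding A_def by simp
  qed
  have dA: "(\<Sum>j\<in>UNIV. dual t j x * nab k s j x) = 1/2 * A s (neg t)" for s t
    unfolding A_def dual_def by (simp add: sum_distrib_left sum_distrib_right mult_ac)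
  have "nab k s i x = (\<Sum>j\<in>UNIV. (\<Sum>t\<in>UNIV. dual t j x * H t i x) * nab k s j x)"
    unfolding H_dual[OF x] by (simp add: if_distrib[of "\<lambda>z. z * _"] cong: if_cong)
  also have "\<dots> = (\<Sum>t\<in>UNIV. (\<Sum>j\<in>UNIV. dual t j x * nab k s j x) * H t i x)"
    by (simp add: sum_2 sum_sign algebra_simps)
  also have "\<dots> = 1/2 * A s Minus * H Plus i x + 1/2 * A s Plus * H Minus i x"
    unfolding dA by (simp add: sum_sign)
  finally have e: "nab k s i x = 1/2 * A s Minus * H Plus i x + 1/2 * A s Plus * H Minus i x" .
  have "A s s = 0" for s using skew[of s s] by simp
  moreover have "1/2 * A Plus Minus = om k x" unfolding A_def om_def ..
  moreover have "A Minus Plus = - A Plus Minus" using skew[of Plus Minus] by (simp add: add_eq_0_iff2)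
  ultimately show ?thesis using e by (cases s) auto
qed

lemma pd_H:
  assumes x: "x \<in> W"
  shows "pd k (H s i) x = of_int (sg s) * om k x * H s i x - (\<Sum>n\<in>UNIV. of_real (chr i k n x) * H s n x)"
  using nab_eq[OF x, of k s i] unfolding nab_def by (simp add: algebra_simps)

lemma pd_dual:
  assumes x: "x \<in> W"
  shows "pd k (dual s i) x = - of_int (sg s) * om k x * dual s i x
    + (\<Sum>n\<in>UNIV. of_real (chr n k i x) * dual s n x)"
proof -
  have g: "(\<lambda>x. of_real (gg i j x) :: complex) differentiable (at x)" for i j
    by (rule smooth_on_differentiable[OF smooth_on_of_real[OF open_W gg_smooth] x])
  have pg: "pd k (\<lambda>x. of_real (gg i j x) :: complex) x = of_real (pd k (gg i j) x)" for i j
    by (rule pd_bounded_linear[OF bounded_linear_of_real smooth_on_differentiable[OF gg_smooth x]])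
  have d: "(\<lambda>x. of_real (gg i j x) * H s j x) differentiable (at x)" for s j
    by (rule differentiable_mult[OF g H_differentiable[OF x]])
  have sd: "(\<lambda>x. \<Sum>j\<in>UNIV. of_real (gg i j x) * H (neg s) j x) differentiable (at x)"
    by (intro differentiable_sum ballI d finite)
  have "pd k (dual s i) x = 1/2 * (\<Sum>j\<in>UNIV. pd k (\<lambda>x. of_real (gg i j x) * H (neg s) j x) x)"
    unfolding dual_def using pd_bounded_linear[OF bounded_linear_mult_right sd, of k "1/2"] pd_sum[of UNIV, OF d]
    by simp
  also have "\<dots> = 1/2 * (\<Sum>j\<in>UNIV. of_real (gg i j x) * pd k (H (neg s) j) x
      + of_real (pd k (gg i j) x) * H (neg s) j x)"
    unfolding pd_mult[OF g H_differentiable[OF x]] pg ..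
  also have "\<dots> = - of_int (sg s) * om k x * dual s i x
    + (\<Sum>n\<in>UNIV. of_real (chr n k i x) * dual s n x)"
    unfolding pd_gg[OF x] pd_H[OF x] dual_def sum_2 sg_neg
    by (simp add: algebra_simps)
  finally show ?thesis .
qed

end

section \<open>Curvature and the commutation of opposite letters\<close>

lemma pd_diff:
  assumes "F differentiable (at x)" "G differentiable (at x)"
  shows "pd i (\<lambda>x. F x - G x) x = pd i F x - pd i G x"
  using pd_eqI[OF has_derivative_diff[OF assms[unfolded frechet_derivative_works]]]
  by (simp add: pd_def)

lemma pd_cmult:
  fixes k :: "'b::real_normed_algebra"
  assumes "F differentiable (at x)"
  shows "pd i (\<lambda>x. k * F x) x = k * pd i F x"
  by (rule pd_bounded_linear[OF bounded_linear_mult_right assms])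

lemma spin_deriv_smooth:
  assumes "open V" "\<And>i. smooth_on V (H s i)" "\<And>k. smooth_on V (om k)" "smooth_on V F"
  shows "smooth_on V (spin_deriv H om n s F)"
  unfolding spin_deriv_def
  by (intro smooth_on_sum smooth_on_mult smooth_on_diff smooth_on_pd smooth_on_cnst_mult assms)

lemma frame_deriv_smooth_on:
  assumes "open V" "\<And>s i. smooth_on V (H s i)" "\<And>k. smooth_on V (om k)" "smooth_on V G"
  shows "smooth_on V (frame_deriv H om w G)"
  by (induction w) (auto intro: spin_deriv_smooth assms)

context framed_chart
begin

lemma frame_deriv_smooth:
  assumes "open V" "V \<subseteq> W" "smooth_on V G"
  shows "smooth_on V (frame_deriv H om w G)"
  by (intro frame_deriv_smooth_on assms smooth_on_subset[OF H_smooth] smooth_on_subset[OF om_smooth])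

lemma om_differentiable: "x \<in> W \<Longrightarrow> om k differentiable (at x)"
  by (rule smooth_on_differentiable[OF om_smooth])

text \<open>Second derivatives of the frame commute. After inserting \<open>pd_H\<close> twice, the
  terms quadratic in \<open>om\<close> cancel because the frame rotates by scalars, and only the
  curl of \<open>om\<close> is left to balance the curvature.\<close>

lemma curvature_H:
  assumes x: "x \<in> W"
  shows "(\<Sum>n\<in>UNIV. of_real (curvature R c l n k m x) * H s n x)
    = of_int (sg s) * (pd k (om m) x - pd m (om k) x) * H s l x"
proof -
  define E where "E m y = of_int (sg s) * (om m y * H s l y) - (\<Sum>n\<in>UNIV. of_real (chr l m n y) * H s n y)" for m y
  note dH = H_differentiable[OF x] and dom = om_differentiable[OF x]
  have dc: "(\<lambda>y. of_real (chr l m n y) :: complex) differentiable (at x)" for l m n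
    by (rule smooth_on_differentiable[OF smooth_on_of_real[OF open_W chr_smooth] x])
  have pc: "pd k (\<lambda>y. of_real (chr l m n y) :: complex) x = of_real (pd k (chr l m n) x)" for k l m n
    by (rule pd_bounded_linear[OF bounded_linear_of_real smooth_on_differentiable[OF chr_smooth x]])
  have d1: "(\<lambda>y. om m y * H s l y) differentiable (at x)" for m by (rule differentiable_mult[OF dom dH])
  have d2: "(\<lambda>y. of_real (chr l m n y) * H s n y) differentiable (at x)" for m n
    by (rule differentiable_mult[OF dc dH])
  have d3: "(\<lambda>y. \<Sum>n\<in>UNIV. of_real (chr l m n y) * H s n y) differentiable (at x)" for m
    by (intro differentiable_sum ballI d2 finite)
  have d4: "(\<lambda>y. of_int (sg s) * (om m y * H s l y)) differentiable (at x)" for m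
    by (intro differentiable_mult d1 differentiable_const)
  have E: "pd k (E m) x = of_int (sg s) * (om m x * pd k (H s l) x + pd k (om m) x * H s l x)
      - (\<Sum>n\<in>UNIV. of_real (chr l m n x) * pd k (H s n) x + of_real (pd k (chr l m n) x) * H s n x)" for k m
    unfolding E_def pd_diff[OF d4 d3] pd_cmult[OF d1] pd_sum[of UNIV, OF d2] pd_mult[OF dom dH]
      pd_mult[OF dc dH] pc ..
  have pE: "pd k (pd m (H s l)) x = pd k (E m) x" for k m
    by (rule pd_cong[OF open_W x]) (simp add: E_def pd_H)
  have "pd k (E m) x = pd m (E k) x"
    using pd_commute[OF open_W x H_smooth[of s l], of k m] unfolding pE .
  then show ?thesis
    unfolding E pd_H[OF x] curvature_def sum_2 by (simp add: algebra_simps)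
qed

text \<open>The only coordinate component of d om in dimension two.\<close>

definition rho :: "real^2 \<Rightarrow> complex" where
  "rho x = pd 1 (om 2) x - pd 2 (om 1) x"

lemma gg_dual:
  assumes x: "x \<in> W"
  shows "of_real (gg i j x) = 2 * (dual Plus j x * dual Minus i x + dual Minus j x * dual Plus i x)"
proof -
  have "of_real (gg i j x) = (\<Sum>l\<in>UNIV. of_real (gg i l x) * (\<Sum>s\<in>UNIV. dual s j x * H s l x))"
    unfolding H_dual[OF x] by (simp add: if_distrib cong: if_cong)
  also have "\<dots> = (\<Sum>s\<in>UNIV. dual s j x * (\<Sum>l\<in>UNIV. of_real (gg i l x) * H s l x))"
    by (simp add: sum_2 sum_sign algebra_simps)
  also have "\<dots> = 2 * (dual Plus j x * dual Minus i x + dual Minus j x * dual Plus i x)"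
    unfolding gg_H by (simp add: sum_sign)
  finally show ?thesis .
qed

text \<open>The left side is d om evaluated on \<open>h_+\<close>, \<open>h_-\<close>, and the
  factor 2 is their scalar product. The determinant \<delta> of the coframe is reciprocal to that of
  the frame, and the metric determinant equals -4 \<delta>^2.\<close>

lemma rho_eq:
  assumes x: "x \<in> W" and K: "sectional_curvature R c (chart_inv c x) = K"
  shows "rho x * (H Plus 1 x * H Minus 2 x - H Plus 2 x * H Minus 1 x) = 2 * of_real K"
proof -
  define \<delta> where "\<delta> = dual Plus 1 x * dual Minus 2 x - dual Minus 1 x * dual Plus 2 x"
  define h where "h = H Plus 1 x * H Minus 2 x - H Plus 2 x * H Minus 1 x"
  have \<delta>h: "\<delta> * h = 1" unfolding \<delta>_def h_def by (rule det_dual_H[OF x])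
  then have \<delta>0: "\<delta> \<noteq> 0" by auto
  let ?C = "\<lambda>l. of_real (curvature R c l 2 1 2 x) :: complex"
  have C: "?C l = rho x * (dual Plus 2 x * H Plus l x - dual Minus 2 x * H Minus l x)" for l
  proof -
    have "?C l = (\<Sum>n\<in>UNIV. of_real (curvature R c l n 1 2 x) * (\<Sum>s\<in>UNIV. dual s 2 x * H s n x))"
      unfolding H_dual[OF x] by (simp add: if_distrib cong: if_cong)
    also have "\<dots> = (\<Sum>s\<in>UNIV. dual s 2 x * (\<Sum>n\<in>UNIV. of_real (curvature R c l n 1 2 x) * H s n x))"
      by (simp add: sum_2 sum_sign algebra_simps)
    also have "\<dots> = rho x * (dual Plus 2 x * H Plus l x - dual Minus 2 x * H Minus l x)"
      unfolding curvature_H[OF x] rho_def by (simp add: sum_sign algebra_simps)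
    finally show ?thesis .
  qed
  have detg: "of_real (det (metric R c (chart_inv c x))) = - 4 * \<delta> * \<delta>"
    unfolding det_2 gg_def[symmetric] of_real_diff of_real_mult gg_dual[OF x] \<delta>_def
    by (simp add: algebra_simps)
  have "(\<Sum>l\<in>UNIV. gg l 1 x * curvature R c l 2 1 2 x) = K * det (metric R c (chart_inv c x))"
    using K metric_det_pos[OF inv_in_dom[OF x]] x unfolding sectional_curvature_def gg_def
    by (simp add: field_simps)
  then have "of_real (\<Sum>l\<in>UNIV. gg l 1 x * curvature R c l 2 1 2 x)
      = (of_real (K * det (metric R c (chart_inv c x))) :: complex)" by simp
  then have "(\<Sum>l\<in>UNIV. of_real (gg 1 l x) * ?C l) = of_real K * (- 4 * \<delta> * \<delta>)"
    unfolding of_real_mult of_real_sum detg using gg_sym[OF x, of 1] by simp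
  moreover have "(\<Sum>l\<in>UNIV. of_real (gg 1 l x) * ?C l) = rho x *
      (dual Plus 2 x * (\<Sum>l\<in>UNIV. of_real (gg 1 l x) * H Plus l x)
        - dual Minus 2 x * (\<Sum>l\<in>UNIV. of_real (gg 1 l x) * H Minus l x))"
    unfolding C by (simp add: sum_2 algebra_simps)
  moreover have "\<dots> = - 2 * rho x * \<delta>" unfolding gg_H \<delta>_def by (simp add: algebra_simps)
  ultimately have "- 2 * rho x * \<delta> = of_real K * (- 4 * \<delta> * \<delta>)" by simp
  then have "(- 2 * \<delta>) * rho x = (- 2 * \<delta>) * (2 * of_real K * \<delta>)" by (simp add: algebra_simps)
  then have "rho x = 2 * of_real K * \<delta>" using \<delta>0 by simp
  then have "rho x * h = 2 * of_real K * (\<delta> * h)" by (simp only: mult.assoc)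
  also have "\<dots> = 2 * of_real K" unfolding \<delta>h by simp
  finally show ?thesis unfolding h_def .
qed

text \<open>The part \<open>sg t\<close> of the outer weight is consumed by the derivative of
  \<open>H t\<close>, so that only \<open>n\<close> remains. In this form everything except
  \<open>pd m (om k)\<close> is symmetric under exchange of the two directions.\<close>

lemma second_spin_deriv:
  fixes n :: int
  assumes V: "open V" "V \<subseteq> W" "x \<in> V" and F: "smooth_on V F"
  defines "E \<equiv> (\<lambda>k y. pd k F y - of_int n * om k y * F y)"
  shows "spin_deriv H om (n + sg t) s (spin_deriv H om n t F) x =
    (\<Sum>m\<in>UNIV. \<Sum>k\<in>UNIV. H s m x * H t k x * (pd m (pd k F) x
       - of_int n * (pd m (om k) x * F x + om k x * pd m F x) - of_int n * om m x * E k x))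
    - (\<Sum>m\<in>UNIV. \<Sum>k\<in>UNIV. \<Sum>r\<in>UNIV. H s m x * of_real (chr k m r x) * H t r x * E k x)"
proof -
  have x: "x \<in> W" using V by blast
  note dF = smooth_on_differentiable[OF F V(3)]
    and dpF = smooth_on_differentiable[OF smooth_on_pd[OF F] V(3)]
    and dom = om_differentiable[OF x] and dH = H_differentiable[OF x]
  have d1: "(\<lambda>y. om k y * F y) differentiable (at x)" for k by (rule differentiable_mult[OF dom dF])
  have d2: "(\<lambda>y. of_int n * (om k y * F y)) differentiable (at x)" for k
    by (intro differentiable_mult d1 differentiable_const)
  have E': "E k = (\<lambda>y. pd k F y - of_int n * (om k y * F y))" for k
    unfolding E_def by (simp add: mult.assoc)
  have dE: "E k differentiable (at x)" for k unfolding E' by (rule differentiable_diff[OF dpF d2])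
  have pE: "pd m (E k) x = pd m (pd k F) x - of_int n * (om k x * pd m F x + pd m (om k) x * F x)" for m k
    unfolding E' pd_diff[OF dpF d2] pd_cmult[OF d1] pd_mult[OF dom dF] ..
  have d3: "(\<lambda>y. H t k y * E k y) differentiable (at x)" for k by (rule differentiable_mult[OF dH dE])
  have S: "spin_deriv H om n t F = (\<lambda>y. \<Sum>k\<in>UNIV. H t k y * E k y)"
    unfolding spin_deriv_def E_def ..
  have pS: "pd m (spin_deriv H om n t F) x = (\<Sum>k\<in>UNIV. H t k x * pd m (E k) x + pd m (H t k) x * E k x)" for m
    unfolding S pd_sum[of UNIV, OF d3] pd_mult[OF dH dE] ..
  have v: "spin_deriv H om n t F x = (\<Sum>k\<in>UNIV. H t k x * E k x)" unfolding S ..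
  show ?thesis
    unfolding spin_deriv_def[of H om "n + sg t" s "spin_deriv H om n t F"] pS v pE pd_H[OF x] sum_2
    by (simp add: algebra_simps)
qed

lemma spin_deriv_commute:
  assumes V: "open V" "V \<subseteq> W" "x \<in> V" and F: "smooth_on V F"
    and K: "sectional_curvature R c (chart_inv c x) = K"
  shows "spin_deriv H om (n - sg s) s (spin_deriv H om n (neg s) F) x
    = spin_deriv H om (n + sg s) (neg s) (spin_deriv H om n s F) x
      - of_int (sg s * n) * 2 * of_real K * F x"
proof -
  have x: "x \<in> W" using V by blast
  \<comment> \<open>Symmetry of the second derivatives of \<open>F\<close> and of the lower
    Christoffel indices removes all but the curl of \<open>om\<close>.\<close>
  have "spin_deriv H om (n + sg Minus) Plus (spin_deriv H om n Minus F) x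
      - spin_deriv H om (n + sg Plus) Minus (spin_deriv H om n Plus F) x
      = - of_int n * (rho x * (H Plus 1 x * H Minus 2 x - H Plus 2 x * H Minus 1 x)) * F x"
    unfolding second_spin_deriv[OF V F] rho_def sum_2
    using pd_commute[OF V(1,3) F, of 1 2] chr_sym[OF x, of _ 1 2]
    by (simp add: algebra_simps)
  then have "spin_deriv H om (n + sg Minus) Plus (spin_deriv H om n Minus F) x
      - spin_deriv H om (n + sg Plus) Minus (spin_deriv H om n Plus F) x
      = - of_int n * (2 * of_real K) * F x" unfolding rho_eq[OF x K] .
  then show ?thesis by (cases s) (auto simp: algebra_simps)
qed

end

section \<open>Contraction of tensor components with a frame\<close>

primrec contr :: "(sign \<Rightarrow> 2 \<Rightarrow> complex) \<Rightarrow> sign list \<Rightarrow> (2 list \<Rightarrow> complex) \<Rightarrow> complex" where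
  "contr A [] T = T []"
| "contr A (s # w) T = (\<Sum>j\<in>UNIV. A s j * contr A w (\<lambda>I. T (j # I)))"

text \<open>With \<open>C l j = \<Gamma>\<^sup>l\<^bsub>kj\<^esub>\<close> the covariant derivative of components in direction \<open>k\<close> is
  \<open>pd k\<close> minus \<open>slot_act C\<close>.\<close>
primrec slot_act :: "(2 \<Rightarrow> 2 \<Rightarrow> complex) \<Rightarrow> 2 list \<Rightarrow> (2 list \<Rightarrow> complex) \<Rightarrow> complex" where
  "slot_act C [] T = 0"
| "slot_act C (j # I) T = (\<Sum>l\<in>UNIV. C l j * T (l # I)) + slot_act C I (\<lambda>J. T (j # J))"

lemma slot_act_eq:
  "slot_act C I T = (\<Sum>m<length I. \<Sum>l\<in>UNIV. C l (I ! m) * T (I[m := l]))"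
proof (induction I arbitrary: T)
  case (Cons j I)
  show ?case by (simp add: Cons sum.lessThan_Suc_shift del: sum.lessThan_Suc)
qed simp

lemma contr_add: "contr A w (\<lambda>I. S I + T I) = contr A w S + contr A w T"
  by (induction w arbitrary: S T) (simp_all add: sum.distrib algebra_simps)

lemma contr_cmult: "contr A w (\<lambda>I. k * T I) = k * contr A w T"
  by (induction w arbitrary: T) (simp_all add: sum_distrib_left algebra_simps)

lemma contr_diff: "contr A w (\<lambda>I. S I - T I) = contr A w S - contr A w T"
  using contr_add[of A w S "\<lambda>I. - T I"] contr_cmult[of A w "-1" T] by simp

lemma contr_0: "contr A w (\<lambda>I. 0) = 0"
  using contr_cmult[of A w 0 "\<lambda>I. 0"] by simp

lemma contr_sum: "contr A w (\<lambda>I. \<Sum>a\<in>S. T a I) = (\<Sum>a\<in>S. contr A w (T a))"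
  by (induction S rule: infinite_finite_induct) (simp_all add: contr_add contr_0)

lemma contr_cong:
  "(\<And>I. length I = length w \<Longrightarrow> S I = T I) \<Longrightarrow> contr A w S = contr A w T"
proof (induction w arbitrary: S T)
  case (Cons s w)
  have "contr A w (\<lambda>I. S (j # I)) = contr A w (\<lambda>I. T (j # I))" for j
    by (rule Cons.IH) (simp add: Cons.prems)
  then show ?case by simp
qed simp

lemma sum_lists_Suc:
  fixes F :: "'k::finite list \<Rightarrow> 'b::comm_monoid_add"
  shows "(\<Sum>I | length I = Suc n. F I) = (\<Sum>j\<in>UNIV. \<Sum>I | length I = n. F (j # I))"
proof -
  have eq: "{I. length I = Suc n} = (\<lambda>(j, I). j # I) ` (UNIV \<times> {I :: 'k list. length I = n})"
    by (auto simp: length_Suc_conv image_def)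
  have "inj_on (\<lambda>(j, I). j # I) (UNIV \<times> {I :: 'k list. length I = n})"
    by (auto simp: inj_on_def)
  then have "(\<Sum>I | length I = Suc n. F I) = (\<Sum>(j, I)\<in>UNIV \<times> {I :: 'k list. length I = n}. F (j # I))"
    unfolding eq by (subst sum.reindex) (simp_all add: case_prod_unfold)
  then show ?thesis by (simp add: sum.cartesian_product)
qed

text \<open>The recursion of \<open>contr\<close> serves inductions over words; the closed form
  links it to the index sums in the definitions.\<close>

lemma contr_eq_sum:
  "contr A w T = (\<Sum>I | length I = length w. (\<Prod>m<length w. A (w ! m) (I ! m)) * T I)"
proof (induction w arbitrary: T)
  case (Cons s w)
  show ?case
    unfolding contr.simps Cons length_Cons sum_lists_Suc
    by (simp add: prod.lessThan_Suc_shift sum_distrib_left mult.assoc del: prod.lessThan_Suc)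
qed (simp)

lemma contr_differentiable:
  assumes "\<And>s j. A s j differentiable (at x)" "\<And>I. T I differentiable (at x)"
  shows "(\<lambda>x. contr (\<lambda>s j. A s j x) w (\<lambda>I. T I x)) differentiable (at x)"
  using assms(2) by (induction w arbitrary: T) (auto intro!: differentiable_sum differentiable_mult assms(1))

text \<open>Leibniz rule for a frame whose covariant derivatives are multiples \<tau> of its
  members, so the multiples add up along \<open>w\<close>. The matrix \<open>C\<close> is kept
  abstract because the rule serves vectors with lower-index tensors and covectors with upper-index
  ones.\<close>

lemma pd_contr:
  fixes A :: "sign \<Rightarrow> 2 \<Rightarrow> real^2 \<Rightarrow> complex"
  assumes A: "\<And>s j. A s j differentiable (at x)" and T: "\<And>I. T I differentiable (at x)"
    and pA: "\<And>s j. pd k (A s j) x = \<tau> s * A s j x - (\<Sum>n\<in>UNIV. C j n * A s n x)"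
  shows "pd k (\<lambda>x. contr (\<lambda>s j. A s j x) w (\<lambda>I. T I x)) x =
    contr (\<lambda>s j. A s j x) w (\<lambda>I. pd k (T I) x - slot_act C I (\<lambda>I. T I x))
    + (\<Sum>s\<leftarrow>w. \<tau> s) * contr (\<lambda>s j. A s j x) w (\<lambda>I. T I x)"
  using T
proof (induction w arbitrary: T)
  case (Cons s w)
  let ?c = "\<lambda>T. contr (\<lambda>s j. A s j x) w T"
  have d: "(\<lambda>x. contr (\<lambda>s j. A s j x) w (\<lambda>I. T (j # I) x)) differentiable (at x)" for j
    by (rule contr_differentiable[OF A Cons.prems])
  have dd: "(\<lambda>x. A s j x * contr (\<lambda>s j. A s j x) w (\<lambda>I. T (j # I) x)) differentiable (at x)" for j
    by (rule differentiable_mult[OF A d])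
  have sw: "?c (\<lambda>I. pd k (T (j # I)) x - slot_act C (j # I) (\<lambda>I. T I x))
     = ?c (\<lambda>I. pd k (T (j # I)) x - slot_act C I (\<lambda>I. T (j # I) x)) - (\<Sum>l\<in>UNIV. C l j * ?c (\<lambda>I. T (l # I) x))" for j
    by (simp add: contr_diff contr_add contr_sum contr_cmult)
  have "pd k (\<lambda>x. contr (\<lambda>s j. A s j x) (s # w) (\<lambda>I. T I x)) x
      = (\<Sum>j\<in>UNIV. A s j x * pd k (\<lambda>x. contr (\<lambda>s j. A s j x) w (\<lambda>I. T (j # I) x)) x
        + pd k (A s j) x * ?c (\<lambda>I. T (j # I) x))"
    unfolding contr.simps pd_sum[of UNIV, OF dd] pd_mult[OF A d] ..
  also have "\<dots> = (\<Sum>j\<in>UNIV. A s j x * (?c (\<lambda>I. pd k (T (j # I)) x - slot_act C I (\<lambda>I. T (j # I) x))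
        + (\<Sum>s\<leftarrow>w. \<tau> s) * ?c (\<lambda>I. T (j # I) x))
        + (\<tau> s * A s j x - (\<Sum>n\<in>UNIV. C j n * A s n x)) * ?c (\<lambda>I. T (j # I) x))"
    unfolding Cons.IH[OF Cons.prems] pA ..
  also have "\<dots> = (\<Sum>j\<in>UNIV. A s j x * ?c (\<lambda>I. pd k (T (j # I)) x - slot_act C (j # I) (\<lambda>I. T I x)))
     + (\<Sum>s\<leftarrow>s # w. \<tau> s) * (\<Sum>j\<in>UNIV. A s j x * ?c (\<lambda>I. T (j # I) x))"
    unfolding sw by (simp add: sum_2 algebra_simps)
  finally show ?case unfolding contr.simps .
qed simp

lemma sum_list_sg: "(\<Sum>s\<leftarrow>w. of_int (sg s) * o') = of_int (charge w) * (o' :: complex)"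
  by (induction w) (simp_all add: algebra_simps)

context framed_chart
begin

lemma cov_Cons:
  "cov R c G (i # I) x = pd i (cov R c G I) x
    - slot_act (\<lambda>l j. of_real (chr l i j x)) I (\<lambda>I. cov R c G I x)"
  by (simp add: slot_act_eq)

lemma cov_smooth:
  assumes "open V" "V \<subseteq> W" "smooth_on V G"
  shows "smooth_on V (cov R c G I)"
\<comment> \<open>By length, because the recursion of \<open>cov\<close> also calls the lists
  \<open>I[m := l]\<close>.\<close>
proof (induction "length I" arbitrary: I)
  case 0
  then show ?case using assms(3) by simp
next
  case (Suc n)
  then obtain i J where I: "I = i # J" "length J = n" by (cases I) auto
  have "smooth_on V (cov R c G (J[m := l]))" "smooth_on V (cov R c G J)" for m l
    using Suc(1) I by auto
  then show ?case unfolding I cov.simps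
    by (intro smooth_on_diff smooth_on_sum smooth_on_mult smooth_on_pd smooth_on_of_real
        smooth_on_subset[OF chr_smooth assms(2)] assms(1))
qed

text \<open>By \<open>pd_contr\<close> each letter of \<open>w\<close> contributes
  \<open>sg s\<close> times \<open>om\<close>; the sum is the charge, the weight of the next
  \<open>spin_deriv\<close>.\<close>

lemma contr_cov:
  assumes V: "open V" "V \<subseteq> W" and G: "smooth_on V G"
  shows "x \<in> V \<Longrightarrow> contr (\<lambda>s j. H s j x) w (\<lambda>I. cov R c G I x) = frame_deriv H om w G x"
proof (induction w arbitrary: x)
  case (Cons s w)
  have x: "x \<in> W" using Cons.prems V by blast
  let ?c = "\<lambda>T. contr (\<lambda>s j. H s j x) w T"
  have "?c (\<lambda>I. cov R c G (k # I) x)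
      = pd k (frame_deriv H om w G) x - of_int (charge w) * om k x * frame_deriv H om w G x" for k
  proof -
    have "pd k (frame_deriv H om w G) x = pd k (\<lambda>x. contr (\<lambda>s j. H s j x) w (\<lambda>I. cov R c G I x)) x"
      by (rule pd_cong[OF V(1) Cons.prems Cons.IH[symmetric]])
    also have "\<dots> = ?c (\<lambda>I. cov R c G (k # I) x)
      + (\<Sum>s\<leftarrow>w. of_int (sg s) * om k x) * ?c (\<lambda>I. cov R c G I x)"
      unfolding cov_Cons
      by (intro pd_contr H_differentiable pd_H x smooth_on_differentiable[OF cov_smooth[OF V G]] Cons.prems)
    finally show ?thesis unfolding Cons.IH[OF Cons.prems] sum_list_sg by (simp add: algebra_simps)
  qed
  then show ?case by (simp add: spin_deriv_def)
qed simp

text \<open>The right side \<open>B\<close> is a right inverse of the metric: lowering an index of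
  \<open>H\<close> gives the coframe, and \<open>H_dual\<close> is completeness. A left inverse and
  a right inverse agree.\<close>

lemma ginv_H:
  assumes x: "x \<in> W"
  shows "of_real (ginv i j x) = 1/2 * (H Plus i x * H Minus j x + H Minus i x * H Plus j x)"
proof -
  define B where "B i j = 1/2 * (H Plus i x * H Minus j x + H Minus i x * H Plus j x)" for i j
  have gB: "(\<Sum>m\<in>UNIV. of_real (gg k m x) * B m j) = (if k = j then 1 else 0)" for k
  proof -
    have "(\<Sum>m\<in>UNIV. of_real (gg k m x) * B m j) = 1/2 * ((\<Sum>m\<in>UNIV. of_real (gg k m x) * H Plus m x) * H Minus j x
        + (\<Sum>m\<in>UNIV. of_real (gg k m x) * H Minus m x) * H Plus j x)"
      unfolding B_def sum_2 by (simp add: algebra_simps)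
    also have "\<dots> = (\<Sum>s\<in>UNIV. dual s k x * H s j x)"
      unfolding gg_H by (simp add: sum_sign)
    finally show ?thesis unfolding H_dual[OF x] .
  qed
  have ig: "(\<Sum>m\<in>UNIV. of_real (ginv i m x) * of_real (gg m k x)) = (if i = k then 1 else 0 :: complex)" for k
  proof -
    have "matrix_inv (metric R c (chart_inv c x)) ** metric R c (chart_inv c x) = mat 1"
      using matrix_inv_2(2) metric_det_pos[OF inv_in_dom[OF x]] by fastforce
    then have "(matrix_inv (metric R c (chart_inv c x)) ** metric R c (chart_inv c x)) $ i $ k = mat 1 $ i $ k"
      by simp
    then have "(\<Sum>m\<in>UNIV. ginv i m x * gg m k x) = (if i = k then 1 else 0)"
      by (simp add: matrix_matrix_mult_def mat_def gg_def ginv_def)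
    then have "of_real (\<Sum>m\<in>UNIV. ginv i m x * gg m k x) = (of_real (if i = k then 1 else 0) :: complex)" by simp
    then show ?thesis by (simp split: if_splits)
  qed
  have "of_real (ginv i j x) = (\<Sum>m\<in>UNIV. of_real (ginv i m x) * (\<Sum>k\<in>UNIV. of_real (gg m k x) * B k j))"
    unfolding gB by (simp add: if_distrib cong: if_cong)
  also have "\<dots> = (\<Sum>k\<in>UNIV. (\<Sum>m\<in>UNIV. of_real (ginv i m x) * of_real (gg m k x)) * B k j)"
    by (simp add: sum_2 algebra_simps)
  also have "\<dots> = B i j" unfolding ig by (simp add: if_distrib[of "\<lambda>z. z * _"] cong: if_cong)
  finally show ?thesis unfolding B_def .
qed

text \<open>The trace is the mean of the two orders of \<open>h_+\<close>, \<open>h_-\<close>, and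
  on functions, which have charge 0, the commutator vanishes.\<close>

lemma laplacian_frame:
  assumes V: "open V" "V \<subseteq> W" "x \<in> V" and G: "smooth_on V (g \<circ> chart_inv c)"
    and K: "sectional_curvature R c (chart_inv c x) = K"
  shows "frame_deriv H om [s, neg s] (g \<circ> chart_inv c) x = laplacian R c g (chart_inv c x)"
proof -
  let ?D = "\<lambda>w. frame_deriv H om w (g \<circ> chart_inv c) x"
  have x: "x \<in> W" using V by blast
  have c: "?D [s, t] = (\<Sum>i\<in>UNIV. \<Sum>j\<in>UNIV. H s i x * H t j x * cov R c (g \<circ> chart_inv c) [i, j] x)" for s t
    unfolding contr_cov[OF V(1,2) G V(3), symmetric] by (simp add: sum_distrib_left mult_ac del: cov.simps)
  have e: "?D [Plus, Minus] = ?D [Minus, Plus]"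
    using spin_deriv_commute[OF V G K, of 0 Plus] by simp
  have "laplacian R c g (chart_inv c x)
      = (\<Sum>i\<in>UNIV. \<Sum>j\<in>UNIV. of_real (ginv i j x) * cov R c (g \<circ> chart_inv c) [i, j] x)"
    unfolding laplacian_def ginv_def using x by simp
  also have "\<dots> = 1/2 * (?D [Plus, Minus] + ?D [Minus, Plus])"
    unfolding c ginv_H[OF x] sum_2 by (simp add: algebra_simps del: cov.simps)
  also have "\<dots> = ?D [Minus, Plus]" unfolding e by (simp del: frame_deriv.simps)
  finally have L: "laplacian R c g (chart_inv c x) = ?D [Minus, Plus]" .
  show ?thesis by (cases s) (simp_all only: neg.simps L e)
qed

end

text \<open>If \<open>h\<^sub>+h\<^sub>-\<close> acts as \<open>e\<close>, then commuting \<open>h\<^sub>s\<close> through \<open>k\<close> letters of the opposite sign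
  collects \<open>2K \<Sum>\<^bsub>j<k\<^esub> j = K k (k - 1)\<close>.\<close>
primrec eigval :: "complex \<Rightarrow> real \<Rightarrow> sign list \<Rightarrow> complex" where
  "eigval e K [] = 1"
| "eigval e K (s # w) = eigval e K w *
    (if sg s * charge w < 0 then e + of_real K * of_int (\<bar>charge w\<bar> * (\<bar>charge w\<bar> - 1)) else 1)"

text \<open>The normal form of words of charge \<open>n\<close>: every other word of this charge
  acts as a scalar multiple of it.\<close>

definition pure_word :: "int \<Rightarrow> sign list" where
  "pure_word n = (if n \<ge> 0 then replicate (nat n) Plus else replicate (nat (- n)) Minus)"

lemma pure_word_nonpos: "n \<le> 0 \<Longrightarrow> pure_word n = replicate (nat (- n)) Minus"
  by (cases "n = 0") (simp_all add: pure_word_def)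

lemma charge_replicate [simp]: "charge (replicate k s) = int k * sg s"
  by (induction k) (simp_all add: algebra_simps)

context framed_chart
begin

context
  fixes V G K and e :: complex
  assumes V: "open V" "V \<subseteq> W" and G: "smooth_on V G"
    and K: "\<And>x. x \<in> V \<Longrightarrow> sectional_curvature R c (chart_inv c x) = K"
    and e: "\<And>x s. x \<in> V \<Longrightarrow> frame_deriv H om [s, neg s] G x = e * G x"
begin

lemma frame_deriv_opposite:
  "x \<in> V \<Longrightarrow> frame_deriv H om (s # replicate (Suc k) (neg s)) G x
    = (e + of_real K * of_nat (Suc k * k)) * frame_deriv H om (replicate k (neg s)) G x"
proof (induction k arbitrary: x)
  case 0
  then show ?case using e[OF 0] by simp
next
  case (Suc k)
  define w where "w = replicate (Suc k) (neg s)"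
  let ?F = "frame_deriv H om w G"
  have w: "w = neg s # replicate k (neg s)" unfolding w_def by simp
  have cw: "charge (neg s # w) = charge w - sg s" by simp
  have cr: "charge (replicate k (neg s)) = charge w + sg s" unfolding w by simp
  have sm: "smooth_on V (frame_deriv H om w G)" for w by (rule frame_deriv_smooth[OF V G])
  have "frame_deriv H om (s # replicate (Suc (Suc k)) (neg s)) G x = frame_deriv H om (s # neg s # w) G x"
    unfolding w_def by (simp only: replicate_Suc)
  also have "\<dots> = spin_deriv H om (charge w - sg s) s (spin_deriv H om (charge w) (neg s) ?F) x"
    unfolding frame_deriv.simps cw ..
  also have "\<dots> = spin_deriv H om (charge w + sg s) (neg s) (spin_deriv H om (charge w) s ?F) x
      - of_int (sg s * charge w) * 2 * of_real K * ?F x"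
    by (rule spin_deriv_commute[OF V Suc.prems sm K[OF Suc.prems]])
  also have "spin_deriv H om (charge w + sg s) (neg s) (spin_deriv H om (charge w) s ?F) x
      = spin_deriv H om (charge w + sg s) (neg s)
        (\<lambda>y. (e + of_real K * of_nat (Suc k * k)) * frame_deriv H om (replicate k (neg s)) G y) x"
    by (rule spin_deriv_cong[OF V(1) Suc.prems]) (use Suc.IH in \<open>simp only: w_def frame_deriv.simps(2)\<close>)
  also have "\<dots> = (e + of_real K * of_nat (Suc k * k)) *
      spin_deriv H om (charge w + sg s) (neg s) (frame_deriv H om (replicate k (neg s)) G) x"
    by (rule spin_deriv_cmult[OF smooth_on_differentiable[OF sm Suc.prems]])
  also have "spin_deriv H om (charge w + sg s) (neg s) (frame_deriv H om (replicate k (neg s)) G) x = ?F x"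
    unfolding w frame_deriv.simps cr[unfolded w] ..
  \<comment> \<open>The word \<open>w\<close> consists of k+1 letters \<open>neg s\<close>, so the
    commutator adds 2K(k+1), and k(k+1) + 2(k+1) = (k+1)(k+2).\<close>
  also have "of_int (sg s * charge w) = (- of_nat (Suc k) :: complex)"
    unfolding w_def by (cases s) auto
  finally show ?case unfolding w_def by (simp add: algebra_simps del: frame_deriv.simps replicate_Suc)
qed

text \<open>A new letter lengthens the pure word when it does not oppose its charge and otherwise
  shortens it by \<open>frame_deriv_opposite\<close>. The factors collected so far are constants,
  thanks to the constant curvature, and therefore pass through the next derivative.\<close>

lemma frame_deriv_pure:
  "x \<in> V \<Longrightarrow> frame_deriv H om w G x = eigval e K w * frame_deriv H om (pure_word (charge w)) G x"
proof (induction w arbitrary: x)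
  case Nil
  then show ?case by (simp add: pure_word_def)
next
  case (Cons s w)
  let ?p = "pure_word (charge w)"
  have cp: "charge ?p = charge w" by (simp add: pure_word_def)
  have sm: "smooth_on V (frame_deriv H om w G)" for w by (rule frame_deriv_smooth[OF V G])
  have "frame_deriv H om (s # w) G x = spin_deriv H om (charge w) s (\<lambda>y. eigval e K w * frame_deriv H om ?p G y) x"
    unfolding frame_deriv.simps by (rule spin_deriv_cong[OF V(1) Cons.prems Cons.IH])
  also have "\<dots> = eigval e K w * frame_deriv H om (s # ?p) G x"
    unfolding frame_deriv.simps cp by (rule spin_deriv_cmult[OF smooth_on_differentiable[OF sm Cons.prems]])
  also have "frame_deriv H om (s # ?p) G x =
     (if sg s * charge w < 0 then e + of_real K * of_int (\<bar>charge w\<bar> * (\<bar>charge w\<bar> - 1)) else 1)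
       * frame_deriv H om (pure_word (charge (s # w))) G x"
  proof (cases "sg s * charge w < 0")
    case True
    define k where "k = nat (\<bar>charge w\<bar> - 1)"
    have k: "\<bar>charge w\<bar> = int (Suc k)" using True unfolding k_def by auto
    have "?p = replicate (Suc k) (neg s) \<and> pure_word (charge (s # w)) = replicate k (neg s)"
    proof (cases s)
      case Plus
      then have "charge w = - int (Suc k)" using True k by simp
      then show ?thesis using Plus pure_word_nonpos[of "- int k"] by (simp add: pure_word_def nat_add_distrib)
    next
      case Minus
      then have "charge w = int (Suc k)" using True k by simp
      then show ?thesis using Minus by (simp add: pure_word_def nat_add_distrib)
    qed
    then have p: "?p = replicate (Suc k) (neg s)" "pure_word (charge (s # w)) = replicate k (neg s)"
      by auto
    show ?thesis unfolding p frame_deriv_opposite[OF Cons.prems] k using True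
      by (simp add: algebra_simps del: frame_deriv.simps)
  next
    case False
    have "pure_word (charge (s # w)) = s # ?p"
    proof (cases s)
      case Plus
      then show ?thesis using False by (simp add: pure_word_def nat_add_distrib)
    next
      case Minus
      then have "charge w \<le> 0" using False by simp
      moreover from this have "nat (- charge (Minus # w)) = Suc (nat (- charge w))" by simp
      ultimately show ?thesis using Minus pure_word_nonpos[of "charge w"] pure_word_nonpos[of "charge (Minus # w)"] by simp
    qed
    then show ?thesis using False by simp
  qed
  finally show ?case by simp
qed

lemma frame_deriv_balanced:
  "x \<in> V \<Longrightarrow> balanced w \<Longrightarrow> frame_deriv H om w G x = eigval e K w * G x"
  using frame_deriv_pure[of x w] by (simp add: balanced_iff pure_word_def)

end

end

section \<open>Transition maps and orientation\<close>

context
  fixes A :: "('a::topological_space) chart set"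
  assumes A: "smooth_atlas A"
begin

lemma atlas_open_dom: "c \<in> A \<Longrightarrow> open (fst c)"
  using A unfolding smooth_atlas_def by blast

lemma atlas_homeo: "c \<in> A \<Longrightarrow> homeomorphism (fst c) (chart_range c) (snd c) (chart_inv c)"
  using A unfolding smooth_atlas_def by blast

lemma atlas_open_image:
  assumes "c \<in> A" "open V" shows "open (snd c ` (fst c \<inter> V))"
proof -
  have o: "open (chart_range c)" "open (fst c)" using A assms(1) unfolding smooth_atlas_def by auto
  have "openin (top_of_set (fst c)) (fst c \<inter> V)" using assms(2) by (simp add: openin_open_Int)
  then have "openin (top_of_set (chart_range c)) (snd c ` (fst c \<inter> V))"
    using homeomorphism_imp_open_map[OF atlas_homeo[OF assms(1)]] by blast
  then show ?thesis using o(1) openin_open_trans by blast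
qed

lemma atlas_inv_coord: "c \<in> A \<Longrightarrow> q \<in> fst c \<Longrightarrow> chart_inv c (snd c q) = q"
  using atlas_homeo homeomorphism_apply1 by blast

lemma transition_smooth:
  "c \<in> A \<Longrightarrow> d \<in> A \<Longrightarrow> smooth_on (snd c ` (fst c \<inter> fst d)) (snd d \<circ> chart_inv c)"
  using A unfolding smooth_atlas_def by blast

lemma transition_has_derivative:
  assumes "c \<in> A" "d \<in> A" "q \<in> fst c" "q \<in> fst d"
  shows "((snd d \<circ> chart_inv c) has_derivative ((*v) (jac c d q))) (at (snd c q))"
proof -
  have "(snd d \<circ> chart_inv c) differentiable (at (snd c q))"
    by (rule smooth_on_differentiable[OF transition_smooth[OF assms(1,2)]]) (use assms in auto)
  then have D: "((snd d \<circ> chart_inv c) has_derivative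
      frechet_derivative (snd d \<circ> chart_inv c) (at (snd c q))) (at (snd c q))"
    by (rule frechet_derivative_works[THEN iffD1])
  have "(*v) (jac c d q) = frechet_derivative (snd d \<circ> chart_inv c) (at (snd c q))"
    unfolding jac_def by (rule matrix_vector_mul(2)[OF has_derivative_linear[OF D]])
  with D show ?thesis by simp
qed

lemma jac_component:
  assumes "c \<in> A" "d \<in> A" "q \<in> fst c" "q \<in> fst d"
  shows "jac c d q $ a $ i = pd i (snd d \<circ> chart_inv c) (snd c q) $ a"
  unfolding jac_def matrix_def pd_def by simp

lemma jac_chain:
  assumes "c \<in> A" "d \<in> A" "b \<in> A" "q \<in> fst c" "q \<in> fst d" "q \<in> fst b"
  shows "jac c b q = jac d b q ** jac c d q"
proof -
  have eq: "(snd d \<circ> chart_inv c) (snd c q) = snd d q"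
    using atlas_inv_coord assms(1,4) by simp
  have D1: "(snd b \<circ> chart_inv d has_derivative (*v) (jac d b q)) (at ((snd d \<circ> chart_inv c) (snd c q)))"
    unfolding eq by (rule transition_has_derivative[OF assms(2,3,5,6)])
  have "((\<lambda>x. (snd b \<circ> chart_inv d) ((snd d \<circ> chart_inv c) x)) has_derivative
      (\<lambda>v. jac d b q *v (jac c d q *v v))) (at (snd c q))"
    by (rule has_derivative_compose[OF transition_has_derivative[OF assms(1,2,4,5)] D1])
  moreover have "((\<lambda>x. (snd b \<circ> chart_inv d) ((snd d \<circ> chart_inv c) x)) has_derivative
      (\<lambda>v. jac d b q *v (jac c d q *v v))) (at (snd c q)) \<longleftrightarrow>
    ((snd b \<circ> chart_inv c) has_derivative (\<lambda>v. jac d b q *v (jac c d q *v v))) (at (snd c q))"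
  proof (rule has_derivative_cong_open)
    show "open (snd c ` (fst c \<inter> fst d))" by (intro atlas_open_image atlas_open_dom assms)
    show "snd c q \<in> snd c ` (fst c \<inter> fst d)" using assms by auto
    fix y assume "y \<in> snd c ` (fst c \<inter> fst d)"
    then show "(snd b \<circ> chart_inv d) ((snd d \<circ> chart_inv c) y) = (snd b \<circ> chart_inv c) y"
      using assms(1,2) by (auto simp: atlas_inv_coord)
  qed
  ultimately have "((snd b \<circ> chart_inv c) has_derivative (\<lambda>v. jac d b q *v (jac c d q *v v))) (at (snd c q))"
    by blast
  then have "(\<lambda>v. jac d b q *v (jac c d q *v v)) = (*v) (jac c b q)"
    using transition_has_derivative[OF assms(1,3,4,6)] by (rule has_derivative_unique)
  then have "jac c b q *v v = (jac d b q ** jac c d q) *v v" for v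
    unfolding matrix_vector_mul_assoc[symmetric] by (rule fun_cong[OF sym])
  then show ?thesis by (simp add: matrix_eq)
qed

lemma jac_self:
  assumes "c \<in> A" "q \<in> fst c" shows "jac c c q = mat 1"
proof -
  have "((snd c \<circ> chart_inv c) has_derivative (\<lambda>v. v)) (at (snd c q)) \<longleftrightarrow>
    ((\<lambda>x. x) has_derivative (\<lambda>v. v)) (at (snd c q))"
  proof (rule has_derivative_cong_open)
    show "open (snd c ` (fst c \<inter> fst c))" by (intro atlas_open_image atlas_open_dom assms)
    show "snd c q \<in> snd c ` (fst c \<inter> fst c)" using assms by auto
    fix y assume "y \<in> snd c ` (fst c \<inter> fst c)"
    then show "(snd c \<circ> chart_inv c) y = y" using assms(1) by (auto simp: atlas_inv_coord)
  qed
  then have "((snd c \<circ> chart_inv c) has_derivative (\<lambda>v. v)) (at (snd c q))" by simp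
  then have "(\<lambda>v. v) = (*v) (jac c c q)"
    using transition_has_derivative[OF assms(1,1,2,2)] by (rule has_derivative_unique)
  then have "jac c c q *v v = mat 1 *v v" for v
    unfolding matrix_vector_mul_lid by (rule fun_cong[OF sym])
  then show ?thesis by (simp add: matrix_eq)
qed

lemma det_jac_chain:
  assumes "c \<in> A" "d \<in> A" "b \<in> A" "q \<in> fst c" "q \<in> fst d" "q \<in> fst b"
  shows "det (jac c b q) = det (jac d b q) * det (jac c d q)"
  unfolding jac_chain[OF assms] by (rule det_mul)

lemma det_jac_nonzero:
  assumes "c \<in> A" "d \<in> A" "q \<in> fst c" "q \<in> fst d"
  shows "det (jac c d q) \<noteq> 0"
  using det_jac_chain[of c d c q] assms by (auto simp: jac_self)

lemma det_jac_continuous: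
  assumes "c \<in> A" "d \<in> A"
  shows "continuous_on (snd c ` (fst c \<inter> fst d)) (\<lambda>x. det (jac c d (chart_inv c x)))"
proof -
  let ?S = "snd c ` (fst c \<inter> fst d)" and ?T = "snd d \<circ> chart_inv c"
  have cc: "continuous_on ?S (\<lambda>x. pd i ?T x $ a)" for a i
    by (intro continuous_on_component smooth_on_continuous[OF smooth_on_pd[OF transition_smooth[OF assms]]])
  then have "continuous_on ?S (\<lambda>x. pd 1 ?T x $ 1 * pd 2 ?T x $ 2 - pd 2 ?T x $ 1 * pd 1 ?T x $ 2)"
    by (intro continuous_on_diff continuous_on_mult cc)
  then show ?thesis
    by (rule continuous_on_eq) (auto simp: det_2 jac_component assms atlas_inv_coord)
qed

end

text \<open>An orientation, recorded as the sign of every chart of the atlas at every point; the charts need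
  not have connected domains.\<close>
definition oriented_signs :: "('a::topological_space) riem \<Rightarrow> ('a chart \<Rightarrow> 'a \<Rightarrow> real) \<Rightarrow> bool" where
  "oriented_signs R \<epsilon> \<longleftrightarrow>
    (\<forall>c\<in>atlas R. \<forall>q\<in>fst c. \<epsilon> c q \<in> {1, -1}) \<and>
    (\<forall>c\<in>atlas R. \<forall>d\<in>atlas R. \<forall>q\<in>fst c \<inter> fst d. det (jac c d q) * \<epsilon> c q * \<epsilon> d q > 0) \<and>
    (\<forall>c\<in>atlas R. \<forall>x\<in>chart_range c. \<exists>N. open N \<and> x \<in> N \<and> N \<subseteq> chart_range c \<and>
        (\<forall>y\<in>N. \<epsilon> c (chart_inv c y) = \<epsilon> c (chart_inv c x)))"

text \<open>The charts of \<open>B\<close> orient the surface but need not belong to the atlas of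
  \<open>R\<close>. The sign of a chart \<open>c\<close> at \<open>q\<close> is that of its Jacobian
  towards any chart of \<open>B\<close> around \<open>q\<close>; the choice \<open>\<beta> q\<close>
  is immaterial since transitions within \<open>B\<close> have positive determinant.\<close>

lemma oriented_signs_exist:
  assumes orient: "orientable R" and p: "p0 \<in> fst c0" "c0 \<in> atlas R" and t: "t \<in> {1, -1}"
  shows "\<exists>\<epsilon>. oriented_signs R \<epsilon> \<and> \<epsilon> c0 p0 = t"
proof -
  obtain B where A: "smooth_atlas (atlas R \<union> B)" and cov: "(\<Union>b\<in>B. fst b) = UNIV"
    and pos': "\<forall>b\<in>B. \<forall>b'\<in>B. \<forall>q\<in>fst b \<inter> fst b'. det (jac b b' q) > 0"
    using orient unfolding orientable_def by (elim exE conjE)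
  have pos: "det (jac b b' q) > 0" if "b \<in> B" "b' \<in> B" "q \<in> fst b" "q \<in> fst b'" for b b' q
    using pos' that by simp
  define \<beta> where "\<beta> q = (SOME b. b \<in> B \<and> q \<in> fst b)" for q
  have \<beta>: "\<beta> q \<in> B" "q \<in> fst (\<beta> q)" for q
  proof -
    have "\<exists>b. b \<in> B \<and> q \<in> fst b" using cov by blast
    then have "\<beta> q \<in> B \<and> q \<in> fst (\<beta> q)" unfolding \<beta>_def by (rule someI_ex)
    then show "\<beta> q \<in> B" "q \<in> fst (\<beta> q)" by auto
  qed
  define e where "e c q = sgn (det (jac c (\<beta> q) q))" for c q
  have e: "e c q = sgn (det (jac c b q))" if "c \<in> atlas R" "q \<in> fst c" "b \<in> B" "q \<in> fst b" for c q b
  proof -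
    have "det (jac c b q) = det (jac (\<beta> q) b q) * det (jac c (\<beta> q) q)"
      by (rule det_jac_chain[OF A]) (use that \<beta> in auto)
    moreover have "det (jac (\<beta> q) b q) > 0" using pos \<beta> that by blast
    ultimately show ?thesis unfolding e_def by (simp add: sgn_mult)
  qed
  have e1: "e c q \<in> {1, -1}" if "c \<in> atlas R" "q \<in> fst c" for c q
  proof -
    have "det (jac c (\<beta> q) q) \<noteq> 0"
      by (rule det_jac_nonzero[OF A]) (use that \<beta> in auto)
    then show ?thesis unfolding e_def by (auto simp: sgn_if)
  qed
  have e2: "det (jac c d q) * e c q * e d q > 0"
    if "c \<in> atlas R" "d \<in> atlas R" "q \<in> fst c" "q \<in> fst d" for c d q
  proof -
    have "det (jac c (\<beta> q) q) = det (jac d (\<beta> q) q) * det (jac c d q)"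
      by (rule det_jac_chain[OF A]) (use that \<beta> in auto)
    then have ec: "e c q = e d q * sgn (det (jac c d q))" unfolding e_def by (simp add: sgn_mult)
    have "det (jac c d q) \<noteq> 0"
      by (rule det_jac_nonzero[OF A]) (use that in auto)
    moreover have "e d q * e d q = 1" using e1[OF that(2,4)] by auto
    moreover have "det (jac c d q) * e c q * e d q = \<bar>det (jac c d q)\<bar> * (e d q * e d q)"
      unfolding ec abs_sgn by (simp only: mult_ac)
    ultimately show ?thesis by (simp only: mult_1_right zero_less_abs_iff not_False_eq_True)
  qed
  have e3: "\<exists>N. open N \<and> x \<in> N \<and> N \<subseteq> chart_range c \<and> (\<forall>y\<in>N. e c (chart_inv c y) = e c (chart_inv c x))"
    if c: "c \<in> atlas R" and x: "x \<in> chart_range c" for c x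
  proof -
    have cA: "c \<in> atlas R \<union> B" using c by simp
    obtain q where q: "q \<in> fst c" "x = snd c q" using x unfolding chart_range_def by blast
    have qx: "chart_inv c x = q" using atlas_inv_coord[OF A cA q(1)] q(2) by simp
    define S where "S = snd c ` (fst c \<inter> fst (\<beta> q))"
    have bA: "\<beta> q \<in> atlas R \<union> B" using \<beta> by simp
    have S: "open S" "x \<in> S" unfolding S_def
      using atlas_open_image[OF A cA atlas_open_dom[OF A bA]] q \<beta> by auto
    define F where "F y = det (jac c (\<beta> q) (chart_inv c y))" for y
    have F: "continuous_on S F" unfolding F_def S_def by (rule det_jac_continuous[OF A cA bA])
    have eF: "e c (chart_inv c y) = sgn (F y)" if "y \<in> S" for y
      using that unfolding S_def F_def
      by (auto simp: atlas_inv_coord[OF A cA] intro!: e c \<beta>)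
    \<comment> \<open>As \<open>F x\<close> is nonzero, the points where \<open>F\<close> has the
      same sign form a neighbourhood.\<close>
    define N where "N = (if F x > 0 then S \<inter> F -` {0<..} else S \<inter> F -` {..<0})"
    have "F x \<noteq> 0" unfolding F_def qx
      by (rule det_jac_nonzero[OF A cA bA q(1) \<beta>(2)])
    then have "x \<in> N" using S unfolding N_def by (cases "F x > 0") auto
    have "open (S \<inter> F -` {0<..})" "open (S \<inter> F -` {..<0})"
      by (intro continuous_open_preimage[OF F S(1)] open_greaterThan open_lessThan)+
    then have "open N" unfolding N_def by (cases "F x > 0") simp_all
    have "N \<subseteq> S" unfolding N_def by auto
    have "S \<subseteq> chart_range c" unfolding S_def chart_range_def by auto
    have eN: "e c (chart_inv c y) = e c (chart_inv c x)" if "y \<in> N" for y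
    proof -
      have "y \<in> S" using that \<open>N \<subseteq> S\<close> by blast
      moreover have "sgn (F y) = sgn (F x)"
        using that \<open>x \<in> N\<close> unfolding N_def by (cases "F x > 0") auto
      ultimately show ?thesis using eF S(2) by simp
    qed
    have "\<forall>y\<in>N. e c (chart_inv c y) = e c (chart_inv c x)" by (rule ballI) (rule eN)
    moreover have "N \<subseteq> chart_range c" using \<open>N \<subseteq> S\<close> \<open>S \<subseteq> chart_range c\<close> by (rule order.trans)
    ultimately show ?thesis using \<open>open N\<close> \<open>x \<in> N\<close> by (intro exI[of _ N] conjI)
  qed
  \<comment> \<open>A global sign that reverses the orientation if it disagrees with the prescribed
    \<open>t\<close> at \<open>p0\<close>.\<close>
  define k where "k = t * e c0 p0"
  have e0: "e c0 p0 = 1 \<or> e c0 p0 = -1" using e1[OF p(2,1)] by simp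
  then have k: "k = 1 \<or> k = -1" using t unfolding k_def by auto
  define \<epsilon> where "\<epsilon> c q = k * e c q" for c q
  have "\<epsilon> c0 p0 = t * (e c0 p0 * e c0 p0)" unfolding \<epsilon>_def k_def by (simp add: mult_ac)
  also have "e c0 p0 * e c0 p0 = 1" using e0 by auto
  finally have "\<epsilon> c0 p0 = t" by simp
  moreover have "oriented_signs R \<epsilon>" unfolding oriented_signs_def
  proof (intro conjI ballI)
    fix c q assume "c \<in> atlas R" "q \<in> fst c"
    then have "e c q = 1 \<or> e c q = -1" using e1[of c q] by simp
    then show "\<epsilon> c q \<in> {1, -1}" using k unfolding \<epsilon>_def by auto
  next
    fix c d q assume "c \<in> atlas R" "d \<in> atlas R" "q \<in> fst c \<inter> fst d"
    then have "det (jac c d q) * e c q * e d q > 0" using e2 by simp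
    then show "det (jac c d q) * \<epsilon> c q * \<epsilon> d q > 0" using k unfolding \<epsilon>_def by auto
  next
    fix c x assume cx: "c \<in> atlas R" "x \<in> chart_range c"
    obtain N where N: "open N" "x \<in> N" "N \<subseteq> chart_range c"
      "\<forall>y\<in>N. e c (chart_inv c y) = e c (chart_inv c x)" using e3[OF cx] by blast
    have "\<forall>y\<in>N. \<epsilon> c (chart_inv c y) = \<epsilon> c (chart_inv c x)"
      unfolding \<epsilon>_def using N(4) by (intro ballI arg_cong[of _ _ "(*) k"]) (rule bspec)
    with N(1-3) show "\<exists>N. open N \<and> x \<in> N \<and> N \<subseteq> chart_range c \<and>
        (\<forall>y\<in>N. \<epsilon> c (chart_inv c y) = \<epsilon> c (chart_inv c x))"
      by (intro exI[of _ N] conjI)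
  qed
  ultimately show ?thesis by (intro exI[of _ \<epsilon>] conjI)
qed

section \<open>Null frames at a point\<close>

definition nullpair :: "(2 \<Rightarrow> 2 \<Rightarrow> real) \<Rightarrow> (sign \<Rightarrow> 2 \<Rightarrow> complex) \<Rightarrow> bool" where
  "nullpair g H \<longleftrightarrow> (\<forall>s t. (\<Sum>i\<in>UNIV. \<Sum>j\<in>UNIV. of_real (g i j) * H s i * H t j) = (if s = t then 0 else 2))"

definition frame_det :: "(sign \<Rightarrow> 2 \<Rightarrow> complex) \<Rightarrow> complex" where
  "frame_det H = H Plus 1 * H Minus 2 - H Plus 2 * H Minus 1"

definition cframe :: "(2 \<Rightarrow> real) \<Rightarrow> (2 \<Rightarrow> real) \<Rightarrow> sign \<Rightarrow> 2 \<Rightarrow> complex" where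
  "cframe e1 e2 s i = of_real (e1 i) - of_int (sg s) * \<i> * of_real (e2 i)"

lemma nullpair_cframe:
  assumes "g 1 2 = g 2 1"
    and "(\<Sum>i\<in>UNIV. \<Sum>j\<in>UNIV. g i j * e1 i * e1 j) = 1" "(\<Sum>i\<in>UNIV. \<Sum>j\<in>UNIV. g i j * e2 i * e2 j) = 1"
      "(\<Sum>i\<in>UNIV. \<Sum>j\<in>UNIV. g i j * e1 i * e2 j) = 0"
  shows "nullpair g (cframe e1 e2)"
proof -
  let ?g = "\<lambda>a b. (\<Sum>i\<in>UNIV. \<Sum>j\<in>UNIV. g i j * a i * b j)"
  have "(\<Sum>i\<in>UNIV. \<Sum>j\<in>UNIV. of_real (g i j) * cframe e1 e2 s i * cframe e1 e2 t j)
     = of_real (?g e1 e1) - of_int (sg s * sg t) * of_real (?g e2 e2)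
       - \<i> * of_int (sg s + sg t) * of_real (?g e1 e2)" for s t
    using assms(1) by (simp add: cframe_def sum_2 algebra_simps)
  note e = this
  show ?thesis unfolding nullpair_def e assms(2-4)
  proof (intro allI)
    fix s t
    show "of_real 1 - of_int (sg s * sg t) * of_real 1 - \<i> * of_int (sg s + sg t) * of_real 0
        = (if s = t then 0 else 2 :: complex)"
      by (cases s; cases t) simp_all
  qed
qed

text \<open>The determinant is 2i times a real number whose sign is the orientation of the real
  frame; \<open>nullpair_rotation\<close> compares these signs.\<close>

lemma frame_det_cframe:
  "frame_det (cframe e1 e2) = 2 * \<i> * of_real (e1 1 * e2 2 - e1 2 * e2 1)"
  by (simp add: frame_det_def cframe_def algebra_simps)

text \<open>A nondegenerate form on the plane has exactly two null lines, so \<open>L\<close>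
  consists of multiples of the members of \<open>H\<close>, possibly exchanged. The orientation
  excludes the exchange, and the scalar product 2 makes the factors reciprocal.\<close>

lemma nullpair_rotation:
  assumes H: "nullpair g H" and L: "nullpair g L" and gs: "g 1 2 = g 2 1"
    and det: "frame_det L = 2 * \<i> * of_real \<kappa>" "frame_det H = 2 * \<i> * of_real \<kappa>'" "\<kappa> * \<kappa>' > 0"
  defines "U \<equiv> (\<lambda>s. 1/2 * (\<Sum>i\<in>UNIV. \<Sum>j\<in>UNIV. of_real (g i j) * L s i * H (neg s) j))"
  shows "\<And>s i. L s i = U s * H s i" and "U Plus * U Minus = 1"
proof -
  let ?g = "\<lambda>a b. (\<Sum>i\<in>UNIV. \<Sum>j\<in>UNIV. of_real (g i j) * a i * b j)"
  define th where "th s i = 1/2 * (\<Sum>j\<in>UNIV. of_real (g i j) * H (neg s) j)" for s i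
  have th: "(\<Sum>i\<in>UNIV. th s i * H t i) = 1/2 * ?g (H t) (H (neg s))" for s t
    by (simp add: th_def sum_distrib_left sum_distrib_right mult_ac)
  have thH: "(\<Sum>i\<in>UNIV. th s i * H t i) = (if s = t then 1 else 0)" for s t
    using H unfolding th nullpair_def by (cases s; cases t) auto
  have "th Plus 1 * H Plus 1 + th Plus 2 * H Plus 2 = 1"
    "th Plus 1 * H Minus 1 + th Plus 2 * H Minus 2 = 0"
    "th Minus 1 * H Plus 1 + th Minus 2 * H Plus 2 = 0"
    "th Minus 1 * H Minus 1 + th Minus 2 * H Minus 2 = 1"
    using thH[of Plus Plus] thH[of Plus Minus] thH[of Minus Plus] thH[of Minus Minus] by (simp_all add: sum_2)
  note inv = inverse_2x2[OF this]
  define \<alpha> where "\<alpha> s t = 1/2 * ?g (L s) (H (neg t))" for s t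
  have \<alpha>_th: "\<alpha> s t = (\<Sum>i\<in>UNIV. th t i * L s i)" for s t
    by (simp add: \<alpha>_def th_def sum_distrib_left sum_distrib_right mult_ac)
  have L_eq: "L s i = \<alpha> s Plus * H Plus i + \<alpha> s Minus * H Minus i" for s i
  proof -
    have "\<alpha> s Plus * H Plus i + \<alpha> s Minus * H Minus i
       = (H Plus i * th Plus 1 + H Minus i * th Minus 1) * L s 1
        + (H Plus i * th Plus 2 + H Minus i * th Minus 2) * L s 2"
      unfolding \<alpha>_th sum_2 by (simp add: algebra_simps)
    then show ?thesis using exhaust_2[of i] inv(1-4) by auto
  qed
  have gL: "?g (L s) (L t) = 2 * (\<alpha> s Plus * \<alpha> t Minus + \<alpha> s Minus * \<alpha> t Plus)" for s t
  proof -
    have "?g (L s) (L t) = \<alpha> t Plus * ?g (L s) (H Plus) + \<alpha> t Minus * ?g (L s) (H Minus)"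
      unfolding L_eq[of t] sum_2 by (simp add: algebra_simps)
    also have "?g (L s) (H Plus) = 2 * \<alpha> s Minus" unfolding \<alpha>_def by simp
    also have "?g (L s) (H Minus) = 2 * \<alpha> s Plus" unfolding \<alpha>_def by simp
    finally show ?thesis by (simp add: algebra_simps)
  qed
  have "\<alpha> Plus Plus * \<alpha> Plus Minus = 0" "\<alpha> Minus Plus * \<alpha> Minus Minus = 0"
    "\<alpha> Plus Plus * \<alpha> Minus Minus + \<alpha> Plus Minus * \<alpha> Minus Plus = 1"
    using L gL[of Plus Plus] gL[of Minus Minus] gL[of Plus Minus] unfolding nullpair_def by auto
  note a = this
  have "frame_det L = (\<alpha> Plus Plus * \<alpha> Minus Minus - \<alpha> Plus Minus * \<alpha> Minus Plus) * frame_det H"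
    unfolding frame_det_def L_eq by (simp add: algebra_simps)
  then have r: "of_real \<kappa> = (\<alpha> Plus Plus * \<alpha> Minus Minus - \<alpha> Plus Minus * \<alpha> Minus Plus) * of_real \<kappa>'"
    unfolding det by simp
  \<comment> \<open>Otherwise the null lines are exchanged, and the base change has determinant
    -1.\<close>
  have b: "\<alpha> Plus Minus = 0"
  proof (rule ccontr)
    assume "\<alpha> Plus Minus \<noteq> 0"
    then have "\<alpha> Plus Plus = 0" using a by simp
    then have "of_real \<kappa> = (- of_real \<kappa>' :: complex)" using r a(3) by simp
    then have "\<kappa> = - \<kappa>'" by (metis of_real_eq_iff of_real_minus)
    then show False using det(3) by (simp add: not_less)
  qed
  then have ab: "\<alpha> Plus Plus * \<alpha> Minus Minus = 1" using a(3) by simp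
  then have c: "\<alpha> Minus Plus = 0" using a(2) by auto
  have U: "U s = \<alpha> s s" for s unfolding U_def \<alpha>_def ..
  show "U Plus * U Minus = 1" unfolding U by (rule ab)
  show "L s i = U s * H s i" for s i unfolding U using L_eq[of s i] b c by (cases s) auto
qed

section \<open>The oriented null frame of a chart\<close>

locale oriented_chart = coord_chart R c for R :: "('a::{t2_space,second_countable_topology}) riem" and c +
  fixes \<epsilon> :: "'a chart \<Rightarrow> 'a \<Rightarrow> real"
  assumes signs: "oriented_signs R \<epsilon>"
begin

definition ee1 :: "real^2 \<Rightarrow> 2 \<Rightarrow> real" where
  "ee1 x i = (if i = 1 then inverse (sqrt (gg 1 1 x)) else 0)"

definition sdet :: "real^2 \<Rightarrow> real" where
  "sdet x = inverse (sqrt (gg 1 1 x * gg 2 2 x - gg 1 2 x * gg 2 1 x))"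

text \<open>Gram--Schmidt applied to the coordinate frame, with the sign prescribed by the orientation.\<close>
definition ee2 :: "real^2 \<Rightarrow> 2 \<Rightarrow> real" where
  "ee2 x i = \<epsilon> c (chart_inv c x) * (inverse (sqrt (gg 1 1 x)) * sdet x * (if i = 1 then - gg 1 2 x else gg 1 1 x))"

definition HH :: "sign \<Rightarrow> 2 \<Rightarrow> real^2 \<Rightarrow> complex" where
  "HH s i x = cframe (ee1 x) (ee2 x) s i"

lemma eps_sq: "x \<in> W \<Longrightarrow> \<epsilon> c (chart_inv c x) * \<epsilon> c (chart_inv c x) = 1"
  using signs atlas inv_in_dom unfolding oriented_signs_def by fastforce

lemma HH_smooth: "smooth_on W (HH s i)"
proof -
  have sg: "smooth_on W (\<lambda>x. inverse (sqrt (gg 1 1 x)))"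
    by (intro smooth_on_inverse_sqrt gg_smooth open_W gg_11_pos)
  have sd: "smooth_on W sdet" unfolding sdet_def
    by (intro smooth_on_inverse_sqrt smooth_on_diff smooth_on_mult gg_smooth open_W gg_det_pos)
  have se: "smooth_on W (\<lambda>x. \<epsilon> c (chart_inv c x))"
    by (rule smooth_on_locally_constant[OF open_W]) (use signs atlas in \<open>auto simp: oriented_signs_def\<close>)
  have "smooth_on W (\<lambda>x. ee1 x i)" unfolding ee1_def using sg by (cases "i = 1") auto
  moreover have "smooth_on W (\<lambda>x. if i = 1 then - gg 1 2 x else gg 1 1 x)"
    by (cases "i = 1") (auto intro: smooth_on_minus open_W gg_smooth)
  then have "smooth_on W (\<lambda>x. ee2 x i)" unfolding ee2_def
    by (intro smooth_on_mult se sg sd open_W)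
  ultimately show ?thesis unfolding HH_def[abs_def] cframe_def
    by (intro smooth_on_diff smooth_on_cnst_mult smooth_on_of_real open_W)
qed

lemma HH_nullpair:
  assumes x: "x \<in> W" shows "nullpair (\<lambda>i j. gg i j x) (\<lambda>s i. HH s i x)"
proof -
  define u where "u = inverse (sqrt (gg 1 1 x))"
  define \<epsilon>' where "\<epsilon>' = \<epsilon> c (chart_inv c x)"
  have u: "u * u * gg 1 1 x = 1"
    using gg_11_pos[OF x] unfolding u_def by (simp add: inverse_mult_distrib[symmetric] del: inverse_mult_distrib)
  have v: "sdet x * sdet x * (gg 1 1 x * gg 2 2 x - gg 1 2 x * gg 2 1 x) = 1"
    using gg_det_pos[OF x] unfolding sdet_def by (simp add: inverse_mult_distrib[symmetric] del: inverse_mult_distrib)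
  have e: "\<epsilon>' * \<epsilon>' = 1" unfolding \<epsilon>'_def by (rule eps_sq[OF x])
  note s = gg_sym[OF x, of 2 1]
  have "(\<Sum>i\<in>UNIV. \<Sum>j\<in>UNIV. gg i j x * ee1 x i * ee1 x j) = u * u * gg 1 1 x"
    unfolding ee1_def sum_2 u_def by simp
  moreover have "(\<Sum>i\<in>UNIV. \<Sum>j\<in>UNIV. gg i j x * ee1 x i * ee2 x j) = 0"
    unfolding ee1_def ee2_def sum_2 by (simp add: algebra_simps)
  moreover have "(\<Sum>i\<in>UNIV. \<Sum>j\<in>UNIV. gg i j x * ee2 x i * ee2 x j)
     = (\<epsilon>' * \<epsilon>') * (u * u * gg 1 1 x) * (sdet x * sdet x * (gg 1 1 x * gg 2 2 x - gg 1 2 x * gg 2 1 x))"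
    unfolding ee2_def sum_2 u_def[symmetric] \<epsilon>'_def[symmetric] using s by (simp add: algebra_simps)
  ultimately show ?thesis unfolding HH_def
    by (intro nullpair_cframe[OF s[symmetric]]) (simp_all only: u v e mult_1)
qed

lemma HH_det:
  assumes x: "x \<in> W"
  shows "frame_det (\<lambda>s i. HH s i x) = 2 * \<i> * of_real (\<epsilon> c (chart_inv c x) * sdet x)"
proof -
  have u: "inverse (sqrt (gg 1 1 x)) * inverse (sqrt (gg 1 1 x)) * gg 1 1 x = 1"
    using gg_11_pos[OF x] by (simp add: inverse_mult_distrib[symmetric] del: inverse_mult_distrib)
  have "ee1 x 1 * ee2 x 2 - ee1 x 2 * ee2 x 1
      = \<epsilon> c (chart_inv c x) * sdet x * (inverse (sqrt (gg 1 1 x)) * inverse (sqrt (gg 1 1 x)) * gg 1 1 x)"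
    unfolding ee1_def ee2_def by (simp add: mult_ac)
  then show ?thesis unfolding HH_def[abs_def] frame_det_cframe u by simp
qed

lemma sdet_pos: "x \<in> W \<Longrightarrow> sdet x > 0"
  using gg_det_pos unfolding sdet_def by simp

sublocale framed_chart R c HH
  using HH_nullpair by unfold_locales (auto simp: HH_smooth nullpair_def)

end

section \<open>Change of charts\<close>

lemma differentiable_comp:
  fixes T :: "real^2 \<Rightarrow> real^2" and F :: "real^2 \<Rightarrow> 'b::real_normed_vector"
  assumes "T differentiable (at x)" "F differentiable (at (T x))"
  shows "(\<lambda>x. F (T x)) differentiable (at x)"
  using has_derivative_compose[OF assms(1)[unfolded frechet_derivative_works]
      assms(2)[unfolded frechet_derivative_works]]
  unfolding differentiable_def by blast

text \<open>Reciprocal factors cancel in pairs. This is why balanced components are the same in all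
  oriented null frames.\<close>

lemma prod_list_balanced:
  fixes u :: "sign \<Rightarrow> complex"
  assumes "u Plus * u Minus = 1" "balanced w"
  shows "(\<Prod>s\<leftarrow>w. u s) = 1"
proof -
  have "(\<Prod>s\<leftarrow>w. u s) = u Plus ^ count_list w Plus * u Minus ^ count_list w Minus" for w
  proof (induction w)
    case (Cons s w)
    then show ?case by (cases s) (simp_all add: mult_ac)
  qed simp
  then have "(\<Prod>s\<leftarrow>w. u s) = (u Plus * u Minus) ^ count_list w Plus"
    using assms(2) unfolding balanced_def by (simp add: power_mult_distrib)
  then show ?thesis unfolding assms(1) by simp
qed

lemma contr_transform:
  assumes "\<And>J. Y J = (\<Sum>I | length I = length J. (\<Prod>m<length J. M (J ! m) (I ! m)) * X I)"
  shows "contr A w Y = contr (\<lambda>s i. \<Sum>j\<in>UNIV. A s j * M j i) w X"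
  using assms
proof (induction w arbitrary: X Y)
  case (Cons s w)
  have "contr A w (\<lambda>I. Y (j # I)) = (\<Sum>i\<in>UNIV. M j i * contr (\<lambda>s i. \<Sum>j\<in>UNIV. A s j * M j i) w (\<lambda>I. X (i # I)))" for j
  proof -
    have "contr A w (\<lambda>I. Y (j # I)) = contr (\<lambda>s i. \<Sum>j\<in>UNIV. A s j * M j i) w (\<lambda>I. \<Sum>i\<in>UNIV. M j i * X (i # I))"
    proof (rule Cons.IH)
      fix J
      show "Y (j # J) = (\<Sum>I | length I = length J. (\<Prod>m<length J. M (J ! m) (I ! m)) * (\<Sum>i\<in>UNIV. M j i * X (i # I)))"
        unfolding Cons.prems[of "j # J"] length_Cons sum_lists_Suc
        by (subst sum.swap) (simp add: prod.lessThan_Suc_shift sum_distrib_left sum_distrib_right mult_ac del: prod.lessThan_Suc)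
    qed
    then show ?thesis by (simp add: contr_sum contr_cmult)
  qed
  then show ?case by (simp add: sum_2 algebra_simps)
qed simp

lemma contr_scale:
  "contr (\<lambda>s i. u s * A s i) w X = (\<Prod>s\<leftarrow>w. u s) * contr A w X"
proof (induction w arbitrary: X)
  case (Cons s w)
  then show ?case by (simp add: sum_distrib_left mult_ac)
qed simp

locale chart_pair = C: oriented_chart R c \<epsilon> + D: oriented_chart R d \<epsilon>
  for R :: "('a::{t2_space,second_countable_topology}) riem" and c d \<epsilon>
begin

definition T :: "real^2 \<Rightarrow> real^2" where "T = snd d \<circ> chart_inv c"
definition Ov :: "(real^2) set" where "Ov = snd c ` (fst c \<inter> fst d)"
definition J :: "2 \<Rightarrow> 2 \<Rightarrow> real^2 \<Rightarrow> real" where "J a k x = pd k T x $ a"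

lemma atlas_smooth: "smooth_atlas (atlas R)"
  using C.riem unfolding riemannian_surface_def by blast

lemma open_Ov: "open Ov"
  unfolding Ov_def by (rule atlas_open_image[OF atlas_smooth C.atlas D.open_dom])

lemma Ov_D:
  assumes "x \<in> Ov"
  shows "x \<in> C.W" "chart_inv c x \<in> fst c" "chart_inv c x \<in> fst d" "T x \<in> D.W" "chart_inv d (T x) = chart_inv c x"
    "snd c (chart_inv c x) = x"
  using assms unfolding Ov_def T_def by auto

lemma T_smooth: "smooth_on Ov T"
  unfolding T_def Ov_def by (rule transition_smooth[OF atlas_smooth C.atlas D.atlas])

lemma T_differentiable: "x \<in> Ov \<Longrightarrow> T differentiable (at x)"
  by (rule smooth_on_differentiable[OF T_smooth])

lemma J_jac: "x \<in> Ov \<Longrightarrow> J a k x = jac c d (chart_inv c x) $ a $ k"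
  unfolding J_def T_def using jac_component[OF atlas_smooth C.atlas D.atlas] Ov_D by metis

lemma T_comp_smooth: "smooth_on Ov (\<lambda>y. T y $ a)"
  by (rule smooth_on_bounded_linear[OF open_Ov bounded_linear_vec_nth T_smooth])

lemma J_eq: "x \<in> Ov \<Longrightarrow> J a k x = pd k (\<lambda>y. T y $ a) x"
  unfolding J_def by (rule pd_component[symmetric, OF T_differentiable])

lemma J_smooth: "smooth_on Ov (J a k)"
  by (rule smooth_on_cong[OF open_Ov smooth_on_pd[OF T_comp_smooth]]) (simp add: J_eq)

lemma pd_J_sym:
  assumes x: "x \<in> Ov" shows "pd i (J a k) x = pd k (J a i) x"
proof -
  have "pd i (J a k) x = pd i (pd k (\<lambda>y. T y $ a)) x" for i k
    by (rule pd_cong[OF open_Ov x J_eq])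
  then show ?thesis using pd_commute_real[OF open_Ov x T_comp_smooth] by simp
qed

lemma gg_transform:
  assumes x: "x \<in> Ov"
  shows "C.gg i j x = (\<Sum>a\<in>UNIV. \<Sum>b\<in>UNIV. D.gg a b (T x) * J a i x * J b j x)"
proof -
  let ?q = "chart_inv c x"
  have "\<forall>c\<in>atlas R. \<forall>d\<in>atlas R. \<forall>q\<in>fst c \<inter> fst d.
        metric R c q = transpose (jac c d q) ** metric R d q ** jac c d q"
    using C.riem unfolding riemannian_surface_def by blast
  then have m: "metric R c ?q = transpose (jac c d ?q) ** metric R d ?q ** jac c d ?q"
    using C.atlas D.atlas Ov_D[OF x] by blast
  show ?thesis
    unfolding C.gg_def D.gg_def Ov_D(5)[OF x] m
    by (simp add: matrix_matrix_mult_def transpose_def sum_2 J_jac[OF x] algebra_simps)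
qed

text \<open>The null frame of \<open>c\<close> pushed forward to the coordinates of
  \<open>d\<close>.\<close>

definition L :: "sign \<Rightarrow> 2 \<Rightarrow> real^2 \<Rightarrow> complex" where
  "L s a x = (\<Sum>k\<in>UNIV. of_real (J a k x) * C.HH s k x)"

text \<open>The rotation factor from the frame of \<open>d\<close> to the pushed-forward frame;
  within this locale \<open>U\<close> is not an open set of the surface.\<close>

definition U :: "sign \<Rightarrow> real^2 \<Rightarrow> complex" where
  "U s x = (\<Sum>a\<in>UNIV. L s a x * D.dual s a (T x))"

lemma rotation:
  assumes x: "x \<in> Ov"
  shows "L s a x = U s x * D.HH s a (T x)" "U Plus x * U Minus x = 1"
proof -
  let ?g = "\<lambda>i j. D.gg i j (T x)"
  have xd: "T x \<in> D.W" and xc: "x \<in> C.W" using Ov_D[OF x] by auto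
  have "(\<Sum>i\<in>UNIV. \<Sum>j\<in>UNIV. of_real (?g i j) * L s i x * L t j x)
    = (\<Sum>i\<in>UNIV. \<Sum>j\<in>UNIV. of_real (C.gg i j x) * C.HH s i x * C.HH t j x)" for s t
    unfolding gg_transform[OF x] L_def sum_2 by (simp add: algebra_simps)
  then have nL: "nullpair ?g (\<lambda>s a. L s a x)"
    using C.HH_nullpair[OF xc] unfolding nullpair_def by simp
  define \<epsilon>1 \<epsilon>2 where "\<epsilon>1 = \<epsilon> c (chart_inv c x)" and "\<epsilon>2 = \<epsilon> d (chart_inv c x)"
  have dJ: "det (jac c d (chart_inv c x)) = J 1 1 x * J 2 2 x - J 1 2 x * J 2 1 x"
    by (simp add: det_2 J_jac[OF x])
  have pos: "det (jac c d (chart_inv c x)) * \<epsilon>1 * \<epsilon>2 > 0"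
    using C.signs C.atlas D.atlas Ov_D[OF x] unfolding oriented_signs_def \<epsilon>1_def \<epsilon>2_def by blast
  have "frame_det (\<lambda>s a. L s a x) = of_real (J 1 1 x * J 2 2 x - J 1 2 x * J 2 1 x) * frame_det (\<lambda>s i. C.HH s i x)"
    unfolding frame_det_def L_def sum_2 by (simp add: algebra_simps)
  then have fL: "frame_det (\<lambda>s a. L s a x) = 2 * \<i> * of_real (det (jac c d (chart_inv c x)) * (\<epsilon>1 * C.sdet x))"
    unfolding C.HH_det[OF xc] dJ \<epsilon>1_def by simp
  have fH: "frame_det (\<lambda>s i. D.HH s i (T x)) = 2 * \<i> * of_real (\<epsilon>2 * D.sdet (T x))"
    unfolding D.HH_det[OF xd] Ov_D(5)[OF x] \<epsilon>2_def ..
  have e: "det (jac c d (chart_inv c x)) * (\<epsilon>1 * C.sdet x) * (\<epsilon>2 * D.sdet (T x))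
      = (det (jac c d (chart_inv c x)) * \<epsilon>1 * \<epsilon>2) * (C.sdet x * D.sdet (T x))"
    by (simp add: mult_ac)
  have p: "det (jac c d (chart_inv c x)) * (\<epsilon>1 * C.sdet x) * (\<epsilon>2 * D.sdet (T x)) > 0"
    unfolding e by (rule mult_pos_pos[OF pos mult_pos_pos[OF C.sdet_pos[OF xc] D.sdet_pos[OF xd]]])
  have Ueq: "U s x = 1/2 * (\<Sum>i\<in>UNIV. \<Sum>j\<in>UNIV. of_real (?g i j) * L s i x * D.HH (neg s) j (T x))" for s
    unfolding U_def D.dual_def sum_2 by (simp add: algebra_simps)
  note rot = nullpair_rotation[OF D.HH_nullpair[OF xd] nL D.gg_sym[OF xd] fL fH p]
  show "L s a x = U s x * D.HH s a (T x)" unfolding Ueq by (rule rot(1))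
  show "U Plus x * U Minus x = 1" unfolding Ueq by (rule rot(2))
qed

lemma U_neg: "x \<in> Ov \<Longrightarrow> U s x * U (neg s) x = 1"
  using rotation(2)[of x] by (cases s) (auto simp: mult.commute)

lemma J_differentiable:
  assumes x: "x \<in> Ov" shows "(\<lambda>y. of_real (J a k y) :: complex) differentiable (at x)"
  by (rule smooth_on_differentiable[OF smooth_on_of_real[OF open_Ov J_smooth] x])

lemma dual_T_differentiable:
  assumes x: "x \<in> Ov" shows "(\<lambda>y. D.dual s a (T y)) differentiable (at x)"
  by (rule differentiable_comp[OF T_differentiable[OF x]
    smooth_on_differentiable[OF D.dual_smooth Ov_D(4)[OF x]]])

lemma U_differentiable:
  assumes x: "x \<in> Ov" shows "U s differentiable (at x)"
proof -
  have "(\<lambda>x. \<Sum>a\<in>UNIV. (\<Sum>k\<in>UNIV. of_real (J a k x) * C.HH s k x) * D.dual s a (T x)) differentiable (at x)"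
    by (intro differentiable_sum differentiable_mult ballI finite J_differentiable[OF x]
        dual_T_differentiable[OF x] C.H_differentiable Ov_D(1)[OF x])
  then show ?thesis unfolding U_def[abs_def] L_def .
qed

lemma dual_transform:
  assumes x: "x \<in> Ov"
  shows "(\<Sum>a\<in>UNIV. D.dual s a (T x) * of_real (J a k x)) = U s x * C.dual s k x"
proof -
  have xd: "T x \<in> D.W" and xc: "x \<in> C.W" using Ov_D[OF x] by auto
  let ?P = "\<lambda>k. (\<Sum>a\<in>UNIV. D.dual s a (T x) * of_real (J a k x))"
  have "?P k = (\<Sum>m\<in>UNIV. ?P m * (\<Sum>t\<in>UNIV. C.dual t k x * C.HH t m x))"
    unfolding C.H_dual[OF xc] by (simp add: if_distrib cong: if_cong)
  also have "\<dots> = (\<Sum>t\<in>UNIV. C.dual t k x * (\<Sum>a\<in>UNIV. D.dual s a (T x) * L t a x))"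
    unfolding L_def by (simp add: sum_2 sum_sign algebra_simps)
  also have "\<dots> = (\<Sum>t\<in>UNIV. C.dual t k x * U t x * (\<Sum>a\<in>UNIV. D.dual s a (T x) * D.HH t a (T x)))"
    unfolding rotation(1)[OF x] by (simp add: sum_2 sum_sign algebra_simps)
  also have "\<dots> = U s x * C.dual s k x"
    unfolding D.dual_H[OF xd] by (cases s) (simp_all add: sum_sign)
  finally show ?thesis .
qed

text \<open>As \<open>U Minus\<close> is the reciprocal of \<open>U Plus\<close>, this is the
  logarithmic derivative of \<open>U Plus\<close>, without a logarithm.\<close>

definition dlogU :: "2 \<Rightarrow> real^2 \<Rightarrow> complex" where
  "dlogU k x = pd k (U Plus) x * U Minus x"

lemma pd_U:
  assumes x: "x \<in> Ov" shows "pd k (U s) x = of_int (sg s) * dlogU k x * U s x"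
proof -
  have "pd k (\<lambda>y. U Plus y * U Minus y) x = pd k (\<lambda>y. 1) x"
    by (rule pd_cong[OF open_Ov x rotation(2)])
  then have z: "U Plus x * pd k (U Minus) x + pd k (U Plus) x * U Minus x = 0"
    unfolding pd_mult[OF U_differentiable[OF x] U_differentiable[OF x]] by simp
  have pm: "U Plus x * U Minus x = 1" by (rule rotation(2)[OF x])
  have "pd k (U Plus) x = pd k (U Plus) x * (U Plus x * U Minus x)" unfolding pm by simp
  moreover have "pd k (U Minus) x = U Minus x * (U Plus x * pd k (U Minus) x)"
    using pm by (simp add: mult.assoc[symmetric] mult.commute)
  moreover have "U Plus x * pd k (U Minus) x = - (pd k (U Plus) x * U Minus x)"
    using z by (simp add: add_eq_0_iff2)
  ultimately show ?thesis unfolding dlogU_def by (cases s) (simp_all add: mult_ac)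
qed

text \<open>Both coframes satisfy the structure equation \<open>d\<theta>\<^sup>s = - sg s \<omega> \<and> \<theta>\<^sup>s\<close>, and \<open>\<eta> \<and> \<theta>\<^sup>+ = \<eta> \<and> \<theta>\<^sup>- = 0\<close>
  forces \<open>\<eta> = 0\<close>; the second derivatives of the transition map cancel by symmetry.\<close>
lemma om_transform:
  assumes x: "x \<in> Ov"
  shows "C.om k x = (\<Sum>a\<in>UNIV. of_real (J a k x) * D.om a (T x)) + dlogU k x"
proof -
  have xd: "T x \<in> D.W" and xc: "x \<in> C.W" using Ov_D[OF x] by auto
  define om' where "om' k = (\<Sum>a\<in>UNIV. of_real (J a k x) * D.om a (T x))" for k
  note dJ = J_differentiable[OF x] and dD = dual_T_differentiable[OF x] and dU = U_differentiable[OF x]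
  have dC: "C.dual s k differentiable (at x)" for s k by (rule smooth_on_differentiable[OF C.dual_smooth xc])
  have dDD: "D.dual s k differentiable (at (T x))" for s k by (rule smooth_on_differentiable[OF D.dual_smooth xd])
  have pJ: "pd i (\<lambda>y. of_real (J a k y) :: complex) x = of_real (pd i (J a k) x)" for i a k
    by (rule pd_bounded_linear[OF bounded_linear_of_real smooth_on_differentiable[OF J_smooth x]])
  have pT: "pd i (\<lambda>y. D.dual s a (T y)) x = (\<Sum>b\<in>UNIV. of_real (J b i x) * pd b (D.dual s a) (T x))" for i s a
    unfolding pd_chain[OF T_differentiable[OF x] dDD] J_def scaleR_conv_of_real ..
  have dp: "(\<lambda>y. D.dual s a (T y) * of_real (J a k y)) differentiable (at x)" for s a k
    by (rule differentiable_mult[OF dD dJ])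
  have lhs: "pd i (\<lambda>y. \<Sum>a\<in>UNIV. D.dual s a (T y) * of_real (J a k y)) x =
    (\<Sum>a\<in>UNIV. D.dual s a (T x) * of_real (pd i (J a k) x)
      + (\<Sum>b\<in>UNIV. of_real (J b i x) * pd b (D.dual s a) (T x)) * of_real (J a k x))" for i s k
    unfolding pd_sum[of UNIV, OF dp] pd_mult[OF dD dJ] pJ pT ..
  have rhs: "pd i (\<lambda>y. U s y * C.dual s k y) x = U s x * pd i (C.dual s k) x
      + of_int (sg s) * dlogU i x * U s x * C.dual s k x" for i s k
    unfolding pd_mult[OF dU dC] pd_U[OF x] ..
  have eq: "(\<Sum>a\<in>UNIV. D.dual s a (T x) * of_real (pd i (J a k) x)
      + (\<Sum>b\<in>UNIV. of_real (J b i x) * pd b (D.dual s a) (T x)) * of_real (J a k x))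
      = U s x * pd i (C.dual s k) x + of_int (sg s) * dlogU i x * U s x * C.dual s k x" for i s k
    unfolding lhs[symmetric] rhs[symmetric] by (rule pd_cong[OF open_Ov x dual_transform])
  have key: "(C.om 1 x - om' 1 - dlogU 1 x) * C.dual s 2 x = (C.om 2 x - om' 2 - dlogU 2 x) * C.dual s 1 x" for s
  proof -
    have "of_int (sg s) * (om' 2 * (\<Sum>a\<in>UNIV. D.dual s a (T x) * of_real (J a 1 x))
         - om' 1 * (\<Sum>a\<in>UNIV. D.dual s a (T x) * of_real (J a 2 x)))
       = U s x * of_int (sg s) * (C.om 2 x * C.dual s 1 x - C.om 1 x * C.dual s 2 x)
        + of_int (sg s) * U s x * (dlogU 1 x * C.dual s 2 x - dlogU 2 x * C.dual s 1 x)"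
    proof -
      let ?l = "\<lambda>i k. (\<Sum>a\<in>UNIV. D.dual s a (T x) * of_real (pd i (J a k) x)
        + (\<Sum>b\<in>UNIV. of_real (J b i x) * pd b (D.dual s a) (T x)) * of_real (J a k x))"
      let ?r = "\<lambda>i k. U s x * pd i (C.dual s k) x + of_int (sg s) * dlogU i x * U s x * C.dual s k x"
      have "?l 1 2 - ?l 2 1 = of_int (sg s) * (om' 2 * (\<Sum>a\<in>UNIV. D.dual s a (T x) * of_real (J a 1 x))
         - om' 1 * (\<Sum>a\<in>UNIV. D.dual s a (T x) * of_real (J a 2 x)))"
        unfolding D.pd_dual[OF xd] om'_def sum_2
        by (simp add: pd_J_sym[OF x, of 1 _ 2] D.chr_sym[OF xd, of _ 1 2] algebra_simps)
      moreover have "?r 1 2 - ?r 2 1 = U s x * of_int (sg s) * (C.om 2 x * C.dual s 1 x - C.om 1 x * C.dual s 2 x)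
        + of_int (sg s) * U s x * (dlogU 1 x * C.dual s 2 x - dlogU 2 x * C.dual s 1 x)"
        unfolding C.pd_dual[OF xc] sum_2
        by (simp add: C.chr_sym[OF xc, of _ 1 2] algebra_simps)
      ultimately show ?thesis unfolding eq by (simp only:)
    qed
    then have "(of_int (sg s) * U s x) * (om' 2 * C.dual s 1 x - om' 1 * C.dual s 2 x)
       = (of_int (sg s) * U s x) * ((C.om 2 x * C.dual s 1 x - C.om 1 x * C.dual s 2 x)
        + (dlogU 1 x * C.dual s 2 x - dlogU 2 x * C.dual s 1 x))"
      unfolding dual_transform[OF x] by (simp add: algebra_simps)
    moreover have "of_int (sg s) * U s x \<noteq> 0"
      using U_neg[OF x, of s] by (cases s) auto
    ultimately have "om' 2 * C.dual s 1 x - om' 1 * C.dual s 2 x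
       = (C.om 2 x * C.dual s 1 x - C.om 1 x * C.dual s 2 x)
        + (dlogU 1 x * C.dual s 2 x - dlogU 2 x * C.dual s 1 x)" by (simp only: mult_cancel_left) simp
    then show ?thesis by (simp add: algebra_simps)
  qed
  define \<delta> where "\<delta> = C.dual Plus 1 x * C.dual Minus 2 x - C.dual Minus 1 x * C.dual Plus 2 x"
  have \<delta>0: "\<delta> \<noteq> 0" using C.det_dual_H[OF xc] unfolding \<delta>_def by auto
  \<comment> \<open>Cramer's rule for the two independent covectors of the coframe.\<close>
  have lin: "a1 * \<delta> = 0 \<and> a2 * \<delta> = 0"
    if a: "\<And>s. a1 * C.dual s 2 x = a2 * C.dual s 1 x" for a1 a2
  proof -
    have "a1 * \<delta> = C.dual Plus 1 x * (a1 * C.dual Minus 2 x) - C.dual Minus 1 x * (a1 * C.dual Plus 2 x)"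
      unfolding \<delta>_def by (simp add: algebra_simps)
    also have "\<dots> = 0" unfolding a by (simp add: algebra_simps)
    finally have 1: "a1 * \<delta> = 0" .
    have "a2 * \<delta> = (a2 * C.dual Plus 1 x) * C.dual Minus 2 x - (a2 * C.dual Minus 1 x) * C.dual Plus 2 x"
      unfolding \<delta>_def by (simp add: algebra_simps)
    also have "\<dots> = 0" unfolding a[symmetric] by (simp add: algebra_simps)
    finally show ?thesis using 1 by simp
  qed
  have "C.om 1 x - om' 1 - dlogU 1 x = 0" "C.om 2 x - om' 2 - dlogU 2 x = 0"
    using lin[OF key] \<delta>0 by auto
  then show ?thesis unfolding om'_def[symmetric] using exhaust_2[of k] by (auto simp: algebra_simps)
qed

definition Uw :: "sign list \<Rightarrow> real^2 \<Rightarrow> complex" where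
  "Uw w x = (\<Prod>s\<leftarrow>w. U s x)"

lemma Uw_simps [simp]: "Uw [] x = 1" "Uw (s # w) x = U s x * Uw w x"
  by (simp_all add: Uw_def)

lemma Uw_differentiable: "x \<in> Ov \<Longrightarrow> Uw w differentiable (at x)"
  unfolding Uw_def by (induction w) (auto intro!: differentiable_mult U_differentiable)

lemma pd_Uw:
  assumes x: "x \<in> Ov" shows "pd k (Uw w) x = of_int (charge w) * dlogU k x * Uw w x"
proof (induction w)
  case Nil
  show ?case unfolding Uw_def by simp
next
  case (Cons s w)
  have "Uw (s # w) = (\<lambda>y. U s y * Uw w y)" by (rule ext) simp
  then have "pd k (Uw (s # w)) x = pd k (\<lambda>y. U s y * Uw w y) x" by (rule arg_cong)
  also have "\<dots> = U s x * pd k (Uw w) x + pd k (U s) x * Uw w x"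
    by (rule pd_mult[OF U_differentiable[OF x] Uw_differentiable[OF x]])
  also have "\<dots> = of_int (charge (s # w)) * dlogU k x * Uw (s # w) x"
    unfolding Cons pd_U[OF x] by (simp add: algebra_simps)
  finally show ?case .
qed

lemma Uw_balanced: "x \<in> Ov \<Longrightarrow> balanced w \<Longrightarrow> Uw w x = 1"
  unfolding Uw_def by (rule prod_list_balanced[OF rotation(2)])

text \<open>Gauge covariance: differentiating the factor \<open>Uw w\<close> yields
  \<open>charge w\<close> times \<open>dlogU\<close>, exactly the change of the connection form with
  the same weight.\<close>

lemma frame_deriv_transform:
  assumes X: "open X" and gc: "smooth_on (snd c ` (fst c \<inter> X)) (g \<circ> chart_inv c)"
    and gd: "smooth_on (snd d ` (fst d \<inter> X)) (g \<circ> chart_inv d)"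
  shows "x \<in> snd c ` (fst c \<inter> fst d \<inter> X) \<Longrightarrow>
    frame_deriv C.HH C.om w (g \<circ> chart_inv c) x = Uw w x * frame_deriv D.HH D.om w (g \<circ> chart_inv d) (T x)"
proof (induction w arbitrary: x)
  case Nil
  then have "x \<in> Ov" unfolding Ov_def by auto
  then show ?case using Ov_D(5)[of x] by simp
next
  case (Cons s w)
  let ?V = "snd c ` (fst c \<inter> fst d \<inter> X)"
  let ?F = "frame_deriv C.HH C.om w (g \<circ> chart_inv c)" and ?G = "frame_deriv D.HH D.om w (g \<circ> chart_inv d)"
  have oV: "open ?V" using C.open_coord_image[of "fst d \<inter> X"] X D.open_dom by (simp add: Int_assoc open_Int)
  have x: "x \<in> Ov" using Cons.prems unfolding Ov_def by auto
  have "T x \<in> snd d ` (fst d \<inter> X)" using Cons.prems unfolding T_def by auto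
  moreover have "open (snd d ` (fst d \<inter> X))" by (rule D.open_coord_image[OF X])
  moreover have "snd d ` (fst d \<inter> X) \<subseteq> D.W" unfolding chart_range_def by auto
  ultimately have dG: "?G differentiable (at (T x))"
    using smooth_on_differentiable[OF D.frame_deriv_smooth[OF _ _ gd]] by blast
  have "pd k ?F x = pd k (\<lambda>y. Uw w y * ?G (T y)) x" for k
    by (rule pd_cong[OF oV Cons.prems Cons.IH])
  then have pF: "pd k ?F x = Uw w x * (\<Sum>a\<in>UNIV. of_real (J a k x) * pd a ?G (T x))
      + of_int (charge w) * dlogU k x * Uw w x * ?G (T x)" for k
    unfolding pd_mult[OF Uw_differentiable[OF x] differentiable_comp[OF T_differentiable[OF x] dG]]
      pd_chain[OF T_differentiable[OF x] dG] pd_Uw[OF x] J_def scaleR_conv_of_real .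
  have "frame_deriv C.HH C.om (s # w) (g \<circ> chart_inv c) x =
    (\<Sum>k\<in>UNIV. C.HH s k x * (pd k ?F x - of_int (charge w) * C.om k x * ?F x))"
    by (simp add: spin_deriv_def)
  also have "\<dots> = Uw w x * (\<Sum>a\<in>UNIV. L s a x * (pd a ?G (T x) - of_int (charge w) * D.om a (T x) * ?G (T x)))"
    unfolding pF om_transform[OF x] Cons.IH[OF Cons.prems] L_def sum_2 by (simp add: algebra_simps)
  also have "\<dots> = Uw (s # w) x * frame_deriv D.HH D.om (s # w) (g \<circ> chart_inv d) (T x)"
    unfolding rotation(1)[OF x] by (simp add: spin_deriv_def sum_2 algebra_simps)
  finally show ?case .
qed

lemma dual_contr_transform:
  assumes X: "tensor_section R X" and x: "x \<in> Ov"
  shows "contr (\<lambda>s i. D.dual s i (T x)) w (X d (chart_inv c x))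
    = Uw w x * contr (\<lambda>s i. C.dual s i x) w (X c (chart_inv c x))"
proof -
  have "\<forall>c\<in>atlas R. \<forall>d\<in>atlas R. \<forall>q\<in>fst c \<inter> fst d. \<forall>J.
        X d q J = (\<Sum>I | length I = length J.
          (\<Prod>m<length J. of_real (jac c d q $ (J ! m) $ (I ! m))) * X c q I)"
    using X unfolding tensor_section_def by blast
  then have "X d (chart_inv c x) J = (\<Sum>I | length I = length J.
          (\<Prod>m<length J. of_real (jac c d (chart_inv c x) $ (J ! m) $ (I ! m))) * X c (chart_inv c x) I)" for J
    using C.atlas D.atlas Ov_D[OF x] by blast
  then have "contr (\<lambda>s i. D.dual s i (T x)) w (X d (chart_inv c x))
      = contr (\<lambda>s i. \<Sum>j\<in>UNIV. D.dual s j (T x) * of_real (jac c d (chart_inv c x) $ j $ i)) w (X c (chart_inv c x))"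
    by (rule contr_transform)
  also have "\<dots> = contr (\<lambda>s i. U s x * C.dual s i x) w (X c (chart_inv c x))"
    unfolding J_jac[OF x, symmetric] dual_transform[OF x] ..
  finally show ?thesis unfolding contr_scale Uw_def .
qed

end

section \<open>Parallel tensors\<close>

lemma smooth_on_prod:
  fixes F :: "'k \<Rightarrow> real^2 \<Rightarrow> complex"
  shows "open S \<Longrightarrow> (\<And>a. a \<in> A \<Longrightarrow> smooth_on S (F a)) \<Longrightarrow> smooth_on S (\<lambda>x. \<Prod>a\<in>A. F a x)"
  by (induction A rule: infinite_finite_induct) (auto simp: smooth_on_mult)

lemma contr_smooth_on:
  assumes "open V" "\<And>s j. smooth_on V (A s j)"
  shows "(\<And>I. smooth_on V (T I)) \<Longrightarrow> smooth_on V (\<lambda>x. contr (\<lambda>s j. A s j x) w (\<lambda>I. T I x))"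
proof (induction w arbitrary: T)
  case (Cons s w)
  have "smooth_on V (\<lambda>x. contr (\<lambda>s j. A s j x) w (\<lambda>I. T (j # I) x))" for j
    by (rule Cons.IH) (rule Cons.prems)
  then show ?case unfolding contr.simps by (intro smooth_on_sum smooth_on_mult assms)
qed simp

lemma sum_lists_prod:
  fixes f :: "nat \<Rightarrow> 'k::finite \<Rightarrow> complex"
  shows "(\<Sum>I | length I = n. \<Prod>m<n. f m (I ! m)) = (\<Prod>m<n. \<Sum>k\<in>UNIV. f m k)"
proof (induction n arbitrary: f)
  case (Suc n)
  have "(\<Sum>I | length I = Suc n. \<Prod>m<Suc n. f m (I ! m))
      = (\<Sum>k\<in>UNIV. f 0 k * (\<Sum>I | length I = n. \<Prod>m<n. f (Suc m) (I ! m)))"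
    unfolding sum_lists_Suc by (simp add: prod.lessThan_Suc_shift sum_distrib_left del: prod.lessThan_Suc)
  also have "\<dots> = (\<Sum>k\<in>UNIV. f 0 k) * (\<Prod>m<n. \<Sum>k\<in>UNIV. f (Suc m) k)"
    unfolding Suc[of "\<lambda>m. f (Suc m)"] by (simp add: sum_distrib_right)
  also have "\<dots> = (\<Prod>m<Suc n. \<Sum>k\<in>UNIV. f m k)"
    by (simp add: prod.lessThan_Suc_shift del: prod.lessThan_Suc)
  finally show ?case .
qed simp

text \<open>Components of the tensor word \<open>v\<close> in the frame \<open>B\<close>, meant for
  lists of equal length.\<close>

definition word_comp :: "(sign \<Rightarrow> 2 \<Rightarrow> complex) \<Rightarrow> sign list \<Rightarrow> 2 list \<Rightarrow> complex" where
  "word_comp B v I = (\<Prod>m<length I. B (v ! m) (I ! m))"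

lemma word_comp_simps [simp]:
  "word_comp B v [] = 1" "word_comp B (s # v) (i # I) = B s i * word_comp B v I"
  by (simp_all add: word_comp_def prod.lessThan_Suc_shift del: prod.lessThan_Suc)

lemma contr_expand:
  assumes "\<And>i j. (\<Sum>s\<in>UNIV. A s i * B s j) = (if i = j then 1 else 0)"
  shows "T I = (\<Sum>w | length w = length I. contr A w T * word_comp B w I)"
proof (induction I arbitrary: T)
  case (Cons j I)
  have "(\<Sum>w | length w = length (j # I). contr A w T * word_comp B w (j # I))
    = (\<Sum>s\<in>UNIV. \<Sum>w | length w = length I. (\<Sum>i\<in>UNIV. A s i * contr A w (\<lambda>I. T (i # I))) * (B s j * word_comp B w I))"
    unfolding length_Cons sum_lists_Suc by simp
  also have "\<dots> = (\<Sum>w | length w = length I. \<Sum>i\<in>UNIV. (\<Sum>s\<in>UNIV. A s i * B s j) * (contr A w (\<lambda>I. T (i # I)) * word_comp B w I))"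
    by (subst sum.swap) (simp add: sum_sign sum_2 algebra_simps)
  also have "\<dots> = (\<Sum>w | length w = length I. contr A w (\<lambda>I. T (j # I)) * word_comp B w I)"
    unfolding assms by (simp add: if_distrib[of "\<lambda>z. z * _"] cong: if_cong)
  also have "\<dots> = T (j # I)" by (rule Cons[symmetric])
  finally show ?case by (rule sym)
qed simp

lemma contr_word_combination:
  assumes "\<And>s t. (\<Sum>i\<in>UNIV. A s i * B t i) = (if s = t then 1 else 0)"
  shows "contr A v (\<lambda>I. \<Sum>w | length w = length I. b w * word_comp B w I) = b v"
proof (induction v arbitrary: b)
  case (Cons s v)
  have "contr A (s # v) (\<lambda>I. \<Sum>w | length w = length I. b w * word_comp B w I)
    = (\<Sum>j\<in>UNIV. A s j * contr A v (\<lambda>I. \<Sum>t\<in>UNIV. B t j * (\<Sum>w | length w = length I. b (t # w) * word_comp B w I)))"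
    by (simp add: sum_lists_Suc sum_distrib_left mult_ac)
  also have "\<dots> = (\<Sum>j\<in>UNIV. A s j * (\<Sum>t\<in>UNIV. B t j * b (t # v)))"
    unfolding contr_sum contr_cmult Cons ..
  also have "\<dots> = (\<Sum>t\<in>UNIV. (\<Sum>j\<in>UNIV. A s j * B t j) * b (t # v))"
    by (simp add: sum_sign sum_2 algebra_simps)
  also have "\<dots> = b (s # v)"
    unfolding assms by (simp add: if_distrib[of "\<lambda>z. z * _"] cong: if_cong)
  finally show ?case .
qed simp

lemma finite_lists_le: "finite {I :: 'k::finite list. length I \<le> N}"
  using finite_lists_length_le[of "UNIV :: 'k set" N] by simp

lemma sum_lists_by_length:
  fixes F :: "'k::finite list \<Rightarrow> complex"
  shows "(\<Sum>I | length I \<le> N. F I) = (\<Sum>n\<le>N. \<Sum>I | length I = n. F I)"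
proof -
  have "(\<Sum>I | length I \<le> N. F I) = (\<Sum>n\<in>{..N}. \<Sum>I\<in>{I \<in> {I. length I \<le> N}. length I = n}. F I)"
    by (rule sum.group[symmetric]) (auto simp: finite_lists_le)
  also have "\<dots> = (\<Sum>n\<le>N. \<Sum>I | length I = n. F I)"
    by (intro sum.cong refl) auto
  finally show ?thesis .
qed

lemma word_comp_scale:
  "length I = length v \<Longrightarrow> word_comp (\<lambda>s i. u s * B s i) v I = (\<Prod>s\<leftarrow>v. u s) * word_comp B v I"
proof (induction v arbitrary: I)
  case (Cons s v)
  then show ?case by (cases I) (simp_all add: mult_ac)
qed simp

context framed_chart
begin

text \<open>The coefficient of the word \<open>h_w\<close> in \<open>X\<close>, as contraction with
  the coframe.\<close>

definition xi :: "'a tensor_field \<Rightarrow> sign list \<Rightarrow> real^2 \<Rightarrow> complex" where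
  "xi X w x = contr (\<lambda>s i. dual s i x) w (\<lambda>I. X c (chart_inv c x) I)"

lemma tensor_smooth: "tensor_section R X \<Longrightarrow> smooth_on W (\<lambda>x. X c (chart_inv c x) I)"
  using atlas unfolding tensor_section_def by blast

lemma xi_smooth: "tensor_section R X \<Longrightarrow> smooth_on W (xi X w)"
  unfolding xi_def[abs_def] by (intro contr_smooth_on open_W dual_smooth tensor_smooth)

lemma pd_xi:
  assumes X: "X \<in> parallel_sections R" and x: "x \<in> W"
  shows "pd k (xi X w) x = - of_int (charge w) * om k x * xi X w x"
proof -
  have ts: "tensor_section R X" and par: "pd k (\<lambda>y. X c (chart_inv c y) J) x +
        (\<Sum>m<length J. \<Sum>l\<in>UNIV. of_real (chr (J ! m) k l x) * X c (chart_inv c x) (J[m := l])) = 0" for J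
    using X atlas x unfolding parallel_sections_def by blast+
  \<comment> \<open>Upper indices are differentiated with the negative transpose of the matrix used
    for lower indices in \<open>contr_cov\<close>.\<close>
  let ?C = "\<lambda>i n. - of_real (chr n k i x) :: complex"
  have z: "pd k (\<lambda>y. X c (chart_inv c y) J) x - slot_act ?C J (\<lambda>I. X c (chart_inv c x) I) = 0" for J
    using par[of J] unfolding slot_act_eq by (simp add: sum_negf)
  have "pd k (xi X w) x = contr (\<lambda>s j. dual s j x) w
      (\<lambda>J. pd k (\<lambda>y. X c (chart_inv c y) J) x - slot_act ?C J (\<lambda>I. X c (chart_inv c x) I))
    + (\<Sum>s\<leftarrow>w. of_int (sg s) * (- om k x)) * xi X w x"
    unfolding xi_def[abs_def]
  proof (rule pd_contr)
    show "dual s j differentiable (at x)" for s j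
      by (rule smooth_on_differentiable[OF dual_smooth x])
    show "(\<lambda>x. X c (chart_inv c x) I) differentiable (at x)" for I
      by (rule smooth_on_differentiable[OF tensor_smooth[OF ts] x])
    show "pd k (dual s j) x = of_int (sg s) * (- om k x) * dual s j x - (\<Sum>n\<in>UNIV. ?C j n * dual s n x)" for s j
      unfolding pd_dual[OF x] sum_2 by simp
  qed
  then show ?thesis unfolding z contr_0 sum_list_sg by simp
qed

text \<open>The integrability condition of the parallel equation is \<open>charge w \<cdot> rho \<cdot> xi = 0\<close>, and \<open>rho\<close> is
  a nonzero multiple of the curvature.\<close>
lemma xi_unbalanced:
  assumes X: "X \<in> parallel_sections R" and x: "x \<in> W"
    and K: "sectional_curvature R c (chart_inv c x) = K" "K \<noteq> 0" and w: "\<not> balanced w"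
  shows "xi X w x = 0"
proof -
  have ts: "tensor_section R X" using X unfolding parallel_sections_def by blast
  let ?n = "of_int (charge w) :: complex"
  note do = om_differentiable[OF x] and dx = smooth_on_differentiable[OF xi_smooth[OF ts] x]
  have dm: "(\<lambda>y. om k y * xi X w y) differentiable (at x)" for k by (rule differentiable_mult[OF do dx])
  have "pd i (pd k (xi X w)) x = pd i (\<lambda>y. - ?n * (om k y * xi X w y)) x" for i k
    by (rule pd_cong[OF open_W x]) (simp add: pd_xi[OF X])
  then have p: "pd i (pd k (xi X w)) x = - ?n * (om k x * (- ?n * om i x * xi X w x) + pd i (om k) x * xi X w x)" for i k
    unfolding pd_cmult[OF dm] pd_mult[OF do dx] pd_xi[OF X x] .
  have "pd 1 (pd 2 (xi X w)) x = pd 2 (pd 1 (xi X w)) x"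
    by (rule pd_commute[OF open_W x xi_smooth[OF ts]])
  then have e: "- ?n * (om 2 x * (- ?n * om 1 x * xi X w x) + pd 1 (om 2) x * xi X w x)
     = - ?n * (om 1 x * (- ?n * om 2 x * xi X w x) + pd 2 (om 1) x * xi X w x)"
    unfolding p .
  have "?n * rho x * xi X w x = - ?n * (om 1 x * (- ?n * om 2 x * xi X w x) + pd 2 (om 1) x * xi X w x)
     - - ?n * (om 2 x * (- ?n * om 1 x * xi X w x) + pd 1 (om 2) x * xi X w x)"
    unfolding rho_def by (simp add: algebra_simps)
  also have "\<dots> = 0" unfolding e by simp
  finally have "?n * rho x * xi X w x = 0" .
  moreover have "rho x \<noteq> 0" using rho_eq[OF x K(1)] K(2) by auto
  moreover have "?n \<noteq> 0" using w by (simp add: balanced_iff)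
  ultimately show ?thesis by simp
qed

lemma xi_locally_constant:
  assumes X: "X \<in> parallel_sections R" and x: "x \<in> W" and w: "balanced w"
  shows "\<exists>N. open N \<and> x \<in> N \<and> N \<subseteq> W \<and> (\<forall>y\<in>N. xi X w y = xi X w x)"
proof -
  have ts: "tensor_section R X" using X unfolding parallel_sections_def by blast
  obtain r where r: "r > 0" "ball x r \<subseteq> W" using open_W x open_contains_ball by blast
  have "(xi X w has_derivative (\<lambda>h. 0)) (at y within ball x r)" if "y \<in> ball x r" for y
  proof -
    have y: "y \<in> W" using that r by blast
    have "pd a (xi X w) y = 0" for a using pd_xi[OF X y] w by (simp add: balanced_iff)
    then have "(xi X w has_derivative (\<lambda>h. 0)) (at y)"
      using differentiable_pd[OF smooth_on_differentiable[OF xi_smooth[OF ts] y], of w] by simp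
    then show ?thesis by (rule has_derivative_at_withinI)
  qed
  then obtain k where k: "\<And>y. y \<in> ball x r \<Longrightarrow> xi X w y = k"
    using has_derivative_zero_constant[OF convex_ball, of x r "xi X w"] by blast
  have "\<forall>y\<in>ball x r. xi X w y = xi X w x"
  proof
    fix y assume "y \<in> ball x r"
    moreover have "x \<in> ball x r" using r by simp
    ultimately show "xi X w y = xi X w x" by (simp only: k)
  qed
  moreover have "open (ball x r)" "x \<in> ball x r" using r by auto
  ultimately show ?thesis using r(2) by (intro exI[of _ "ball x r"] conjI)
qed

lemma tensor_expand:
  assumes x: "x \<in> W"
  shows "X c (chart_inv c x) I = (\<Sum>w | length w = length I. xi X w x * word_comp (\<lambda>s i. H s i x) w I)"
  unfolding xi_def by (rule contr_expand[OF H_dual[OF x], where T = "\<lambda>I. X c (chart_inv c x) I"])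

text \<open>The support of the components depends on the frame. The length bound replaces both
  supports by all lists of bounded length, where coordinates can be exchanged for the frame degree
  by degree.\<close>

lemma contraction_cov:
  assumes V: "open V" "V \<subseteq> W" "x \<in> V" and G: "smooth_on V G"
    and N: "\<And>I. N < length I \<Longrightarrow> X c (chart_inv c x) I = 0"
  shows "(\<Sum>I | X c (chart_inv c x) I \<noteq> 0. X c (chart_inv c x) I * cov R c G I x)
    = (\<Sum>w | length w \<le> N. xi X w x * frame_deriv H om w G x)"
proof -
  have x: "x \<in> W" using V by blast
  have "(\<Sum>I | X c (chart_inv c x) I \<noteq> 0. X c (chart_inv c x) I * cov R c G I x)
     = (\<Sum>I | length I \<le> N. X c (chart_inv c x) I * cov R c G I x)"
    by (rule sum.mono_neutral_left) (use N in \<open>auto simp: finite_lists_le not_le[symmetric]\<close>)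
  also have "\<dots> = (\<Sum>n\<le>N. \<Sum>I | length I = n. X c (chart_inv c x) I * cov R c G I x)"
    by (rule sum_lists_by_length)
  also have "\<dots> = (\<Sum>n\<le>N. \<Sum>w | length w = n. xi X w x * frame_deriv H om w G x)"
  proof (rule sum.cong[OF refl])
    fix n
    have "(\<Sum>I | length I = n. X c (chart_inv c x) I * cov R c G I x)
      = (\<Sum>I | length I = n. \<Sum>w | length w = n. xi X w x * (word_comp (\<lambda>s i. H s i x) w I * cov R c G I x))"
      by (rule sum.cong[OF refl], subst tensor_expand[OF x]) (auto simp: sum_distrib_right mult.assoc)
    also have "\<dots> = (\<Sum>w | length w = n. xi X w x * (\<Sum>I | length I = n. word_comp (\<lambda>s i. H s i x) w I * cov R c G I x))"
      by (subst sum.swap) (simp add: sum_distrib_left)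
    also have "\<dots> = (\<Sum>w | length w = n. xi X w x * contr (\<lambda>s j. H s j x) w (\<lambda>I. cov R c G I x))"
      unfolding contr_eq_sum word_comp_def by (intro sum.cong arg_cong2[of _ _ _ _ "(*)"] refl) auto
    finally show "(\<Sum>I | length I = n. X c (chart_inv c x) I * cov R c G I x)
      = (\<Sum>w | length w = n. xi X w x * frame_deriv H om w G x)"
      unfolding contr_cov[OF V(1,2) G V(3)] .
  qed
  also have "\<dots> = (\<Sum>w | length w \<le> N. xi X w x * frame_deriv H om w G x)"
    by (rule sum_lists_by_length[symmetric])
  finally show ?thesis .
qed

lemma word_comp_smooth: "smooth_on W (\<lambda>x. word_comp (\<lambda>s i. H s i x) v I)"
  unfolding word_comp_def by (intro smooth_on_prod open_W H_smooth)

lemma pd_word_comp: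
  assumes x: "x \<in> W"
  shows "length I = length v \<Longrightarrow> pd k (\<lambda>x. word_comp (\<lambda>s i. H s i x) v I) x
    = of_int (charge v) * om k x * word_comp (\<lambda>s i. H s i x) v I
      - slot_act (\<lambda>l j. of_real (chr j k l x)) I (word_comp (\<lambda>s i. H s i x) v)"
proof (induction v arbitrary: I)
  case (Cons s v)
  then obtain i I' where I: "I = i # I'" "length I' = length v" by (cases I) auto
  have "pd k (\<lambda>x. word_comp (\<lambda>s i. H s i x) (s # v) I) x
     = H s i x * pd k (\<lambda>x. word_comp (\<lambda>s i. H s i x) v I') x + pd k (H s i) x * word_comp (\<lambda>s i. H s i x) v I'"
    unfolding I word_comp_simps
    by (rule pd_mult[OF H_differentiable[OF x] smooth_on_differentiable[OF word_comp_smooth x]])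
  also have "\<dots> = of_int (charge (s # v)) * om k x * word_comp (\<lambda>s i. H s i x) (s # v) I
      - slot_act (\<lambda>l j. of_real (chr j k l x)) I (word_comp (\<lambda>s i. H s i x) (s # v))"
  proof -
    have sl: "slot_act C I' (\<lambda>J. H s i x * T J) = H s i x * slot_act C I' T" for C T
      unfolding slot_act_eq by (simp add: sum_distrib_left mult_ac)
    show ?thesis
      unfolding Cons.IH[OF I(2)] pd_H[OF x] I(1) slot_act.simps word_comp_simps sl
      by (simp add: sum_2 algebra_simps)
  qed
  finally show ?case .
qed simp

end

section \<open>The action of parallel tensors\<close>

abbreviation single :: "sign list \<Rightarrow> tensor" where
  "single w \<equiv> (\<lambda>v. if v = w then 1 else 0)"

lemma frame_deriv_add:
  assumes V: "open V" "\<And>s i. smooth_on V (H s i)" "\<And>k. smooth_on V (om k)"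
    and FG: "smooth_on V F" "smooth_on V G"
  shows "x \<in> V \<Longrightarrow> frame_deriv H om w (\<lambda>y. F y + G y) x = frame_deriv H om w F x + frame_deriv H om w G x"
proof (induction w arbitrary: x)
  case (Cons s w)
  have d: "frame_deriv H om w F differentiable (at x)" "frame_deriv H om w G differentiable (at x)"
    using smooth_on_differentiable[OF frame_deriv_smooth_on[OF V] Cons.prems] FG by auto
  have "frame_deriv H om (s # w) (\<lambda>y. F y + G y) x
      = spin_deriv H om (charge w) s (\<lambda>y. frame_deriv H om w F y + frame_deriv H om w G y) x"
    unfolding frame_deriv.simps by (rule spin_deriv_cong[OF V(1) Cons.prems Cons.IH])
  then show ?case unfolding spin_deriv_add[OF d] by simp
qed simp

lemma frame_deriv_cmult:
  assumes V: "open V" "\<And>s i. smooth_on V (H s i)" "\<And>k. smooth_on V (om k)"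
    and F: "smooth_on V F"
  shows "x \<in> V \<Longrightarrow> frame_deriv H om w (\<lambda>y. k * F y) x = k * frame_deriv H om w F x"
proof (induction w arbitrary: x)
  case (Cons s w)
  have d: "frame_deriv H om w F differentiable (at x)"
    by (rule smooth_on_differentiable[OF frame_deriv_smooth_on[OF V F] Cons.prems])
  have "frame_deriv H om (s # w) (\<lambda>y. k * F y) x
      = spin_deriv H om (charge w) s (\<lambda>y. k * frame_deriv H om w F y) x"
    unfolding frame_deriv.simps by (rule spin_deriv_cong[OF V(1) Cons.prems Cons.IH])
  then show ?case unfolding spin_deriv_cmult[OF d] by simp
qed simp

lemma frame_deriv_combination:
  assumes V: "open V" "\<And>s i. smooth_on V (H s i)" "\<And>k. smooth_on V (om k)"
    and F: "\<And>a. a \<in> S \<Longrightarrow> smooth_on V (F a)" and x: "x \<in> V" and S: "finite S"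
  shows "frame_deriv H om w (\<lambda>y. \<Sum>a\<in>S. k a * F a y) x = (\<Sum>a\<in>S. k a * frame_deriv H om w (F a) x)"
  using S F
proof (induction S)
  case empty
  have "frame_deriv H om w (\<lambda>y. 0 * (0::complex)) x = 0 * frame_deriv H om w (\<lambda>y. 0) x"
    by (rule frame_deriv_cmult[OF V smooth_on_const x])
  then show ?case by simp
next
  case (insert a S)
  have "frame_deriv H om w (\<lambda>y. k a * F a y + (\<Sum>a\<in>S. k a * F a y)) x
    = frame_deriv H om w (\<lambda>y. k a * F a y) x + frame_deriv H om w (\<lambda>y. \<Sum>a\<in>S. k a * F a y) x"
    by (rule frame_deriv_add[OF V _ _ x])
      (use insert.prems V(1) in \<open>auto intro!: smooth_on_sum smooth_on_cnst_mult\<close>)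
  also have "frame_deriv H om w (\<lambda>y. k a * F a y) x = k a * frame_deriv H om w (F a) x"
    by (rule frame_deriv_cmult[OF V insert.prems x]) simp
  finally show ?case using insert by simp
qed

locale surface_geometry =
  fixes R :: "('a::{t2_space,second_countable_topology}) riem" and K :: real
    and \<epsilon> :: "'a chart \<Rightarrow> 'a \<Rightarrow> real" and U :: "'a set"
  assumes riem: "riemannian_surface R" and conn: "connected (UNIV :: 'a set)"
    and curv: "constant_curvature R K" and K0: "K \<noteq> 0" and signs: "oriented_signs R \<epsilon>"
    and U: "open U"
begin

abbreviation "nframe c \<equiv> oriented_chart.HH R c \<epsilon>"
abbreviation "nconn c \<equiv> framed_chart.om R c (nframe c)"

definition fderiv :: "'a chart \<Rightarrow> sign list \<Rightarrow> ('a \<Rightarrow> complex) \<Rightarrow> 'a \<Rightarrow> complex" where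
  "fderiv c w g q = frame_deriv (nframe c) (nconn c) w (g \<circ> chart_inv c) (snd c q)"

definition xi_at :: "'a chart \<Rightarrow> 'a tensor_field \<Rightarrow> sign list \<Rightarrow> 'a \<Rightarrow> complex" where
  "xi_at c X w q = framed_chart.xi R c (nframe c) X w (snd c q)"

lemma oriented_chart_of: "c \<in> atlas R \<Longrightarrow> oriented_chart R c \<epsilon>"
  by unfold_locales (use riem signs in auto)

lemma framed_chart_of: "c \<in> atlas R \<Longrightarrow> framed_chart R c (nframe c)"
proof -
  assume "c \<in> atlas R"
  then interpret oriented_chart R c \<epsilon> by (rule oriented_chart_of)
  show ?thesis by (rule framed_chart_axioms)
qed

lemma chart_pair_of: "c \<in> atlas R \<Longrightarrow> d \<in> atlas R \<Longrightarrow> chart_pair R c d \<epsilon>"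
  unfolding chart_pair_def using oriented_chart_of by blast

lemma curvature_at: "c \<in> atlas R \<Longrightarrow> q \<in> fst c \<Longrightarrow> sectional_curvature R c q = K"
  using curv unfolding constant_curvature_def by blast

lemma chart_at: "\<exists>c. c \<in> atlas R \<and> q \<in> fst c"
  using riem unfolding riemannian_surface_def smooth_atlas_def by blast

abbreviation V :: "'a chart \<Rightarrow> (real^2) set" where "V c \<equiv> snd c ` (fst c \<inter> U)"

lemma V_open:
  assumes "c \<in> atlas R" shows "open (V c)" "V c \<subseteq> chart_range c"
proof -
  interpret oriented_chart R c \<epsilon> by (rule oriented_chart_of[OF assms])
  show "open (V c)" by (rule open_coord_image[OF U])
  show "V c \<subseteq> chart_range c" unfolding chart_range_def by auto
qed

lemma smooth_fun: "g \<in> smooth_functions R U \<Longrightarrow> c \<in> atlas R \<Longrightarrow> smooth_on (V c) (g \<circ> chart_inv c)"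
  unfolding smooth_functions_def by blast

lemma frame_smooth:
  assumes "c \<in> atlas R"
  shows "smooth_on (V c) (nframe c s i)" "smooth_on (V c) (nconn c k)"
proof -
  interpret framed_chart R c "nframe c" by (rule framed_chart_of[OF assms])
  show "smooth_on (V c) (nframe c s i)" by (rule smooth_on_subset[OF H_smooth V_open(2)[OF assms]])
  show "smooth_on (V c) (nconn c k)" by (rule smooth_on_subset[OF om_smooth V_open(2)[OF assms]])
qed

lemma fderiv_indep:
  assumes c: "c \<in> atlas R" "d \<in> atlas R" "q \<in> fst c" "q \<in> fst d" "q \<in> U"
    and g: "g \<in> smooth_functions R U" and w: "balanced w"
  shows "fderiv c w g q = fderiv d w g q"
proof -
  interpret P: chart_pair R c d \<epsilon> by (rule chart_pair_of[OF c(1,2)])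
  have x: "snd c q \<in> snd c ` (fst c \<inter> fst d \<inter> U)" "snd c q \<in> P.Ov" using c unfolding P.Ov_def by auto
  have "P.T (snd c q) = snd d q" unfolding P.T_def using c(3) by simp
  then show ?thesis
    using P.frame_deriv_transform[OF U smooth_fun[OF g c(1)] smooth_fun[OF g c(2)] x(1), of w]
      P.Uw_balanced[OF x(2) w] unfolding fderiv_def by simp
qed

lemma xi_at_indep:
  assumes c: "c \<in> atlas R" "d \<in> atlas R" "q \<in> fst c" "q \<in> fst d"
    and X: "X \<in> parallel_sections R" and w: "balanced w"
  shows "xi_at c X w q = xi_at d X w q"
proof -
  interpret P: chart_pair R c d \<epsilon> by (rule chart_pair_of[OF c(1,2)])
  have x: "snd c q \<in> P.Ov" using c unfolding P.Ov_def by auto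
  have T: "P.T (snd c q) = snd d q" unfolding P.T_def using c(3) by simp
  have "tensor_section R X" using X unfolding parallel_sections_def by blast
  from P.dual_contr_transform[OF this x, of w] show ?thesis
    unfolding xi_at_def P.C.xi_def P.D.xi_def T P.Uw_balanced[OF x w] using c(3,4) by simp
qed

text \<open>Connectedness of the surface enters here. The function \<open>F\<close> depends on the
  point alone, with a chosen chart at each point; chart independence makes it locally constant,
  hence constant.\<close>

lemma xi_at_const:
  assumes c: "c \<in> atlas R" "d \<in> atlas R" "q \<in> fst c" "r \<in> fst d"
    and X: "X \<in> parallel_sections R" and w: "balanced w"
  shows "xi_at c X w q = xi_at d X w r"
proof -
  define F where "F q = xi_at (SOME c. c \<in> atlas R \<and> q \<in> fst c) X w q" for q
  have F: "F q = xi_at c X w q" if "c \<in> atlas R" "q \<in> fst c" for c q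
    unfolding F_def using someI_ex[OF chart_at[of q]] that by (intro xi_at_indep X w) auto
  have "eventually (\<lambda>b. F a = F b) (at a within UNIV)" for a
  proof -
    obtain c where c: "c \<in> atlas R" "a \<in> fst c" using chart_at by blast
    interpret framed_chart R c "nframe c" by (rule framed_chart_of[OF c(1)])
    obtain N where N: "open N" "snd c a \<in> N" "N \<subseteq> W" "\<forall>y\<in>N. xi X w y = xi X w (snd c a)"
      using xi_locally_constant[OF X coord_in_W[OF c(2)] w] by blast
    have "open (fst c \<inter> snd c -` N)"
      by (rule continuous_open_preimage[OF homeomorphism_cont1[OF homeo] open_dom N(1)])
    moreover have "a \<in> fst c \<inter> snd c -` N" using c N by simp
    moreover have "F a = F b" if "b \<in> fst c \<inter> snd c -` N" for b
    proof -
      have "F b = xi X w (snd c b)" using F[OF c(1), of b] that unfolding xi_at_def by simp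
      also have "\<dots> = xi X w (snd c a)" using N(4) that by blast
      also have "\<dots> = F a" using F[OF c] unfolding xi_at_def by simp
      finally show ?thesis by (rule sym)
    qed
    ultimately show ?thesis unfolding eventually_at_topological by blast
  qed
  then have "F q = F r" using connected_local_const[OF conn, of q r F] by blast
  then show ?thesis unfolding F[OF c(1,3)] F[OF c(2,4)] .
qed

lemma xi_at_unbalanced:
  assumes "c \<in> atlas R" "q \<in> fst c" "X \<in> parallel_sections R" "\<not> balanced w"
  shows "xi_at c X w q = 0"
proof -
  interpret framed_chart R c "nframe c" by (rule framed_chart_of[OF assms(1)])
  show ?thesis unfolding xi_at_def
    by (rule xi_unbalanced[OF assms(3) coord_in_W[OF assms(2)] _ K0 assms(4)])
      (simp add: assms curvature_at)
qed

text \<open>\<open>par_act\<close> computes in a chosen chart. Unbalanced terms vanish and balanced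
  ones agree in all charts, so any chart \<open>d\<close> may be used.\<close>

lemma par_act_xi:
  assumes X: "X \<in> parallel_sections R" and g: "g \<in> smooth_functions R U"
    and N: "\<And>c q I. c \<in> atlas R \<Longrightarrow> q \<in> fst c \<Longrightarrow> N < length I \<Longrightarrow> X c q I = 0"
    and d: "d \<in> atlas R" "q \<in> fst d" "q \<in> U"
  shows "par_act R U X g q = (\<Sum>w | length w \<le> N. xi_at d X w q * fderiv d w g q)"
proof -
  define c where "c = (SOME c. c \<in> atlas R \<and> q \<in> fst c)"
  have c: "c \<in> atlas R" "q \<in> fst c" using someI_ex[OF chart_at[of q]] unfolding c_def by auto
  interpret framed_chart R c "nframe c" by (rule framed_chart_of[OF c(1)])
  have "par_act R U X g q = (\<Sum>I | X c q I \<noteq> 0. X c q I * cov R c (g \<circ> chart_inv c) I (snd c q))"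
    unfolding par_act_def using d(3) by (simp add: c_def Let_def)
  also have "\<dots> = (\<Sum>w | length w \<le> N. xi_at c X w q * fderiv c w g q)"
    using contraction_cov[OF V_open[OF c(1)] _ smooth_fun[OF g c(1)], of "snd c q" N X] c d N
    unfolding xi_at_def fderiv_def by simp
  also have "\<dots> = (\<Sum>w | length w \<le> N. xi_at d X w q * fderiv d w g q)"
  proof (rule sum.cong[OF refl])
    fix w
    show "xi_at c X w q * fderiv c w g q = xi_at d X w q * fderiv d w g q"
    proof (cases "balanced w")
      case True
      then show ?thesis using xi_at_indep[OF c(1) d(1) c(2) d(2) X True]
          fderiv_indep[OF c(1) d(1) c(2) d(2,3) g True] by simp
    next
      case False
      then show ?thesis using xi_at_unbalanced[OF c X False] xi_at_unbalanced[OF d(1,2) X False] by simp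
    qed
  qed
  finally show ?thesis .
qed

context
  fixes c p h and u :: "sign \<Rightarrow> complex"
  assumes c: "c \<in> atlas R" "p \<in> fst c"
    and h: "\<And>s i. h s $ i = u s * nframe c s i (snd c p)" and u: "u Plus * u Minus = 1"
begin

lemma u_neg: "u (neg s) * u s = 1"
  using u by (cases s) (auto simp: mult.commute)

text \<open>The basis dual to \<open>h\<close> is the coframe scaled by the reciprocal of
  \<open>u s\<close>, which is \<open>u (neg s)\<close>.\<close>

lemma value_at_xi:
  assumes X: "X \<in> parallel_sections R" and b: "value_at c p h X b"
  shows "b w = (\<Prod>s\<leftarrow>w. u (neg s)) * xi_at c X w p"
proof -
  interpret framed_chart R c "nframe c" by (rule framed_chart_of[OF c(1)])
  let ?A = "\<lambda>s i. u (neg s) * dual s i (snd c p)"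
  have "(\<Sum>i\<in>UNIV. ?A s i * (h t $ i)) = u (neg s) * u t * (\<Sum>i\<in>UNIV. dual s i (snd c p) * nframe c t i (snd c p))" for s t
    unfolding h by (simp add: sum_distrib_left mult_ac)
  then have dual: "(\<Sum>i\<in>UNIV. ?A s i * (h t $ i)) = (if s = t then 1 else 0)" for s t
    unfolding dual_H[OF coord_in_W[OF c(2)]] using u_neg by simp
  have X': "X c p I = (\<Sum>w | length w = length I. b w * word_comp (\<lambda>s i. h s $ i) w I)" for I
    using b unfolding value_at_def word_comp_def by simp
  have "contr ?A w (X c p) = contr ?A w (\<lambda>I. \<Sum>w | length w = length I. b w * word_comp (\<lambda>s i. h s $ i) w I)"
    by (rule contr_cong) (rule X')
  also have "\<dots> = b w" by (rule contr_word_combination[OF dual])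
  finally have "b w = contr ?A w (X c p)" by (rule sym)
  then show ?thesis unfolding contr_scale xi_at_def xi_def using c(2) by simp
qed

text \<open>For balanced words the rotation between \<open>h\<close> and the frame cancels and the
  coefficient is constant; for the others both sides vanish. Thus the value at \<open>p\<close>
  determines the action at every point of \<open>U\<close>.\<close>

lemma value_at_balanced:
  assumes X: "X \<in> parallel_sections R" and b: "value_at c p h X b" and d: "d \<in> atlas R" "q \<in> fst d"
  shows "b w = xi_at d X w q" "\<not> balanced w \<Longrightarrow> b w = 0"
proof -
  show nb: "b w = 0" if "\<not> balanced w"
    using value_at_xi[OF X b, of w] xi_at_unbalanced[OF c X that] by simp
  show "b w = xi_at d X w q"
  proof (cases "balanced w")
    case True
    have "(\<Prod>s\<leftarrow>w. u (neg s)) = 1"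
      by (rule prod_list_balanced[OF _ True]) (use u in \<open>simp add: mult.commute\<close>)
    then show ?thesis using value_at_xi[OF X b, of w] xi_at_const[OF c(1) d(1) c(2) d(2) X True] by simp
  next
    case False
    then show ?thesis using nb xi_at_unbalanced[OF d X] by simp
  qed
qed

lemma par_act_value:
  assumes X: "X \<in> parallel_sections R" and b: "value_at c p h X b"
    and g: "g \<in> smooth_functions R U" and d: "d \<in> atlas R" "q \<in> fst d" "q \<in> U"
  shows "par_act R U X g q = (\<Sum>w | b w \<noteq> 0. b w * fderiv d w g q)"
proof -
  have "tensor_section R X" using X unfolding parallel_sections_def by blast
  then have "\<exists>N. \<forall>c\<in>atlas R. \<forall>q\<in>fst c. \<forall>I. N < length I \<longrightarrow> X c q I = 0"
    unfolding tensor_section_def by (elim conjE)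
  then obtain N where "\<forall>c\<in>atlas R. \<forall>q\<in>fst c. \<forall>I. N < length I \<longrightarrow> X c q I = 0" by (elim exE)
  then have N: "X c q I = 0" if "c \<in> atlas R" "q \<in> fst c" "N < length I" for c q I using that by simp
  interpret framed_chart R c "nframe c" by (rule framed_chart_of[OF c(1)])
  have "b w = 0" if "N < length w" for w
  proof -
    have "contr (\<lambda>s i. dual s i (snd c p)) w (X c p) = contr (\<lambda>s i. dual s i (snd c p)) w (\<lambda>I. 0)"
      by (rule contr_cong) (use N[OF c] that in simp)
    then show ?thesis using value_at_xi[OF X b, of w] c(2) unfolding xi_at_def xi_def contr_0 by simp
  qed
  then have sub: "{w. b w \<noteq> 0} \<subseteq> {w. length w \<le> N}" by (auto simp: not_le[symmetric])
  have "par_act R U X g q = (\<Sum>w | length w \<le> N. xi_at d X w q * fderiv d w g q)"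
    by (rule par_act_xi[OF X g _ d]) (rule N)
  also have "\<dots> = (\<Sum>w | length w \<le> N. b w * fderiv d w g q)"
    unfolding value_at_balanced(1)[OF X b d(1,2)] ..
  also have "\<dots> = (\<Sum>w | b w \<noteq> 0. b w * fderiv d w g q)"
    by (rule sum.mono_neutral_right[OF finite_lists_le sub]) auto
  finally show ?thesis .
qed

lemma par_act_chart:
  assumes X: "X \<in> parallel_sections R" and b: "value_at c p h X b"
    and g: "g \<in> smooth_functions R U" and d: "d \<in> atlas R" and y: "y \<in> V d"
  shows "(par_act R U X g \<circ> chart_inv d) y
    = (\<Sum>w | b w \<noteq> 0. b w * frame_deriv (nframe d) (nconn d) w (g \<circ> chart_inv d) y)"
proof -
  interpret framed_chart R d "nframe d" by (rule framed_chart_of[OF d])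
  obtain q where q: "q \<in> fst d" "q \<in> U" "y = snd d q" using y by blast
  show ?thesis using par_act_value[OF X b g d q(1,2)] q unfolding fderiv_def by simp
qed

lemma par_act_smooth:
  assumes X: "X \<in> parallel_sections R" and b: "value_at c p h X b"
    and g: "g \<in> smooth_functions R U"
  shows "par_act R U X g \<in> smooth_functions R U"
proof -
  have "smooth_on (V d) (par_act R U X g \<circ> chart_inv d)" if d: "d \<in> atlas R" for d
  proof (rule smooth_on_cong[OF V_open(1)[OF d]])
    show "smooth_on (V d) (\<lambda>y. \<Sum>w | b w \<noteq> 0. b w * frame_deriv (nframe d) (nconn d) w (g \<circ> chart_inv d) y)"
      by (intro smooth_on_sum smooth_on_cnst_mult frame_deriv_smooth_on V_open[OF d] frame_smooth[OF d] smooth_fun[OF g d])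
    show "(\<Sum>w | b w \<noteq> 0. b w * frame_deriv (nframe d) (nconn d) w (g \<circ> chart_inv d) y) = (par_act R U X g \<circ> chart_inv d) y"
      if "y \<in> V d" for y
      by (rule par_act_chart[OF X b g d that, symmetric])
  qed
  then show ?thesis unfolding smooth_functions_def by (auto simp: par_act_def)
qed

text \<open>Every word occurring in \<open>b\<close> is balanced, so
  \<open>frame_deriv_append\<close> turns the iterated derivative into that of a concatenated
  word.\<close>

lemma fderiv_par_act:
  assumes X: "X \<in> parallel_sections R" and b: "value_at c p h X b"
    and g: "g \<in> smooth_functions R U" and d: "d \<in> atlas R" "q \<in> fst d" "q \<in> U"
  shows "fderiv d v (par_act R U X g) q = (\<Sum>w | b w \<noteq> 0. b w * fderiv d (v @ w) g q)"
proof -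
  have fin: "finite {w. b w \<noteq> 0}" using b unfolding value_at_def tensors_def by blast
  have y: "snd d q \<in> V d" using d by blast
  have "fderiv d v (par_act R U X g) q = frame_deriv (nframe d) (nconn d) v
      (\<lambda>y. \<Sum>w | b w \<noteq> 0. b w * frame_deriv (nframe d) (nconn d) w (g \<circ> chart_inv d) y) (snd d q)"
    unfolding fderiv_def by (rule frame_deriv_cong[OF V_open(1)[OF d(1)] par_act_chart[OF X b g d(1)] y])
  also have "\<dots> = (\<Sum>w | b w \<noteq> 0. b w * frame_deriv (nframe d) (nconn d) v
      (frame_deriv (nframe d) (nconn d) w (g \<circ> chart_inv d)) (snd d q))"
    by (rule frame_deriv_combination[OF V_open(1)[OF d(1)] frame_smooth[OF d(1)] _ y fin])
      (intro frame_deriv_smooth_on V_open[OF d(1)] frame_smooth[OF d(1)] smooth_fun[OF g d(1)])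
  also have "\<dots> = (\<Sum>w | b w \<noteq> 0. b w * fderiv d (v @ w) g q)"
  proof (rule sum.cong[OF refl])
    fix w assume "w \<in> {w. b w \<noteq> 0}"
    then have "balanced w" using value_at_balanced(2)[OF X b d(1,2), of w] by auto
    then show "b w * frame_deriv (nframe d) (nconn d) v (frame_deriv (nframe d) (nconn d) w (g \<circ> chart_inv d)) (snd d q)
        = b w * fderiv d (v @ w) g q" unfolding fderiv_def by (simp add: frame_deriv_append)
  qed
  finally show ?thesis .
qed

text \<open>The tensor \<open>h_v\<close> built from the local null frames is global because the
  rotation factor \<open>Uw v\<close> is 1, and parallel because the connection form enters with
  weight \<open>charge v\<close>, which is 0.\<close>

lemma parallel_word_exists:
  assumes v: "balanced v"
  shows "\<exists>X\<in>parallel_sections R. value_at c p h X (single v)"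
proof -
  define X :: "'a tensor_field" where
    "X d q I = (if length I = length v then word_comp (\<lambda>s i. nframe d s i (snd d q)) v I else 0)" for d q I
  have chart_X: "X d (chart_inv d x) I = (if length I = length v then word_comp (\<lambda>s i. nframe d s i x) v I else 0)"
    if "d \<in> atlas R" "x \<in> chart_range d" for d x I
  proof -
    interpret framed_chart R d "nframe d" by (rule framed_chart_of[OF that(1)])
    show ?thesis unfolding X_def using that(2) by simp
  qed
  have sm: "smooth_on (chart_range d) (\<lambda>x. X d (chart_inv d x) I)" if d: "d \<in> atlas R" for d I
  proof -
    interpret framed_chart R d "nframe d" by (rule framed_chart_of[OF d])
    have "smooth_on W (\<lambda>x. if length I = length v then word_comp (\<lambda>s i. nframe d s i x) v I else 0)"
      by (cases "length I = length v") (simp_all add: word_comp_smooth)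
    then show ?thesis by (rule smooth_on_cong[OF open_W]) (simp add: chart_X[OF d])
  qed
  have tr: "X d q J = (\<Sum>I | length I = length J.
          (\<Prod>m<length J. of_real (jac c d q $ (J ! m) $ (I ! m))) * X c q I)"
    if cd: "c \<in> atlas R" "d \<in> atlas R" "q \<in> fst c" "q \<in> fst d" for c d q J
  proof (cases "length J = length v")
    case False
    then show ?thesis unfolding X_def by simp
  next
    case True
    interpret P: chart_pair R c d \<epsilon> by (rule chart_pair_of[OF cd(1,2)])
    have x: "snd c q \<in> P.Ov" using cd unfolding P.Ov_def by auto
    have T: "P.T (snd c q) = snd d q" unfolding P.T_def using cd(3) by simp
    have jac: "jac c d q $ a $ k = P.J a k (snd c q)" for a k
      using P.J_jac[OF x, of a k] cd(3) by simp
    have "(\<Sum>I | length I = length J. (\<Prod>m<length J. of_real (jac c d q $ (J ! m) $ (I ! m))) * X c q I)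
      = (\<Sum>I | length I = length J. \<Prod>m<length J. of_real (P.J (J ! m) (I ! m) (snd c q)) * nframe c (v ! m) (I ! m) (snd c q))"
      unfolding jac by (intro sum.cong refl) (simp add: X_def True word_comp_def prod.distrib)
    also have "\<dots> = (\<Prod>m<length J. P.L (v ! m) (J ! m) (snd c q))"
      unfolding sum_lists_prod[where n = "length J" and f = "\<lambda>m k. of_real (P.J (J ! m) k (snd c q)) * nframe c (v ! m) k (snd c q)"] P.L_def ..
    also have "\<dots> = word_comp (\<lambda>s i. P.U s (snd c q) * nframe d s i (snd d q)) v J"
      unfolding P.rotation(1)[OF x] T word_comp_def ..
    also have "\<dots> = P.Uw v (snd c q) * word_comp (\<lambda>s i. nframe d s i (snd d q)) v J"
      unfolding word_comp_scale[OF True] P.Uw_def ..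
    also have "\<dots> = X d q J" unfolding P.Uw_balanced[OF x v] X_def using True by simp
    finally show ?thesis by (rule sym)
  qed
  have ts: "tensor_section R X" unfolding tensor_section_def
  proof (intro conjI ballI allI)
    show "\<exists>N. \<forall>c\<in>atlas R. \<forall>q\<in>fst c. \<forall>I. N < length I \<longrightarrow> X c q I = 0"
      unfolding X_def by (intro exI[of _ "length v"]) auto
  qed (use sm tr in auto)
  have par: "pd i (\<lambda>y. X d (chart_inv d y) J) x +
        (\<Sum>m<length J. \<Sum>l\<in>UNIV. of_real (christoffel R d (J ! m) i l x) *
            X d (chart_inv d x) (J[m := l])) = 0"
    if d: "d \<in> atlas R" and x: "x \<in> chart_range d" for d x i J
  proof -
    interpret framed_chart R d "nframe d" by (rule framed_chart_of[OF d])
    have p: "pd i (\<lambda>y. X d (chart_inv d y) J) x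
      = pd i (\<lambda>y. if length J = length v then word_comp (\<lambda>s i. nframe d s i y) v J else 0) x"
      by (rule pd_cong[OF open_W x]) (simp add: chart_X[OF d])
    show ?thesis
    proof (cases "length J = length v")
      case False
      then show ?thesis unfolding p chart_X[OF d x] by simp
    next
      case True
      then show ?thesis unfolding p chart_X[OF d x]
        using pd_word_comp[OF x True, of i] v by (simp add: balanced_iff slot_act_eq)
    qed
  qed
  have "X \<in> parallel_sections R" unfolding parallel_sections_def using ts par by blast
  moreover have "value_at c p h X (single v)"
    unfolding value_at_def tensors_def
  proof (intro conjI allI)
    fix I
    have "(\<Sum>w | length w = length I. (if w = v then 1 else 0) * (\<Prod>m<length I. h (w ! m) $ (I ! m)))
      = (\<Sum>w | length w = length I. if w = v then (\<Prod>m<length I. h (v ! m) $ (I ! m)) else 0)"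
      by (intro sum.cong refl) auto
    also have "\<dots> = (if length I = length v then word_comp (\<lambda>s i. h s $ i) v I else 0)"
      by (subst sum.delta) (use finite_lists_length_eq[of "UNIV :: sign set" "length I"] in \<open>auto simp: word_comp_def\<close>)
    also have "\<dots> = X c p I"
      using prod_list_balanced[OF u v] unfolding h by (auto simp: X_def word_comp_scale)
    finally show "X c p I = (\<Sum>w | length w = length I. (if w = v then 1 else 0) * (\<Prod>m<length I. h (w ! m) $ (I ! m)))"
      by (rule sym)
  qed simp
  ultimately show ?thesis by blast
qed

lemma par_act_eigenfunction:
  assumes f: "eigenfunction R U f" and v: "balanced v"
    and X: "X \<in> parallel_sections R" and b: "value_at c p h X (single v)"
  shows "\<exists>k. par_act R U X f = (\<lambda>q. k * f q)"
proof -
  have fs: "f \<in> smooth_functions R U" using f unfolding eigenfunction_def by blast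
  obtain ev where ev: "\<And>d q. d \<in> atlas R \<Longrightarrow> q \<in> fst d \<Longrightarrow> q \<in> U \<Longrightarrow> - laplacian R d f q = ev * f q"
    using f unfolding eigenfunction_def by blast
  \<comment> \<open>Two opposite letters act on \<open>f\<close> as the Laplacian, hence as
    \<open>-ev\<close>.\<close>
  have "par_act R U X f q = eigval (- ev) K v * f q" for q
  proof (cases "q \<in> U")
    case False
    then show ?thesis using fs by (simp add: par_act_def smooth_functions_def)
  next
    case True
    obtain d where d: "d \<in> atlas R" "q \<in> fst d" using chart_at by blast
    interpret framed_chart R d "nframe d" by (rule framed_chart_of[OF d(1)])
    have lap: "frame_deriv (nframe d) (nconn d) [s, neg s] (f \<circ> chart_inv d) x = - ev * (f \<circ> chart_inv d) x"
      if x: "x \<in> V d" for x s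
    proof -
      obtain r where r: "r \<in> fst d" "r \<in> U" "x = snd d r" using x by blast
      have "frame_deriv (nframe d) (nconn d) [s, neg s] (f \<circ> chart_inv d) x = laplacian R d f (chart_inv d x)"
        by (rule laplacian_frame[OF V_open[OF d(1)] x smooth_fun[OF fs d(1)], of K]) (use r d curvature_at in simp)
      then show ?thesis using ev[OF d(1) r(1,2)] r by (simp add: minus_equation_iff[of "laplacian R d f r"])
    qed
    have Kd: "sectional_curvature R d (chart_inv d x) = K" if "x \<in> V d" for x
      using that curvature_at[OF d(1)] by auto
    have "snd d q \<in> V d" using d True by blast
    then have "fderiv d v f q = eigval (- ev) K v * f q"
      unfolding fderiv_def
      using frame_deriv_balanced[OF V_open[OF d(1)] smooth_fun[OF fs d(1)] Kd lap _ v] d by simp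
    moreover have "{w. (if w = v then 1 else 0) \<noteq> (0::complex)} = {v}" by auto
    ultimately show ?thesis unfolding par_act_value[OF X b fs d True] by simp
  qed
  then show ?thesis by blast
qed

end

end

text \<open>The given basis may be negatively oriented in the chart, so the sign at \<open>p\<close>
  is adjusted to it; then only a rotation separates the two null frames.\<close>

lemma hvec_frame:
  assumes riem: "riemannian_surface R" and c: "c \<in> atlas R" "p \<in> fst c" and ob: "orthonormal_basis R c p e1 e2"
    and signs: "oriented_signs R \<epsilon>" and sgn: "\<epsilon> c p = sgn (e1 $ 1 * e2 $ 2 - e1 $ 2 * e2 $ 1)"
  shows "\<exists>u. u Plus * u Minus = 1 \<and> (\<forall>s i. hvec e1 e2 s $ i = u s * oriented_chart.HH R c \<epsilon> s i (snd c p))"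
proof -
  interpret oriented_chart R c \<epsilon> by unfold_locales (use riem c signs in auto)
  have x: "snd c p \<in> W" using c by simp
  let ?g = "\<lambda>i j. gg i j (snd c p)"
  let ?L = "cframe (($) e1) (($) e2)"
  have h: "hvec e1 e2 s $ i = ?L s i" for s i
    unfolding hvec_def cframe_def by (cases s) simp_all
  have g: "?g i j = metric R c p $ i $ j" for i j unfolding gg_def using c by simp
  have L: "nullpair ?g ?L"
    by (rule nullpair_cframe[OF gg_sym[OF x]])
      (use ob in \<open>simp_all add: orthonormal_basis_def inner_vec_def matrix_vector_mult_def g sum_2 algebra_simps\<close>)
  have "\<epsilon> c p \<in> {1, -1}" using signs c unfolding oriented_signs_def by blast
  then have "(e1 $ 1 * e2 $ 2 - e1 $ 2 * e2 $ 1) * \<epsilon> c p > 0"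
    unfolding sgn by (auto simp: sgn_if split: if_splits)
  then have pos: "(e1 $ 1 * e2 $ 2 - e1 $ 2 * e2 $ 1) * (\<epsilon> c (chart_inv c (snd c p)) * sdet (snd c p)) > 0"
    using mult_pos_pos[OF _ sdet_pos[OF x]] c by (simp add: mult.assoc[symmetric])
  note rot = nullpair_rotation[OF HH_nullpair[OF x] L gg_sym[OF x] frame_det_cframe HH_det[OF x] pos]
  show ?thesis unfolding h
  proof (rule exI, intro conjI allI)
    show "cframe (($) e1) (($) e2) s i = (1/2 * (\<Sum>i\<in>UNIV. \<Sum>j\<in>UNIV. of_real (?g i j)
        * cframe (($) e1) (($) e2) s i * HH (neg s) j (snd c p))) * HH s i (snd c p)" for s i
      by (rule rot(1))
  qed (rule rot(2))
qed

text \<open>What the algebra needs to know about the geometry: \<open>Dq v g\<close> is \<open>(\<nabla>\<^sup>k g)(h\<^bsub>v\<^esub>)\<close> at a point where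
  \<open>f\<close> does not vanish.\<close>
locale balanced_action =
  fixes R :: "('a::{t2_space,second_countable_topology}) riem" and c p h U f
    and Dq :: "sign list \<Rightarrow> ('a \<Rightarrow> complex) \<Rightarrow> complex"
  assumes riem: "riemannian_surface R" and U: "open U" and f: "f \<in> smooth_functions R U"
    and Dq_add: "\<And>w g g'. g \<in> smooth_functions R U \<Longrightarrow> g' \<in> smooth_functions R U \<Longrightarrow>
      Dq w (\<lambda>q. g q + g' q) = Dq w g + Dq w g'"
    and Dq_sm: "\<And>w k g. g \<in> smooth_functions R U \<Longrightarrow> Dq w (\<lambda>q. k * g q) = k * Dq w g"
    and Dq_f: "Dq [] f \<noteq> 0"
    and value_balanced: "\<And>X b w. X \<in> parallel_sections R \<Longrightarrow> value_at c p h X b \<Longrightarrow> b w \<noteq> 0 \<Longrightarrow> balanced w"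
    and par_smooth: "\<And>X b g. X \<in> parallel_sections R \<Longrightarrow> value_at c p h X b \<Longrightarrow> g \<in> smooth_functions R U \<Longrightarrow>
      par_act R U X g \<in> smooth_functions R U"
    and Dq_par: "\<And>X b g v. X \<in> parallel_sections R \<Longrightarrow> value_at c p h X b \<Longrightarrow> g \<in> smooth_functions R U \<Longrightarrow>
      Dq v (par_act R U X g) = (\<Sum>w | b w \<noteq> 0. b w * Dq (v @ w) g)"
    and eigen: "\<And>v. balanced v \<Longrightarrow> \<exists>X\<in>parallel_sections R. value_at c p h X (single v)
      \<and> (\<exists>k. par_act R U X f = (\<lambda>q. k * f q))"

text \<open>The orientation is chosen to fit \<open>e1\<close>, \<open>e2\<close> at
  \<open>p\<close>, while \<open>Dq\<close> differentiates at a point \<open>q\<close> of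
  \<open>U\<close> with \<open>f q\<close> nonzero.\<close>

lemma geometric_action:
  fixes R :: "('a::{t2_space,second_countable_topology}) riem" and e1 e2 :: "real^2"
  assumes riem: "riemannian_surface R" and conn: "connected (UNIV :: 'a set)" and orient: "orientable R"
    and curv: "constant_curvature R K" "K \<noteq> 0"
    and c: "c \<in> atlas R" "p \<in> fst c" and ob: "orthonormal_basis R c p e1 e2"
    and U: "open U" and f: "eigenfunction R U f"
  shows "\<exists>Dq. balanced_action R c p (hvec e1 e2) U f Dq"
proof -
  define t where "t = sgn (e1 $ 1 * e2 $ 2 - e1 $ 2 * e2 $ 1)"
  have "t \<in> {1, -1}"
  proof -
    interpret coord_chart R c by unfold_locales (use riem c in auto)
    have s: "metric R c p $ 1 $ 2 = metric R c p $ 2 $ 1" by (rule metric_sym[OF c(2)])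
    have o: "metric R c p $ 1 $ 1 * e1 $ 1 * e1 $ 1 + 2 * metric R c p $ 2 $ 1 * e1 $ 1 * e1 $ 2 + metric R c p $ 2 $ 2 * e1 $ 2 * e1 $ 2 = 1"
      "metric R c p $ 1 $ 1 * e2 $ 1 * e2 $ 1 + 2 * metric R c p $ 2 $ 1 * e2 $ 1 * e2 $ 2 + metric R c p $ 2 $ 2 * e2 $ 2 * e2 $ 2 = 1"
      "metric R c p $ 1 $ 1 * e1 $ 1 * e2 $ 1 + metric R c p $ 2 $ 1 * (e1 $ 1 * e2 $ 2 + e1 $ 2 * e2 $ 1) + metric R c p $ 2 $ 2 * e1 $ 2 * e2 $ 2 = 0"
      using ob s by (simp_all add: orthonormal_basis_def inner_vec_def matrix_vector_mult_def sum_2 algebra_simps)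
    \<comment> \<open>The determinant of the Gram matrix of \<open>e1\<close>, \<open>e2\<close>,
      which is 1 by orthonormality; hence the basis has a well-defined orientation sign.\<close>
    have "(e1 $ 1 * e2 $ 2 - e1 $ 2 * e2 $ 1)^2 * det (metric R c p) =
        (metric R c p $ 1 $ 1 * e1 $ 1 * e1 $ 1 + 2 * metric R c p $ 2 $ 1 * e1 $ 1 * e1 $ 2 + metric R c p $ 2 $ 2 * e1 $ 2 * e1 $ 2)
        * (metric R c p $ 1 $ 1 * e2 $ 1 * e2 $ 1 + 2 * metric R c p $ 2 $ 1 * e2 $ 1 * e2 $ 2 + metric R c p $ 2 $ 2 * e2 $ 2 * e2 $ 2)
        - (metric R c p $ 1 $ 1 * e1 $ 1 * e2 $ 1 + metric R c p $ 2 $ 1 * (e1 $ 1 * e2 $ 2 + e1 $ 2 * e2 $ 1) + metric R c p $ 2 $ 2 * e1 $ 2 * e2 $ 2)^2"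
      unfolding det_2 s by (simp add: power2_eq_square algebra_simps)
    also have "\<dots> = 1" unfolding o by simp
    finally have "e1 $ 1 * e2 $ 2 - e1 $ 2 * e2 $ 1 \<noteq> 0" by auto
    then show ?thesis unfolding t_def by (simp add: sgn_if)
  qed
  then obtain \<epsilon> where eps: "oriented_signs R \<epsilon>" "\<epsilon> c p = t"
    using oriented_signs_exist[OF orient c(2,1)] by blast
  interpret surface_geometry R K \<epsilon> U
    by unfold_locales (use riem conn curv eps U in auto)
  obtain u where u: "u Plus * u Minus = 1" "\<And>s i. hvec e1 e2 s $ i = u s * nframe c s i (snd c p)"
    using hvec_frame[OF riem c ob eps(1)] eps(2) unfolding t_def by blast
  have fs: "f \<in> smooth_functions R U" using f unfolding eigenfunction_def by blast
  obtain q where q: "q \<in> U" "f q \<noteq> 0" using f unfolding eigenfunction_def by blast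
  obtain d where d: "d \<in> atlas R" "q \<in> fst d" using chart_at by blast
  interpret D: framed_chart R d "nframe d" by (rule framed_chart_of[OF d(1)])
  have y: "snd d q \<in> V d" using d q by blast
  note sm = V_open(1)[OF d(1)] frame_smooth[OF d(1)]
  note ctx = c u(2,1)
  have "balanced_action R c p (hvec e1 e2) U f (\<lambda>w g. fderiv d w g q)"
  proof
    show "riemannian_surface R" by (rule riem)
    show "open U" by (rule U)
    show "f \<in> smooth_functions R U" by (rule fs)
    show "fderiv d w (\<lambda>q. g q + g' q) q = fderiv d w g q + fderiv d w g' q"
      if "g \<in> smooth_functions R U" "g' \<in> smooth_functions R U" for w g g'
      using frame_deriv_add[OF sm smooth_fun[OF that(1) d(1)] smooth_fun[OF that(2) d(1)] y, where w = w]
      unfolding fderiv_def comp_def by simp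
    show "fderiv d w (\<lambda>q. k * g q) q = k * fderiv d w g q" if "g \<in> smooth_functions R U" for w k g
      using frame_deriv_cmult[OF sm smooth_fun[OF that d(1)] y, where w = w and k = k]
      unfolding fderiv_def comp_def by simp
    show "fderiv d [] f q \<noteq> 0" unfolding fderiv_def using q d by simp
    show "balanced w" if "X \<in> parallel_sections R" "value_at c p (hvec e1 e2) X b" "b w \<noteq> 0" for X b w
      using value_at_balanced(2)[OF ctx that(1,2) d, of w] that(3) by blast
    show "par_act R U X g \<in> smooth_functions R U"
      if "X \<in> parallel_sections R" "value_at c p (hvec e1 e2) X b" "g \<in> smooth_functions R U" for X b g
      by (rule par_act_smooth[OF ctx that])
    show "fderiv d v (par_act R U X g) q = (\<Sum>w | b w \<noteq> 0. b w * fderiv d (v @ w) g q)"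
      if "X \<in> parallel_sections R" "value_at c p (hvec e1 e2) X b" "g \<in> smooth_functions R U" for X b g v
      by (rule fderiv_par_act[OF ctx that d q(1)])
    show "\<exists>X\<in>parallel_sections R. value_at c p (hvec e1 e2) X (single v)
      \<and> (\<exists>k. par_act R U X f = (\<lambda>q. k * f q))" if "balanced v" for v
      using parallel_word_exists[OF ctx that] par_act_eigenfunction[OF ctx f that] by blast
  qed
  then show ?thesis by blast
qed

section \<open>Complex vector spaces with explicit carrier\<close>

text \<open>Scalars are the type \<open>complex\<close> and not the carrier of a ring, so the vector
  space laws are stated directly over the additive group.\<close>

locale cspace = abelian_group M for M :: "(complex, 'v) module" (structure) +
  assumes sm_closed [simp, intro]: "x \<in> carrier M \<Longrightarrow> k \<odot> x \<in> carrier M"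
    and sm_add: "x \<in> carrier M \<Longrightarrow> y \<in> carrier M \<Longrightarrow> k \<odot> (x \<oplus> y) = k \<odot> x \<oplus> k \<odot> y"
    and add_sm: "x \<in> carrier M \<Longrightarrow> (j + k) \<odot> x = j \<odot> x \<oplus> k \<odot> x"
    and sm_sm: "x \<in> carrier M \<Longrightarrow> j \<odot> (k \<odot> x) = (j * k) \<odot> x"
    and one_sm: "x \<in> carrier M \<Longrightarrow> 1 \<odot> x = x"
begin

lemma zero_sm [simp]: "x \<in> carrier M \<Longrightarrow> 0 \<odot> x = \<zero>"
proof -
  assume x: "x \<in> carrier M"
  have "0 \<odot> x \<oplus> 0 \<odot> x = 0 \<odot> x" using add_sm[OF x, of 0 0] by simp
  then show ?thesis using x by simp
qed

lemma sm_zero [simp]: "k \<odot> \<zero> = \<zero>"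
  using sm_sm[of \<zero> k 0] by simp

definition csubspace :: "'v set \<Rightarrow> bool" where
  "csubspace W \<longleftrightarrow> W \<subseteq> carrier M \<and> \<zero> \<in> W \<and> (\<forall>x\<in>W. \<forall>y\<in>W. x \<oplus> y \<in> W) \<and> (\<forall>k. \<forall>x\<in>W. k \<odot> x \<in> W)"

lemma finsum_in_csubspace:
  assumes W: "csubspace W" shows "(\<And>i. i \<in> F \<Longrightarrow> g i \<in> W) \<Longrightarrow> finsum M g F \<in> W"
proof (induction F rule: infinite_finite_induct)
  case (insert i F)
  moreover have "g \<in> F \<rightarrow> carrier M" "g i \<in> carrier M" using insert W unfolding csubspace_def by auto
  ultimately show ?case using W unfolding csubspace_def by (simp add: finsum_insert)
qed (use W in \<open>auto simp: csubspace_def finsum_infinite\<close>)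

lemma sm_finsum:
  assumes "finite F" "g \<in> F \<rightarrow> carrier M"
  shows "k \<odot> finsum M g F = finsum M (\<lambda>i. k \<odot> g i) F"
  using assms
proof (induction F)
  case (insert i F)
  then have "g \<in> F \<rightarrow> carrier M" "g i \<in> carrier M" by auto
  with insert show ?case by (simp add: finsum_insert sm_add Pi_iff)
qed simp

lemma finsum_single:
  assumes "finite B" "a \<in> B" "g a \<in> carrier M" "\<And>x. x \<in> B \<Longrightarrow> x \<noteq> a \<Longrightarrow> g x = \<zero>"
  shows "finsum M g B = g a"
proof -
  have "g x \<in> carrier M" if "x \<in> B" for x
    using assms(3) assms(4)[OF that] by (cases "x = a") auto
  then have "g \<in> B \<rightarrow> carrier M" by blast
  then have "finsum M g {a} = finsum M g B"
    using assms by (intro add.finprod_mono_neutral_cong_left) auto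
  then show ?thesis using finsum_insert[of "{}" a g] assms(3) by simp
qed

lemma csubspace_lin_span:
  assumes A: "A \<subseteq> carrier M" shows "csubspace (lin_span M A)"
  unfolding csubspace_def
proof (intro conjI ballI allI)
  show "lin_span M A \<subseteq> carrier M"
    unfolding lin_span_def using A by (auto intro!: finsum_closed)
  show "\<zero> \<in> lin_span M A" unfolding lin_span_def
    by (intro CollectI exI[of _ "\<lambda>x. 0"] exI[of _ "{}"]) simp
  fix x y assume "x \<in> lin_span M A" "y \<in> lin_span M A"
  then obtain j k F G where x: "x = finsum M (\<lambda>x. j x \<odot> x) F" "finite F" "F \<subseteq> A"
    and y: "y = finsum M (\<lambda>x. k x \<odot> x) G" "finite G" "G \<subseteq> A"
    unfolding lin_span_def by blast
  let ?B = "F \<union> G"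
  have B: "?B \<subseteq> carrier M" using x y A by auto
  have "x = finsum M (\<lambda>x. (if x \<in> F then j x else 0) \<odot> x) ?B"
    unfolding x(1) by (rule add.finprod_mono_neutral_cong_left) (use x y B in auto)
  moreover have "y = finsum M (\<lambda>x. (if x \<in> G then k x else 0) \<odot> x) ?B"
    unfolding y(1) by (rule add.finprod_mono_neutral_cong_left) (use x y B in auto)
  ultimately have "x \<oplus> y = finsum M (\<lambda>x. (if x \<in> F then j x else 0) \<odot> x \<oplus> (if x \<in> G then k x else 0) \<odot> x) ?B"
    using B by (subst finsum_addf) auto
  also have "\<dots> = finsum M (\<lambda>x. ((if x \<in> F then j x else 0) + (if x \<in> G then k x else 0)) \<odot> x) ?B"
    using B by (intro finsum_cong') (auto simp: add_sm)
  finally have "x \<oplus> y = finsum M (\<lambda>x. ((if x \<in> F then j x else 0) + (if x \<in> G then k x else 0)) \<odot> x) ?B" .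
  moreover have "finite ?B" "?B \<subseteq> A" using x y by auto
  ultimately show "x \<oplus> y \<in> lin_span M A"
    unfolding lin_span_def
    by (intro CollectI exI[of _ "\<lambda>x. (if x \<in> F then j x else 0) + (if x \<in> G then k x else 0)"] exI[of _ ?B] conjI)
next
  fix k x assume "x \<in> lin_span M A"
  then obtain j F where x: "x = finsum M (\<lambda>x. j x \<odot> x) F" "finite F" "F \<subseteq> A"
    unfolding lin_span_def by blast
  have F: "F \<subseteq> carrier M" using x A by auto
  have "k \<odot> x = finsum M (\<lambda>x. k \<odot> (j x \<odot> x)) F"
    unfolding x(1) by (rule sm_finsum) (use x F in auto)
  also have "\<dots> = finsum M (\<lambda>x. (k * j x) \<odot> x) F"
    using F by (intro finsum_cong') (auto simp: sm_sm)
  finally show "k \<odot> x \<in> lin_span M A"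
    unfolding lin_span_def using x(2,3)
    by (intro CollectI exI[of _ "\<lambda>x. k * j x"] exI[of _ F] conjI)
qed

lemma lin_span_base:
  assumes "x \<in> A" "x \<in> carrier M" shows "x \<in> lin_span M A"
proof -
  have "finsum M (\<lambda>x. 1 \<odot> x) {x} = x"
    using finsum_insert[of "{}" x "\<lambda>x. 1 \<odot> x"] assms by (simp add: one_sm)
  moreover have "finsum M (\<lambda>x. 1 \<odot> x) {x} \<in> lin_span M A"
    unfolding lin_span_def using assms(1)
    by (intro CollectI exI[of _ "\<lambda>x. 1"] exI[of _ "{x}"] conjI) auto
  ultimately show ?thesis by (simp only:)
qed

lemma lin_span_minimal:
  assumes "csubspace W" "A \<subseteq> W" shows "lin_span M A \<subseteq> W"
proof
  fix x assume "x \<in> lin_span M A"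
  then obtain k F where x: "x = finsum M (\<lambda>x. k x \<odot> x) F" "F \<subseteq> A" unfolding lin_span_def by blast
  show "x \<in> W" unfolding x(1)
    by (rule finsum_in_csubspace[OF assms(1)]) (use x(2) assms in \<open>auto simp: csubspace_def\<close>)
qed

lemma functional_finsum:
  fixes \<phi> :: "'v \<Rightarrow> complex"
  assumes add: "\<And>x y. x \<in> carrier M \<Longrightarrow> y \<in> carrier M \<Longrightarrow> \<phi> (x \<oplus> y) = \<phi> x + \<phi> y"
    and sm: "\<And>k x. x \<in> carrier M \<Longrightarrow> \<phi> (k \<odot> x) = k * \<phi> x"
    and F: "finite F" "g \<in> F \<rightarrow> carrier M"
  shows "\<phi> (finsum M g F) = (\<Sum>i\<in>F. \<phi> (g i))"
  using F
proof (induction F)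
  case empty
  show ?case using sm[of \<zero> 0] by simp
next
  case (insert i F)
  then have "g \<in> F \<rightarrow> carrier M" "g i \<in> carrier M" by auto
  with insert show ?case by (simp add: finsum_insert add)
qed

lemma functional_vanishes:
  fixes \<phi> :: "'v \<Rightarrow> complex"
  assumes add: "\<And>x y. x \<in> carrier M \<Longrightarrow> y \<in> carrier M \<Longrightarrow> \<phi> (x \<oplus> y) = \<phi> x + \<phi> y"
    and sm: "\<And>k x. x \<in> carrier M \<Longrightarrow> \<phi> (k \<odot> x) = k * \<phi> x"
    and A: "A \<subseteq> carrier M" "\<And>x. x \<in> A \<Longrightarrow> \<phi> x = 0" and x: "x \<in> lin_span M A"
  shows "\<phi> x = 0"
proof -
  have "csubspace {x \<in> carrier M. \<phi> x = 0}"
    unfolding csubspace_def using add sm sm[of \<zero> 0] by auto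
  then have "lin_span M A \<subseteq> {x \<in> carrier M. \<phi> x = 0}" by (rule lin_span_minimal) (use A in auto)
  then show ?thesis using x by blast
qed

end

lemma vspace_simps [simp]:
  "carrier (vspace C z pl sc) = C" "zero (vspace C z pl sc) = z"
  "add (vspace C z pl sc) = pl" "smult (vspace C z pl sc) = sc"
  by (simp_all add: vspace_def)

text \<open>Negatives are supplied by the scalar \<open>-1\<close>.\<close>
lemma cspace_vspace:
  assumes "\<And>x y. x \<in> C \<Longrightarrow> y \<in> C \<Longrightarrow> pl x y \<in> C" "z \<in> C" "\<And>k x. x \<in> C \<Longrightarrow> sc k x \<in> C"
    and "\<And>x y w. x \<in> C \<Longrightarrow> y \<in> C \<Longrightarrow> w \<in> C \<Longrightarrow> pl (pl x y) w = pl x (pl y w)"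
    and "\<And>x y. x \<in> C \<Longrightarrow> y \<in> C \<Longrightarrow> pl x y = pl y x" "\<And>x. x \<in> C \<Longrightarrow> pl z x = x"
    and "\<And>x. x \<in> C \<Longrightarrow> sc 0 x = z"
    and "\<And>k x y. x \<in> C \<Longrightarrow> y \<in> C \<Longrightarrow> sc k (pl x y) = pl (sc k x) (sc k y)"
    and radd: "\<And>j k x. x \<in> C \<Longrightarrow> sc (j + k) x = pl (sc j x) (sc k x)"
    and "\<And>j k x. x \<in> C \<Longrightarrow> sc j (sc k x) = sc (j * k) x"
    and one: "\<And>x. x \<in> C \<Longrightarrow> sc 1 x = x"
  shows "cspace (vspace C z pl sc)"
proof -
  have inv: "\<exists>y\<in>C. pl y x = z" if "x \<in> C" for x
  proof
    show "pl (sc (-1) x) x = z" using radd[OF that, of "-1" 1] one[OF that] assms(7)[OF that] by simp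
  qed (use that assms(3) in auto)
  have "abelian_group (vspace C z pl sc)"
    by (rule abelian_groupI) (use assms inv in auto)
  then show ?thesis
    by (intro cspace.intro cspace_axioms.intro) (use assms in auto)
qed

locale cquotient = cspace M for M :: "(complex, 'v) module" (structure) +
  fixes N :: "'v set"
  assumes N: "csubspace N"
begin

abbreviation Q :: "(complex, 'v set) module" where "Q \<equiv> quotient_space M N"
abbreviation cl :: "'v \<Rightarrow> 'v set" where "cl x \<equiv> N +> x"

lemma neg_sm: "x \<in> carrier M \<Longrightarrow> \<ominus> x = (-1) \<odot> x"
proof -
  assume x: "x \<in> carrier M"
  have "(-1) \<odot> x \<oplus> x = \<zero>" using add_sm[OF x, of "-1" 1] one_sm[OF x] x by simp
  then show ?thesis using x by (simp add: minus_equality)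
qed

lemma N_subset: "x \<in> N \<Longrightarrow> x \<in> carrier M" and N_zero: "\<zero> \<in> N"
  and N_add: "x \<in> N \<Longrightarrow> y \<in> N \<Longrightarrow> x \<oplus> y \<in> N" and N_sm: "x \<in> N \<Longrightarrow> k \<odot> x \<in> N"
  using N unfolding csubspace_def by auto

lemma abelian_subgroup_N: "abelian_subgroup N M"
proof (rule abelian_subgroupI3)
  show "additive_subgroup N M"
    unfolding additive_subgroup_def
    by (rule subgroup.intro)
      (use N_add N_zero N_sm N_subset neg_sm in \<open>auto simp: a_inv_def[symmetric]\<close>)
  show "abelian_group M" by (rule abelian_group_axioms)
qed

sublocale N: abelian_subgroup N M by (rule abelian_subgroup_N)

lemma cl_eq_iff:
  assumes "x \<in> carrier M" "y \<in> carrier M"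
  shows "cl x = cl y \<longleftrightarrow> x \<ominus> y \<in> N"
proof -
  have mem: "x \<in> cl y \<longleftrightarrow> x \<ominus> y \<in> N"
    unfolding minus_eq by (rule N.a_rcos_module[OF assms(2,1)])
  show ?thesis
  proof
    assume "cl x = cl y"
    then show "x \<ominus> y \<in> N" using N.a_rcos_self[OF assms(1)] mem by (simp only:)
  next
    assume "x \<ominus> y \<in> N"
    then have "x \<in> cl y" unfolding mem .
    then show "cl x = cl y" using N.a_repr_independence'[OF _ assms(2)] by simp
  qed
qed

lemma cl_N:
  assumes "x \<in> carrier M" shows "cl x = N \<longleftrightarrow> x \<in> N"
proof
  assume "cl x = N"
  then show "x \<in> N" using N.a_rcos_self[OF assms] by (simp only:)
next
  assume "x \<in> N"
  then show "cl x = N" by (rule N.a_rcos_const)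
qed

lemma cl_zero: "cl \<zero> = N"
  using cl_N[OF zero_closed] N_zero by simp

lemma Q_carrier: "carrier Q = cl ` carrier M"
  unfolding quotient_space_def A_RCOSETS_def RCOSETS_def a_r_coset_def by auto

lemma Q_zero: "\<zero>\<^bsub>Q\<^esub> = cl \<zero>"
  unfolding cl_zero by (simp add: quotient_space_def)

lemma Q_add: "x \<in> carrier M \<Longrightarrow> y \<in> carrier M \<Longrightarrow> cl x \<oplus>\<^bsub>Q\<^esub> cl y = cl (x \<oplus> y)"
  using N.a_rcos_sum[of x y] by (simp add: quotient_space_def)

lemma cl_memD:
  assumes "y \<in> cl x" "x \<in> carrier M"
  obtains n where "n \<in> N" "y = n \<oplus> x"
  using assms unfolding a_r_coset_def' by auto

lemma cl_add_N: "n \<in> N \<Longrightarrow> x \<in> carrier M \<Longrightarrow> cl (n \<oplus> x) = cl x"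
  by (subst cl_eq_iff) (auto simp: N_subset minus_eq a_assoc r_neg)

text \<open>\<open>quotient_map\<close> is a union over all representatives; since \<open>T\<close>
  preserves \<open>N\<close>, each of them yields the same coset.\<close>

lemma quotient_map_cl:
  assumes x: "x \<in> carrier M" and T: "\<And>y. y \<in> carrier M \<Longrightarrow> T y \<in> carrier M"
    "\<And>y z. y \<in> carrier M \<Longrightarrow> z \<in> carrier M \<Longrightarrow> T (y \<oplus> z) = T y \<oplus> T z" "\<And>n. n \<in> N \<Longrightarrow> T n \<in> N"
  shows "quotient_map M N T (cl x) = cl (T x)"
proof -
  have eq: "cl (T y) = cl (T x)" if y: "y \<in> cl x" for y
  proof -
    obtain n where n: "n \<in> N" "y = n \<oplus> x" using cl_memD[OF y x] by blast
    show ?thesis unfolding n(2) T(2)[OF N_subset[OF n(1)] x] by (rule cl_add_N[OF T(3)[OF n(1)] T(1)[OF x]])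
  qed
  have "(\<Union>y\<in>cl x. cl (T y)) = (\<Union>y\<in>cl x. cl (T x))"
    by (rule SUP_cong[OF refl]) (rule eq)
  also have "\<dots> = cl (T x)" using N.a_rcos_self[OF x] by blast
  finally show ?thesis unfolding quotient_map_def .
qed

lemma Q_sm: "x \<in> carrier M \<Longrightarrow> k \<odot>\<^bsub>Q\<^esub> cl x = cl (k \<odot> x)"
  using quotient_map_cl[of x "\<lambda>x. k \<odot> x"] N_sm
  by (simp add: quotient_space_def quotient_map_def sm_add)

lemma cspace_Q: "cspace Q"
proof -
  have Q: "Q = vspace (carrier Q) \<zero>\<^bsub>Q\<^esub> (\<oplus>\<^bsub>Q\<^esub>) (\<odot>\<^bsub>Q\<^esub>)"
    by (simp add: quotient_space_def)
  have "cspace (vspace (carrier Q) \<zero>\<^bsub>Q\<^esub> (\<oplus>\<^bsub>Q\<^esub>) (\<odot>\<^bsub>Q\<^esub>))"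
  proof (rule cspace_vspace)
    show "A \<oplus>\<^bsub>Q\<^esub> B = B \<oplus>\<^bsub>Q\<^esub> A" if AB: "A \<in> carrier Q" "B \<in> carrier Q" for A B
    proof -
      obtain x y where "A = cl x" "B = cl y" "x \<in> carrier M" "y \<in> carrier M"
        using AB unfolding Q_carrier by blast
      then show ?thesis using a_comm[of x y] by (simp only: Q_add)
    qed
  qed (auto simp: Q_carrier Q_zero Q_add Q_sm a_assoc sm_add add_sm sm_sm one_sm)
  then show ?thesis unfolding Q[symmetric] .
qed

lemma Q_finsum:
  assumes "finite F" "g \<in> F \<rightarrow> carrier M"
  shows "finsum Q (\<lambda>i. cl (g i)) F = cl (finsum M g F)"
  using assms
proof (induction F)
  case empty
  interpret Q: cspace Q by (rule cspace_Q)
  show ?case by (simp add: Q_zero)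
next
  case (insert i F)
  interpret Q: cspace Q by (rule cspace_Q)
  have "g \<in> F \<rightarrow> carrier M" "g i \<in> carrier M" using insert by auto
  moreover from this have "(\<lambda>i. cl (g i)) \<in> F \<rightarrow> carrier Q" "cl (g i) \<in> carrier Q" by (auto simp: Q_carrier)
  ultimately show ?case using insert by (simp add: finsum_insert Q.finsum_insert Q_add finsum_closed)
qed

end

section \<open>The space \<open>F(S)\<close>\<close>

locale mode_space = S: cspace S for S :: "(complex, 's) module"
begin

abbreviation FS :: "(complex, mode_word \<Rightarrow> 's) module" where "FS \<equiv> F_space S"

lemma FS_simps:
  "carrier FS = {u. (\<forall>w. u w \<in> carrier S) \<and> finite {w. u w \<noteq> \<zero>\<^bsub>S\<^esub>} \<and> {w. u w \<noteq> \<zero>\<^bsub>S\<^esub>} \<subseteq> mode_words}"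
  "\<zero>\<^bsub>FS\<^esub> = (\<lambda>w. \<zero>\<^bsub>S\<^esub>)" "u \<oplus>\<^bsub>FS\<^esub> v = (\<lambda>w. u w \<oplus>\<^bsub>S\<^esub> v w)" "k \<odot>\<^bsub>FS\<^esub> u = (\<lambda>w. k \<odot>\<^bsub>S\<^esub> u w)"
  by (simp_all add: F_space_def)

lemma cspace_FS: "cspace FS"
  unfolding F_space_def
proof (rule cspace_vspace)
  let ?C = "{u. (\<forall>w. u w \<in> carrier S) \<and> finite {w. u w \<noteq> \<zero>\<^bsub>S\<^esub>} \<and> {w. u w \<noteq> \<zero>\<^bsub>S\<^esub>} \<subseteq> mode_words}"
  fix x y assume x: "x \<in> ?C" and y: "y \<in> ?C"
  have sub: "{w. x w \<oplus>\<^bsub>S\<^esub> y w \<noteq> \<zero>\<^bsub>S\<^esub>} \<subseteq> {w. x w \<noteq> \<zero>\<^bsub>S\<^esub>} \<union> {w. y w \<noteq> \<zero>\<^bsub>S\<^esub>}"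
  proof
    fix w assume w: "w \<in> {w. x w \<oplus>\<^bsub>S\<^esub> y w \<noteq> \<zero>\<^bsub>S\<^esub>}"
    show "w \<in> {w. x w \<noteq> \<zero>\<^bsub>S\<^esub>} \<union> {w. y w \<noteq> \<zero>\<^bsub>S\<^esub>}"
    proof (rule ccontr)
      assume "w \<notin> {w. x w \<noteq> \<zero>\<^bsub>S\<^esub>} \<union> {w. y w \<noteq> \<zero>\<^bsub>S\<^esub>}"
      then have "x w = \<zero>\<^bsub>S\<^esub>" "y w = \<zero>\<^bsub>S\<^esub>" by auto
      then show False using w by simp
    qed
  qed
  show "(\<lambda>w. x w \<oplus>\<^bsub>S\<^esub> y w) \<in> ?C"
    using x y finite_subset[OF sub] order.trans[OF sub] by auto
next
  let ?C = "{u. (\<forall>w. u w \<in> carrier S) \<and> finite {w. u w \<noteq> \<zero>\<^bsub>S\<^esub>} \<and> {w. u w \<noteq> \<zero>\<^bsub>S\<^esub>} \<subseteq> mode_words}"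
  fix k :: complex and x assume x: "x \<in> ?C"
  have sub: "{w. k \<odot>\<^bsub>S\<^esub> x w \<noteq> \<zero>\<^bsub>S\<^esub>} \<subseteq> {w. x w \<noteq> \<zero>\<^bsub>S\<^esub>}" using S.sm_zero by auto
  show "(\<lambda>w. k \<odot>\<^bsub>S\<^esub> x w) \<in> ?C"
    using x finite_subset[OF sub] order.trans[OF sub] by auto
qed (auto simp: S.a_assoc S.sm_add S.add_sm S.sm_sm S.one_sm intro!: ext S.a_comm)

sublocale F: cspace FS by (rule cspace_FS)

lemma FS_finsum_apply:
  assumes "finite A" "g \<in> A \<rightarrow> carrier FS"
  shows "finsum FS g A w = finsum S (\<lambda>i. g i w) A"
  using assms
proof (induction A)
  case empty
  show ?case by (simp add: FS_simps(2))
next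
  case (insert i A)
  have g: "g \<in> A \<rightarrow> carrier FS" "g i \<in> carrier FS" using insert by auto
  then have "(\<lambda>i. g i w) \<in> A \<rightarrow> carrier S" "g i w \<in> carrier S" by (auto simp: FS_simps(1))
  then show ?case using insert g by (simp add: F.finsum_insert S.finsum_insert FS_simps(3))
qed

text \<open>The vector \<open>m \<otimes> s\<close>.\<close>

definition E :: "mode_word \<Rightarrow> 's \<Rightarrow> mode_word \<Rightarrow> 's" where
  "E m s w = (if w = m then s else \<zero>\<^bsub>S\<^esub>)"

lemma E_carrier: "m \<in> mode_words \<Longrightarrow> s \<in> carrier S \<Longrightarrow> E m s \<in> carrier FS"
proof -
  assume "m \<in> mode_words" "s \<in> carrier S"
  moreover have "{w. E m s w \<noteq> \<zero>\<^bsub>S\<^esub>} \<subseteq> {m}" by (auto simp: E_def)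
  ultimately show ?thesis using finite_subset[of _ "{m}"] by (auto simp: FS_simps(1) E_def)
qed

lemma E_sm: "s \<in> carrier S \<Longrightarrow> E m (k \<odot>\<^bsub>S\<^esub> s) = k \<odot>\<^bsub>FS\<^esub> E m s"
  by (rule ext) (simp add: E_def FS_simps(4))

lemma F_vec_E: "F_vec S s = E [] s"
  by (rule ext) (simp add: F_vec_def E_def)

lemma neg_mode_E: "neg_mode S i m (E w s) = E ((i, m) # w) s"
  by (rule ext) (auto simp: neg_mode_def E_def split: list.split)

lemma neg_mode_zero: "neg_mode S i m (\<lambda>w. \<zero>\<^bsub>S\<^esub>) = (\<lambda>w. \<zero>\<^bsub>S\<^esub>)"
  by (rule ext) (auto simp: neg_mode_def split: list.split)

lemma finsum_sm_zero: "finsum S (\<lambda>j. k j \<odot>\<^bsub>S\<^esub> \<zero>\<^bsub>S\<^esub>) A = \<zero>\<^bsub>S\<^esub>"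
  by (simp add: S.finsum_zero)

lemma pos_mode_zero: "pos_mode S B l i m w (\<lambda>w. \<zero>\<^bsub>S\<^esub>) = \<zero>\<^bsub>S\<^esub>"
  by (induction w) (simp_all add: finsum_sm_zero)

lemma pos_mode_E: "pos_mode S B l i m w (E [] s) = \<zero>\<^bsub>S\<^esub>"
proof (cases w)
  case Nil
  then show ?thesis by (simp add: E_def finsum_sm_zero)
next
  case (Cons x w)
  have "(\<lambda>v. E [] s (x # v)) = (\<lambda>w. \<zero>\<^bsub>S\<^esub>)" by (rule ext) (simp add: E_def)
  then show ?thesis unfolding Cons by (simp add: E_def finsum_sm_zero pos_mode_zero)
qed

context
  fixes act :: "sign \<Rightarrow> 's \<Rightarrow> 's" and B :: "sign \<Rightarrow> sign \<Rightarrow> complex" and l :: complex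
  assumes act_zero: "\<And>i. act i \<zero>\<^bsub>S\<^esub> = \<zero>\<^bsub>S\<^esub>"
begin

lemma mode_zero: "mode S act B l x (\<lambda>w. \<zero>\<^bsub>S\<^esub>) = (\<lambda>w. \<zero>\<^bsub>S\<^esub>)"
  by (auto simp: mode_def Let_def neg_mode_zero zero_mode_def act_zero pos_mode_zero)

lemma apply_modes_append: "apply_modes S act B l (xs @ ys) u = apply_modes S act B l xs (apply_modes S act B l ys u)"
  by (simp add: apply_modes_def)

lemma apply_modes_zero: "apply_modes S act B l xs (\<lambda>w. \<zero>\<^bsub>S\<^esub>) = (\<lambda>w. \<zero>\<^bsub>S\<^esub>)"
  by (induction xs) (simp_all add: apply_modes_def mode_zero)

lemma apply_zero_modes:
  "(\<forall>x\<in>set xs. snd x = 0) \<Longrightarrow> apply_modes S act B l xs (E [] s) = E [] (foldr act (map fst xs) s)"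
proof (induction xs)
  case (Cons x xs)
  have "zero_mode act i (E [] s) = E [] (act i s)" for i s
    by (rule ext) (simp add: zero_mode_def E_def act_zero)
  with Cons show ?case by (simp add: apply_modes_def mode_def)
qed (simp add: apply_modes_def)

lemma apply_pos_modes:
  assumes "\<forall>x\<in>set xs. snd x > 0" "xs \<noteq> []"
  shows "apply_modes S act B l xs (E [] s) = (\<lambda>w. \<zero>\<^bsub>S\<^esub>)"
proof -
  obtain ys y where xs: "xs = ys @ [y]" using assms(2) by (meson rev_exhaust)
  have "apply_modes S act B l [y] (E [] s) = (\<lambda>w. \<zero>\<^bsub>S\<^esub>)"
    using assms(1) unfolding xs by (simp add: apply_modes_def mode_def Let_def pos_mode_E)
  then show ?thesis unfolding xs apply_modes_append by (simp only: apply_modes_zero)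
qed

lemma apply_neg_modes:
  "(\<forall>x\<in>set xs. snd x < 0) \<Longrightarrow> apply_modes S act B l xs (E m s) = E (map (\<lambda>x. (fst x, nat (- snd x))) xs @ m) s"
  by (induction xs) (simp_all add: apply_modes_def mode_def Let_def neg_mode_E)

lemma apply_normal_order:
  assumes "filter (\<lambda>x. snd x > 0) xs = []"
  shows "apply_modes S act B l (normal_order xs) (E [] s)
    = E (map (\<lambda>x. (fst x, nat (- snd x))) (filter (\<lambda>x. snd x < 0) xs))
        (foldr act (map fst (filter (\<lambda>x. snd x = 0) xs)) s)"
  unfolding normal_order_def assms apply_modes_append
  by (simp add: apply_zero_modes apply_neg_modes apply_modes_def[of _ _ _ _ "[]"])

text \<open>The zero modes act before all others and keep the vector in
  \<open>1 \<otimes> S\<close>, which the first positive mode kills.\<close>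

lemma apply_normal_order_pos:
  assumes "filter (\<lambda>x. snd x > 0) xs \<noteq> []"
  shows "apply_modes S act B l (normal_order xs) (E [] s) = (\<lambda>w. \<zero>\<^bsub>S\<^esub>)"
  unfolding normal_order_def apply_modes_append
  using apply_pos_modes[OF _ assms] by (simp add: apply_zero_modes apply_modes_zero)

end

end

section \<open>Words without balanced suffix\<close>

text \<open>The position \<open>q = 0\<close> is included: a nonempty reduced word is itself
  unbalanced.\<close>

definition reduced :: "sign list \<Rightarrow> bool" where
  "reduced w \<longleftrightarrow> (\<forall>q<length w. \<not> balanced (drop q w))"

lemma balanced_append: "balanced v \<Longrightarrow> balanced (w @ v) \<longleftrightarrow> balanced w"
  by (simp add: balanced_iff)

text \<open>Balanced suffixes are split off repeatedly; together they are again balanced.\<close>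

lemma reduced_decomposition: "\<exists>v b. w = v @ b \<and> reduced v \<and> balanced b"
proof (induction "length w" arbitrary: w rule: less_induct)
  case less
  show ?case
  proof (cases "reduced w")
    case True
    then show ?thesis by (intro exI[of _ w] exI[of _ "[]"]) (simp add: balanced_def)
  next
    case False
    then obtain q where q: "q < length w" "balanced (drop q w)" unfolding reduced_def by blast
    have "length (take q w) < length w" using q by simp
    from less[OF this] obtain v b where vb: "take q w = v @ b" "reduced v" "balanced b" by (elim exE conjE)
    have "w = v @ (b @ drop q w)" using append_take_drop_id[of q w] vb(1) by simp
    moreover have "balanced (b @ drop q w)" using vb(3) q(2) by (simp add: balanced_append)
    ultimately show ?thesis using vb(2) by (intro exI[of _ v] exI[of _ "b @ drop q w"] conjI)
  qed
qed

lemma reduced_suffix: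
  assumes "reduced (v @ b)" "balanced b" shows "b = []"
proof (rule ccontr)
  assume "b \<noteq> []"
  then have "\<not> balanced (drop (length v) (v @ b))"
    using assms(1)[unfolded reduced_def, rule_format, of "length v"] by simp
  then show False using assms(2) by simp
qed

text \<open>The case with content is \<open>v\<close> longer than \<open>w\<close>. Then
  \<open>v\<close> would end inside \<open>b\<close>, at \<open>w @ x\<close>; as the rest of
  \<open>b\<close> is balanced, so is \<open>x\<close>, a nonempty balanced suffix of the reduced
  \<open>v\<close>.\<close>

lemma reduced_prefix_append:
  assumes v: "reduced v" and b: "balanced b"
  shows "(take (length v) (w @ b) = v \<and> balanced (drop (length v) (w @ b)))
    \<longleftrightarrow> (take (length v) w = v \<and> balanced (drop (length v) w))"
proof (cases "length v \<le> length w")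
  case True
  then show ?thesis using b by (simp add: balanced_append)
next
  case False
  define x y where "x = take (length v - length w) b" and "y = drop (length v - length w) b"
  have xy: "b = x @ y" unfolding x_def y_def by simp
  have "take (length v) w \<noteq> v"
  proof
    assume "take (length v) w = v"
    then have "length (take (length v) w) = length v" by (rule arg_cong)
    then show False using False by simp
  qed
  moreover have "\<not> (w @ x = v \<and> balanced y)"
  proof
    assume a: "w @ x = v \<and> balanced y"
    then have "balanced x" using b xy balanced_append[of y x] by simp
    then have "x = []" using reduced_suffix[of w x] v a by simp
    then show False using a False by auto
  qed
  moreover have "take (length v) (w @ b) = w @ x" "drop (length v) (w @ b) = y"
    using False unfolding x_def y_def by simp_all
  ultimately show ?thesis by simp
qed

section \<open>The tensor product over the parallel sections\<close>

text \<open>A splitting position of \<open>v\<close> is the same as a pair of words with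
  concatenation \<open>v\<close>; sums over pairs are easier to exchange.\<close>

lemma tensor_mult_eq:
  assumes "finite {w. a w \<noteq> 0}" "finite {w. b w \<noteq> 0}"
  shows "tensor_mult a b v = (\<Sum>x | a x \<noteq> 0. \<Sum>y | b y \<noteq> 0. if x @ y = v then a x * b y else 0)"
proof -
  let ?A = "{w. a w \<noteq> 0}" and ?B = "{w. b w \<noteq> 0}"
  have "tensor_mult a b v = (\<Sum>j \<in> {j. j \<le> length v \<and> a (take j v) \<noteq> 0 \<and> b (drop j v) \<noteq> 0}. a (take j v) * b (drop j v))"
    unfolding tensor_mult_def by (rule sum.mono_neutral_right) auto
  also have "\<dots> = (\<Sum>(x, y) \<in> {(x, y) \<in> ?A \<times> ?B. x @ y = v}. a x * b y)"
    by (rule sum.reindex_bij_witness[where j = "\<lambda>n. (take n v, drop n v)" and i = "\<lambda>(x, y). length x"]) auto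
  also have "\<dots> = (\<Sum>(x, y) \<in> ?A \<times> ?B. if x @ y = v then a x * b y else 0)"
    by (rule sum.mono_neutral_cong_left) (use assms in \<open>auto split: if_splits\<close>)
  finally show ?thesis by (simp add: sum.cartesian_product)
qed

lemma tensor_mult_closed: "a \<in> tensors \<Longrightarrow> b \<in> tensors \<Longrightarrow> tensor_mult a b \<in> tensors"
proof -
  assume a: "a \<in> tensors" and b: "b \<in> tensors"
  let ?A = "{w. a w \<noteq> 0}" and ?B = "{w. b w \<noteq> 0}"
  have "{v. tensor_mult a b v \<noteq> 0} \<subseteq> (\<lambda>(x, y). x @ y) ` (?A \<times> ?B)"
  proof
    fix v assume "v \<in> {v. tensor_mult a b v \<noteq> 0}"
    then have "(\<Sum>x\<in>?A. \<Sum>y\<in>?B. if x @ y = v then a x * b y else 0) \<noteq> 0"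
      using a b unfolding tensors_def by (simp add: tensor_mult_eq)
    then obtain x where x: "x \<in> ?A" "(\<Sum>y\<in>?B. if x @ y = v then a x * b y else 0) \<noteq> 0"
      by (rule sum.not_neutral_contains_not_neutral)
    from x(2) obtain y where y: "y \<in> ?B" "(if x @ y = v then a x * b y else 0) \<noteq> 0"
      by (rule sum.not_neutral_contains_not_neutral)
    then have "x @ y = v" by (simp split: if_splits)
    then show "v \<in> (\<lambda>(x, y). x @ y) ` (?A \<times> ?B)" using x(1) y(1) by force
  qed
  then show ?thesis using a b finite_subset unfolding tensors_def by blast
qed

lemma single_support: "{v. single w v \<noteq> 0} = {w}" by auto

lemma single_tensor: "single w \<in> tensors"
  unfolding tensors_def mem_Collect_eq single_support by simp

lemma tensor_mult_single: "tensor_mult (single w) (single b) = single (w @ b)"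
proof
  fix v
  show "tensor_mult (single w) (single b) v = single (w @ b) v"
    by (subst tensor_mult_eq) (auto simp: single_support)
qed

text \<open>Left multiplication by \<open>h_i\<close> in \<open>T(E_p)\<close>, the counterpart of
  \<open>left_mult\<close>.\<close>

definition shift :: "sign \<Rightarrow> tensor \<Rightarrow> tensor" where
  "shift i a w = (case w of [] \<Rightarrow> 0 | j # v \<Rightarrow> if j = i then a v else 0)"

lemma shift_tensors: "a \<in> tensors \<Longrightarrow> shift i a \<in> tensors"
proof -
  assume "a \<in> tensors"
  moreover have "{w. shift i a w \<noteq> 0} \<subseteq> (#) i ` {w. a w \<noteq> 0}"
  proof
    fix w assume "w \<in> {w. shift i a w \<noteq> 0}"
    then show "w \<in> (#) i ` {w. a w \<noteq> 0}" by (cases w) (auto simp: shift_def split: if_splits)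
  qed
  ultimately show ?thesis unfolding tensors_def using finite_subset by blast
qed

lemma tensor_mult_shift: "tensor_mult (shift i a) b = shift i (tensor_mult a b)"
proof
  fix w
  show "tensor_mult (shift i a) b w = shift i (tensor_mult a b) w"
  proof (cases w)
    case (Cons j v)
    then show ?thesis
      by (simp add: tensor_mult_def shift_def sum.atMost_Suc_shift del: sum.atMost_Suc)
  qed (simp add: tensor_mult_def shift_def)
qed

context balanced_action
begin

abbreviation TF where "TF \<equiv> tensor_functions R U"
abbreviation Bal where "Bal \<equiv> balancing R c p h U"
abbreviation SS where "SS \<equiv> S_space R c p h U"

lemma V_open: "d \<in> atlas R \<Longrightarrow> open (snd d ` (fst d \<inter> U))"
  using atlas_open_image[of "atlas R" d U] riem U unfolding riemannian_surface_def by blast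

lemma smooth_funD:
  "g \<in> smooth_functions R U \<Longrightarrow> d \<in> atlas R \<Longrightarrow> smooth_on (snd d ` (fst d \<inter> U)) (\<lambda>x. g (chart_inv d x))"
  unfolding smooth_functions_def comp_def by blast

lemma smooth_funI:
  "(\<And>q. q \<notin> U \<Longrightarrow> g q = 0) \<Longrightarrow>
    (\<And>d. d \<in> atlas R \<Longrightarrow> smooth_on (snd d ` (fst d \<inter> U)) (\<lambda>x. g (chart_inv d x))) \<Longrightarrow>
    g \<in> smooth_functions R U"
  unfolding smooth_functions_def comp_def by blast

lemma smooth_fun_outside: "g \<in> smooth_functions R U \<Longrightarrow> q \<notin> U \<Longrightarrow> g q = 0"
  unfolding smooth_functions_def by blast

lemma smooth_fun_add:
  "g \<in> smooth_functions R U \<Longrightarrow> g' \<in> smooth_functions R U \<Longrightarrow> (\<lambda>q. g q + g' q) \<in> smooth_functions R U"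
  by (rule smooth_funI) (simp_all add: smooth_fun_outside smooth_on_add V_open smooth_funD)

lemma smooth_fun_cmult: "g \<in> smooth_functions R U \<Longrightarrow> (\<lambda>q. k * g q) \<in> smooth_functions R U"
  by (rule smooth_funI) (simp_all add: smooth_fun_outside smooth_on_cnst_mult V_open smooth_funD)

lemma smooth_fun_zero: "(\<lambda>q. 0) \<in> smooth_functions R U"
  by (rule smooth_funI) simp_all

lemma TF_simps:
  "carrier TF = {u. finite {w. u w \<noteq> (\<lambda>q. 0)} \<and> (\<forall>w. u w \<in> smooth_functions R U)}"
  "\<zero>\<^bsub>TF\<^esub> = (\<lambda>w q. 0)" "u \<oplus>\<^bsub>TF\<^esub> v = (\<lambda>w q. u w q + v w q)" "k \<odot>\<^bsub>TF\<^esub> u = (\<lambda>w q. k * u w q)"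
  by (simp_all add: tensor_functions_def)

lemma cspace_TF: "cspace TF"
  unfolding tensor_functions_def
proof (rule cspace_vspace)
  let ?C = "{u :: sign list \<Rightarrow> 'a \<Rightarrow> complex. finite {w. u w \<noteq> (\<lambda>q. 0)} \<and> (\<forall>w. u w \<in> smooth_functions R U)}"
  fix x y assume x: "x \<in> ?C" and y: "y \<in> ?C"
  have "{w. (\<lambda>q. x w q + y w q) \<noteq> (\<lambda>q. 0)} \<subseteq> {w. x w \<noteq> (\<lambda>q. 0)} \<union> {w. y w \<noteq> (\<lambda>q. 0)}"
    by (auto simp: fun_eq_iff)
  moreover have "finite ({w. x w \<noteq> (\<lambda>q. 0)} \<union> {w. y w \<noteq> (\<lambda>q. 0)})" using x y by simp
  ultimately have "finite {w. (\<lambda>q. x w q + y w q) \<noteq> (\<lambda>q. 0)}" by (rule finite_subset)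
  then show "(\<lambda>w q. x w q + y w q) \<in> ?C" using x y smooth_fun_add by simp
next
  let ?C = "{u :: sign list \<Rightarrow> 'a \<Rightarrow> complex. finite {w. u w \<noteq> (\<lambda>q. 0)} \<and> (\<forall>w. u w \<in> smooth_functions R U)}"
  fix k :: complex and x assume x: "x \<in> ?C"
  have "{w. (\<lambda>q. k * x w q) \<noteq> (\<lambda>q. 0)} \<subseteq> {w. x w \<noteq> (\<lambda>q. 0)}" by (auto simp: fun_eq_iff)
  moreover have "finite {w. x w \<noteq> (\<lambda>q. 0)}" using x by simp
  ultimately have "finite {w. (\<lambda>q. k * x w q) \<noteq> (\<lambda>q. 0)}" by (rule finite_subset)
  then show "(\<lambda>w q. k * x w q) \<in> ?C" using x smooth_fun_cmult by simp
qed (auto simp: fun_eq_iff algebra_simps smooth_fun_zero)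

sublocale T: cspace TF by (rule cspace_TF)

definition gen :: "tensor \<Rightarrow> tensor \<Rightarrow> 'a tensor_field \<Rightarrow> ('a \<Rightarrow> complex) \<Rightarrow> sign list \<Rightarrow> 'a \<Rightarrow> complex" where
  "gen a b X g w q = pure_tensor (tensor_mult a b) g w q - pure_tensor a (par_act R U X g) w q"

definition Gen :: "(sign list \<Rightarrow> 'a \<Rightarrow> complex) set" where
  "Gen = {gen a b X g | a b X g. a \<in> tensors \<and> X \<in> parallel_sections R \<and> value_at c p h X b \<and>
                  g \<in> smooth_functions R U}"

lemma Bal_eq: "Bal = lin_span TF Gen"
  unfolding balancing_def Gen_def gen_def[abs_def] ..

lemma pure_carrier:
  assumes "a \<in> tensors" "g \<in> smooth_functions R U" shows "pure_tensor a g \<in> carrier TF"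
proof -
  have "{w. pure_tensor a g w \<noteq> (\<lambda>q. 0)} \<subseteq> {w. a w \<noteq> 0}" by (auto simp: pure_tensor_def fun_eq_iff)
  then have "finite {w. pure_tensor a g w \<noteq> (\<lambda>q. 0)}" using assms(1) finite_subset unfolding tensors_def by blast
  then show ?thesis using smooth_fun_cmult[OF assms(2)] by (simp add: TF_simps pure_tensor_def[abs_def])
qed

lemma gen_eq: "gen a b X g = pure_tensor (tensor_mult a b) g \<oplus>\<^bsub>TF\<^esub> ((-1) \<odot>\<^bsub>TF\<^esub> pure_tensor a (par_act R U X g))"
  by (intro ext) (simp add: gen_def TF_simps)

lemma gen_carrier:
  assumes "a \<in> tensors" "X \<in> parallel_sections R" "value_at c p h X b" "g \<in> smooth_functions R U"
  shows "gen a b X g \<in> carrier TF"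
proof -
  have "b \<in> tensors" using assms(3) unfolding value_at_def by blast
  then show ?thesis unfolding gen_eq
    by (intro T.a_closed T.sm_closed pure_carrier tensor_mult_closed par_smooth[OF assms(2-4)] assms)
qed

lemma Gen_carrier: "Gen \<subseteq> carrier TF"
  unfolding Gen_def using gen_carrier by blast

sublocale Q: cquotient TF Bal
  by unfold_locales (unfold Bal_eq, rule T.csubspace_lin_span[OF Gen_carrier])

lemma SS_Q: "SS = Q.Q" by (simp add: S_space_def)

lemma cspace_SS: "cspace SS" unfolding SS_Q by (rule Q.cspace_Q)

sublocale F: mode_space SS
  by (rule mode_space.intro) (rule cspace_SS)

lemma left_mult_pure: "left_mult i (pure_tensor a g) = pure_tensor (shift i a) g"
  by (intro ext) (auto simp: left_mult_def pure_tensor_def shift_def split: list.split)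

lemma left_mult_linear:
  "left_mult i (u \<oplus>\<^bsub>TF\<^esub> v) = left_mult i u \<oplus>\<^bsub>TF\<^esub> left_mult i v"
  "left_mult i (k \<odot>\<^bsub>TF\<^esub> u) = k \<odot>\<^bsub>TF\<^esub> left_mult i u"
  by (auto intro!: ext simp: TF_simps left_mult_def split: list.split)

lemma left_mult_carrier: "u \<in> carrier TF \<Longrightarrow> left_mult i u \<in> carrier TF"
proof -
  assume u: "u \<in> carrier TF"
  have "{w. left_mult i u w \<noteq> (\<lambda>q. 0)} \<subseteq> (#) i ` {w. u w \<noteq> (\<lambda>q. 0)}"
  proof
    fix w assume "w \<in> {w. left_mult i u w \<noteq> (\<lambda>q. 0)}"
    then show "w \<in> (#) i ` {w. u w \<noteq> (\<lambda>q. 0)}" by (cases w) (auto simp: left_mult_def split: if_splits)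
  qed
  then have "finite {w. left_mult i u w \<noteq> (\<lambda>q. 0)}"
    using u finite_subset[OF _ finite_imageI] by (auto simp: TF_simps)
  moreover have "left_mult i u w \<in> smooth_functions R U" for w
    using u smooth_fun_zero by (auto simp: left_mult_def TF_simps split: list.split)
  ultimately show ?thesis by (simp add: TF_simps)
qed

text \<open>Parallel sections act from the right, so left multiplication only changes
  \<open>a\<close> into \<open>shift i a\<close> in a generator.\<close>

lemma left_mult_Bal: "u \<in> Bal \<Longrightarrow> left_mult i u \<in> Bal"
proof -
  have "Bal \<subseteq> {u \<in> carrier TF. left_mult i u \<in> Bal}" (is "_ \<subseteq> ?W")
    unfolding Bal_eq
  proof (rule T.lin_span_minimal)
    have "left_mult i (\<lambda>w q. 0) = (\<lambda>w q. 0)" by (auto intro!: ext simp: left_mult_def split: list.split)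
    then have "left_mult i \<zero>\<^bsub>TF\<^esub> = \<zero>\<^bsub>TF\<^esub>" unfolding TF_simps .
    then show "T.csubspace {u \<in> carrier TF. left_mult i u \<in> lin_span TF Gen}"
      using T.csubspace_lin_span[OF Gen_carrier]
      unfolding T.csubspace_def by (simp add: left_mult_linear)
    show "Gen \<subseteq> {u \<in> carrier TF. left_mult i u \<in> lin_span TF Gen}"
    proof
      fix u assume "u \<in> Gen"
      then obtain a b X g where u: "u = gen a b X g" "a \<in> tensors" "X \<in> parallel_sections R"
        "value_at c p h X b" "g \<in> smooth_functions R U" unfolding Gen_def by blast
      have "left_mult i u = gen (shift i a) b X g"
        unfolding u(1) gen_eq left_mult_linear left_mult_pure tensor_mult_shift ..
      moreover have "gen (shift i a) b X g \<in> Gen" unfolding Gen_def using u shift_tensors by blast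
      ultimately have "left_mult i u \<in> lin_span TF Gen" using T.lin_span_base Gen_carrier by auto
      then show "u \<in> {u \<in> carrier TF. left_mult i u \<in> lin_span TF Gen}"
        using gen_carrier[OF u(2-5)] u(1) by simp
    qed
  qed
  then show "u \<in> Bal \<Longrightarrow> left_mult i u \<in> Bal" by blast
qed

abbreviation act where "act \<equiv> S_act R c p h U"

lemma act_cl: "u \<in> carrier TF \<Longrightarrow> act i (Q.cl u) = Q.cl (left_mult i u)"
  unfolding S_act_def
  by (rule Q.quotient_map_cl) (auto intro: left_mult_carrier left_mult_Bal simp: left_mult_linear)

definition e :: "sign list \<Rightarrow> sign list \<Rightarrow> 'a \<Rightarrow> complex" where
  "e w = pure_tensor (single w) f"

lemma e_carrier: "e w \<in> carrier TF"
  unfolding e_def by (rule pure_carrier[OF single_tensor f])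

lemma cl_e_carrier: "Q.cl (e w) \<in> carrier SS"
  unfolding SS_Q Q.Q_carrier using e_carrier by blast

lemma S_vec_e: "S_vec R c p h U f = Q.cl (e [])"
  unfolding S_vec_def e_def ..

lemma act_e: "act i (Q.cl (e w)) = Q.cl (e (i # w))"
proof -
  have "shift i (single w) = single (i # w)"
    by (rule ext) (auto simp: shift_def split: list.split)
  then show ?thesis unfolding act_cl[OF e_carrier] unfolding e_def left_mult_pure by simp
qed

lemma act_word_e: "foldr act w (Q.cl (e v)) = Q.cl (e (w @ v))"
  by (induction w) (simp_all add: act_e)

lemma act_zero: "act i \<zero>\<^bsub>SS\<^esub> = \<zero>\<^bsub>SS\<^esub>"
proof -
  have "left_mult i \<zero>\<^bsub>TF\<^esub> = \<zero>\<^bsub>TF\<^esub>"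
    by (auto intro!: ext simp: left_mult_def TF_simps split: list.split)
  then show ?thesis unfolding SS_Q Q.Q_zero using act_cl[of "\<zero>\<^bsub>TF\<^esub>" i] by simp
qed

text \<open>A balanced end is the value of a parallel section; it moves across the tensor sign and
  acts on the eigenfunction by a scalar.\<close>

lemma e_append_balanced:
  assumes b: "balanced b" shows "\<exists>k. Q.cl (e (w @ b)) = k \<odot>\<^bsub>SS\<^esub> Q.cl (e w)"
proof -
  obtain X k where X: "X \<in> parallel_sections R" "value_at c p h X (single b)" "par_act R U X f = (\<lambda>q. k * f q)"
    using eigen[OF b] by blast
  have "gen (single w) (single b) X f \<in> Gen" unfolding Gen_def using X single_tensor f by blast
  then have "gen (single w) (single b) X f \<in> Bal" unfolding Bal_eq using T.lin_span_base Gen_carrier by blast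
  moreover have "gen (single w) (single b) X f = e (w @ b) \<ominus>\<^bsub>TF\<^esub> (k \<odot>\<^bsub>TF\<^esub> e w)"
    unfolding T.minus_eq Q.neg_sm[OF T.sm_closed[OF e_carrier]]
    by (intro ext) (simp add: gen_def TF_simps e_def pure_tensor_def tensor_mult_single X(3))
  ultimately have "Q.cl (e (w @ b)) = Q.cl (k \<odot>\<^bsub>TF\<^esub> e w)"
    by (subst Q.cl_eq_iff) (auto intro: e_carrier)
  then show ?thesis unfolding SS_Q using Q.Q_sm[OF e_carrier] by metis
qed

section \<open>Functionals separating the reduced words\<close>

lemma Dq_zero: "Dq w (\<lambda>q. 0) = 0"
  using Dq_sm[OF smooth_fun_zero, of w 0] by simp

definition psi :: "sign list \<Rightarrow> sign list \<Rightarrow> ('a \<Rightarrow> complex) \<Rightarrow> complex" where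
  "psi v w g = (if take (length v) w = v \<and> balanced (drop (length v) w) then Dq (drop (length v) w) g else 0)"

text \<open>For reduced \<open>v\<close> this functional separates \<open>v \<otimes> f\<close> from the other reduced words.\<close>
definition phi :: "sign list \<Rightarrow> (sign list \<Rightarrow> 'a \<Rightarrow> complex) \<Rightarrow> complex" where
  "phi v u = (\<Sum>w | u w \<noteq> (\<lambda>q. 0). psi v w (u w))"

lemma phi_sum:
  assumes "finite A" "\<And>w. u w \<noteq> (\<lambda>q. 0) \<Longrightarrow> w \<in> A"
  shows "phi v u = (\<Sum>w\<in>A. psi v w (u w))"
  unfolding phi_def
  by (rule sum.mono_neutral_left) (use assms in \<open>auto simp: psi_def Dq_zero\<close>)

lemma psi_add: "g \<in> smooth_functions R U \<Longrightarrow> g' \<in> smooth_functions R U \<Longrightarrow>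
    psi v w (\<lambda>q. g q + g' q) = psi v w g + psi v w g'"
  by (simp add: psi_def Dq_add)

lemma psi_sm: "g \<in> smooth_functions R U \<Longrightarrow> psi v w (\<lambda>q. k * g q) = k * psi v w g"
  by (simp add: psi_def Dq_sm)

lemma phi_add:
  assumes x: "x \<in> carrier TF" and y: "y \<in> carrier TF"
  shows "phi v (x \<oplus>\<^bsub>TF\<^esub> y) = phi v x + phi v y"
proof -
  let ?A = "{w. x w \<noteq> (\<lambda>q. 0)} \<union> {w. y w \<noteq> (\<lambda>q. 0)}"
  have A: "finite ?A" using x y by (simp add: TF_simps)
  have "phi v (x \<oplus>\<^bsub>TF\<^esub> y) = (\<Sum>w\<in>?A. psi v w ((x \<oplus>\<^bsub>TF\<^esub> y) w))"
    by (rule phi_sum[OF A]) (auto simp: TF_simps fun_eq_iff)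
  also have "\<dots> = (\<Sum>w\<in>?A. psi v w (x w)) + (\<Sum>w\<in>?A. psi v w (y w))"
    using x y by (simp add: TF_simps psi_add sum.distrib)
  also have "\<dots> = phi v x + phi v y"
    using phi_sum[OF A, of x v] phi_sum[OF A, of y v] by auto
  finally show ?thesis .
qed

lemma phi_sm:
  assumes x: "x \<in> carrier TF" shows "phi v (k \<odot>\<^bsub>TF\<^esub> x) = k * phi v x"
proof -
  let ?A = "{w. x w \<noteq> (\<lambda>q. 0)}"
  have A: "finite ?A" using x by (simp add: TF_simps)
  have "phi v (k \<odot>\<^bsub>TF\<^esub> x) = (\<Sum>w\<in>?A. psi v w ((k \<odot>\<^bsub>TF\<^esub> x) w))"
    by (rule phi_sum[OF A]) (auto simp: TF_simps fun_eq_iff)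
  also have "\<dots> = k * phi v x"
    using x by (simp add: TF_simps psi_sm phi_def sum_distrib_left)
  finally show ?thesis .
qed

lemma phi_pure:
  assumes A: "finite A" "\<And>w. a w \<noteq> 0 \<Longrightarrow> w \<in> A" and g: "g \<in> smooth_functions R U"
  shows "phi v (pure_tensor a g) = (\<Sum>w\<in>A. a w * psi v w g)"
proof -
  have "phi v (pure_tensor a g) = (\<Sum>w\<in>A. psi v w (pure_tensor a g w))"
  proof (rule phi_sum[OF A(1)])
    fix w assume "pure_tensor a g w \<noteq> (\<lambda>q. 0)"
    then have "a w \<noteq> 0" by (auto simp: pure_tensor_def fun_eq_iff)
    then show "w \<in> A" by (rule A(2))
  qed
  also have "\<dots> = (\<Sum>w\<in>A. a w * psi v w g)"
    unfolding pure_tensor_def by (simp add: psi_sm[OF g])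
  finally show ?thesis .
qed

text \<open>By \<open>reduced_prefix_append\<close>, whether a word starts with \<open>v\<close> and
  continues with a balanced word is unaffected by a balanced \<open>y\<close> behind it. So both
  terms of the generator contribute for the same \<open>x\<close>, and there \<open>Dq_par\<close>
  makes them equal.\<close>

lemma phi_gen:
  assumes v: "reduced v" and a: "a \<in> tensors" and X: "X \<in> parallel_sections R"
    and b: "value_at c p h X b" and g: "g \<in> smooth_functions R U"
  shows "phi v (gen a b X g) = 0"
proof -
  have bt: "b \<in> tensors" using b unfolding value_at_def by blast
  let ?A = "{w. a w \<noteq> 0}" and ?B = "{w. b w \<noteq> 0}"
  have fin: "finite ?A" "finite ?B" using a bt unfolding tensors_def by auto
  let ?C = "{w. tensor_mult a b w \<noteq> 0} \<union> (\<lambda>(x, y). x @ y) ` (?A \<times> ?B)"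
  have C: "finite ?C" using tensor_mult_closed[OF a bt] fin unfolding tensors_def by simp
  have Xg: "par_act R U X g \<in> smooth_functions R U" by (rule par_smooth[OF X b g])
  have psi_par: "psi v x (par_act R U X g) = (\<Sum>y\<in>?B. b y * psi v (x @ y) g)" for x
  proof -
    have "(\<Sum>y\<in>?B. b y * psi v (x @ y) g)
      = (\<Sum>y\<in>?B. if take (length v) x = v \<and> balanced (drop (length v) x) then b y * Dq (drop (length v) x @ y) g else 0)"
    proof (rule sum.cong[OF refl])
      fix y assume "y \<in> ?B"
      then have "balanced y" using value_balanced[OF X b] by blast
      note rp = reduced_prefix_append[OF v this, of x]
      show "b y * psi v (x @ y) g = (if take (length v) x = v \<and> balanced (drop (length v) x)
          then b y * Dq (drop (length v) x @ y) g else 0)"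
      proof (cases "take (length v) x = v \<and> balanced (drop (length v) x)")
        case True
        have "length (take (length v) x) = length v" using True by simp
        then have d: "drop (length v) (x @ y) = drop (length v) x @ y" by simp
        have "psi v (x @ y) g = Dq (drop (length v) (x @ y)) g"
          unfolding psi_def by (rule if_P) (simp only: rp True)
        then show ?thesis unfolding if_P[OF True] d by simp
      next
        case False
        have "psi v (x @ y) g = 0" unfolding psi_def by (rule if_not_P) (simp only: rp False not_False_eq_True)
        then show ?thesis unfolding if_not_P[OF False] by simp
      qed
    qed
    also have "\<dots> = psi v x (par_act R U X g)"
    proof (cases "take (length v) x = v \<and> balanced (drop (length v) x)")
      case True
      show ?thesis unfolding psi_def Dq_par[OF X b g] if_P[OF True] ..
    next
      case False
      show ?thesis unfolding psi_def if_not_P[OF False] by simp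
    qed
    finally show ?thesis by (rule sym)
  qed
  have "phi v (pure_tensor (tensor_mult a b) g) = (\<Sum>w\<in>?C. tensor_mult a b w * psi v w g)"
    by (rule phi_pure[OF C _ g]) simp
  also have "\<dots> = (\<Sum>w\<in>?C. \<Sum>x\<in>?A. \<Sum>y\<in>?B. (if x @ y = w then a x * b y else 0) * psi v w g)"
    unfolding tensor_mult_eq[OF fin] sum_distrib_right ..
  also have "\<dots> = (\<Sum>x\<in>?A. \<Sum>w\<in>?C. \<Sum>y\<in>?B. (if x @ y = w then a x * b y else 0) * psi v w g)"
    by (rule sum.swap)
  also have "\<dots> = (\<Sum>x\<in>?A. \<Sum>y\<in>?B. \<Sum>w\<in>?C. (if x @ y = w then a x * b y else 0) * psi v w g)"
    by (rule sum.cong[OF refl]) (rule sum.swap)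
  also have "\<dots> = (\<Sum>x\<in>?A. \<Sum>y\<in>?B. a x * b y * psi v (x @ y) g)"
  proof (intro sum.cong refl)
    fix x y assume "x \<in> ?A" "y \<in> ?B"
    then have "x @ y \<in> ?C" by force
    moreover have "(\<Sum>w\<in>?C. (if x @ y = w then a x * b y else 0) * psi v w g)
      = (\<Sum>w\<in>?C. if w = x @ y then a x * b y * psi v (x @ y) g else 0)"
      by (intro sum.cong refl) auto
    ultimately show "(\<Sum>w\<in>?C. (if x @ y = w then a x * b y else 0) * psi v w g) = a x * b y * psi v (x @ y) g"
      using C by (simp add: sum.delta)
  qed
  also have "\<dots> = (\<Sum>x\<in>?A. a x * psi v x (par_act R U X g))"
    unfolding psi_par by (simp add: sum_distrib_left mult.assoc)
  also have "\<dots> = phi v (pure_tensor a (par_act R U X g))"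
    by (rule phi_pure[OF fin(1) _ Xg, symmetric]) simp
  finally have "phi v (pure_tensor (tensor_mult a b) g) = phi v (pure_tensor a (par_act R U X g))" .
  moreover note c1 = pure_carrier[OF tensor_mult_closed[OF a bt] g] and c2 = pure_carrier[OF a Xg]
  ultimately show ?thesis
    unfolding gen_eq phi_add[OF c1 T.sm_closed[OF c2]] phi_sm[OF c2] by simp
qed

lemma phi_Bal:
  assumes "reduced v" "u \<in> Bal" shows "phi v u = 0"
proof (rule T.functional_vanishes[of "phi v"])
  show "phi v x = 0" if "x \<in> Gen" for x using that phi_gen[OF assms(1)] unfolding Gen_def by blast
  show "u \<in> lin_span TF Gen" using assms(2) unfolding Bal_eq .
qed (auto intro: phi_add phi_sm Gen_carrier[THEN subsetD])

text \<open>A reduced word that continues \<open>v\<close> by a balanced word is \<open>v\<close>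
  itself.\<close>

lemma phi_e:
  assumes "reduced v" "reduced w" shows "phi v (e w) = (if w = v then Dq [] f else 0)"
proof -
  have "phi v (e w) = psi v w f"
    unfolding e_def by (subst phi_pure[of "{w}"]) (auto simp: f split: if_splits)
  moreover have "w = v" if "take (length v) w = v" "balanced (drop (length v) w)"
  proof -
    have "w = take (length v) w @ drop (length v) w" by simp
    then have w: "w = v @ drop (length v) w" unfolding that(1) .
    have "reduced (v @ drop (length v) w)" by (simp only: w[symmetric] assms(2))
    then have "drop (length v) w = []" by (rule reduced_suffix) (rule that(2))
    then show ?thesis using w by (simp only: append_Nil2)
  qed
  ultimately show ?thesis unfolding psi_def by (auto simp: balanced_def)
qed

end

section \<open>Interpolation of the mode numbers\<close>

text \<open>For t = 1, ..., N the coefficients (t-1 choose m-1) with m \<le> N form a unitriangular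
  matrix. The value t = 0 belongs to zero modes; there (-1 choose m-1) is a sign, in particular
  nonzero.\<close>

lemma gbinomial_interpolation:
  fixes \<gamma> :: "nat \<Rightarrow> complex"
  shows "\<exists>\<kappa>. \<forall>t\<le>N. (\<Sum>m = 1..Suc N. \<kappa> m * ((of_int (int t - 1) :: complex) gchoose (m - 1))) = \<gamma> t"
proof -
  define b where "b m t = ((of_int (int t - 1) :: complex) gchoose (m - 1))" for m t
  have b0: "b m t = 0" if "1 \<le> t" "t < m" for m t
  proof -
    have "of_int (int t - 1) = (of_nat (t - 1) :: complex)" using that by (simp add: of_nat_diff)
    then have "b m t = of_nat ((t - 1) choose (m - 1))" unfolding b_def by (simp add: binomial_gbinomial)
    then show ?thesis using that by (simp add: binomial_eq_0)
  qed
  have b1: "b t t = 1" if "1 \<le> t" for t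
  proof -
    have eq: "of_int (int t - 1) = (of_nat (t - 1) :: complex)" using that by (simp add: of_nat_diff)
    have "b t t = of_nat (t - 1) gchoose (t - 1)" unfolding b_def eq ..
    also have "\<dots> = of_nat ((t - 1) choose (t - 1))" by (rule binomial_gbinomial[symmetric])
    finally show ?thesis by simp
  qed
  have bz: "b m 0 \<noteq> 0" for m
  proof -
    have "(of_nat (m - 1) gchoose (m - 1)) = (1 :: complex)"
      using binomial_gbinomial[of "m - 1" "m - 1", where ?'a = complex] by simp
    then show ?thesis
      unfolding b_def using gbinomial_minus[of "1::complex" "m - 1"] by simp
  qed
  have "\<exists>\<kappa>. \<forall>t\<in>{1..n}. (\<Sum>m = 1..n. \<kappa> m * b m t) = \<gamma> t" for n
  proof (induction n)
    case (Suc n)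
    then obtain \<kappa> where \<kappa>: "\<And>t. t \<in> {1..n} \<Longrightarrow> (\<Sum>m = 1..n. \<kappa> m * b m t) = \<gamma> t" by blast
    define \<kappa>' where "\<kappa>' = \<kappa>(Suc n := \<gamma> (Suc n) - (\<Sum>m = 1..n. \<kappa> m * b m (Suc n)))"
    have s: "(\<Sum>m = 1..Suc n. \<kappa>' m * b m t) = (\<Sum>m = 1..n. \<kappa> m * b m t) + \<kappa>' (Suc n) * b (Suc n) t" for t
    proof -
      have "(\<Sum>m = 1..n. \<kappa>' m * b m t) = (\<Sum>m = 1..n. \<kappa> m * b m t)"
        by (intro sum.cong refl) (simp add: \<kappa>'_def)
      then show ?thesis by simp
    qed
    have "(\<Sum>m = 1..Suc n. \<kappa>' m * b m t) = \<gamma> t" if t: "t \<in> {1..Suc n}" for t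
    proof (cases "t = Suc n")
      case True
      show ?thesis unfolding s unfolding True b1[of "Suc n", simplified] by (simp add: \<kappa>'_def)
    next
      case False
      then have "t \<in> {1..n}" using t by simp
      then show ?thesis unfolding s using \<kappa>[of t] b0[of t "Suc n"] by simp
    qed
    then show ?case by blast
  qed simp
  then obtain \<kappa> where \<kappa>: "\<And>t. t \<in> {1..N} \<Longrightarrow> (\<Sum>m = 1..N. \<kappa> m * b m t) = \<gamma> t" by blast
  \<comment> \<open>The coefficient with m = N+1 vanishes at 1, ..., N, so it corrects the value at
    0 alone.\<close>
  define \<kappa>' where "\<kappa>' = \<kappa>(Suc N := (\<gamma> 0 - (\<Sum>m = 1..N. \<kappa> m * b m 0)) / b (Suc N) 0)"
  have s: "(\<Sum>m = 1..Suc N. \<kappa>' m * b m t) = (\<Sum>m = 1..N. \<kappa> m * b m t) + \<kappa>' (Suc N) * b (Suc N) t" for t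
  proof -
    have "(\<Sum>m = 1..N. \<kappa>' m * b m t) = (\<Sum>m = 1..N. \<kappa> m * b m t)"
      by (intro sum.cong refl) (simp add: \<kappa>'_def)
    then show ?thesis by simp
  qed
  have "(\<Sum>m = 1..Suc N. \<kappa>' m * b m t) = \<gamma> t" if t: "t \<le> N" for t
  proof (cases "t = 0")
    case True
    show ?thesis unfolding s unfolding True using bz[of "Suc N"] by (simp add: \<kappa>'_def)
  next
    case False
    then have "t \<in> {1..N}" using t by simp
    then show ?thesis unfolding s using \<kappa>[of t] b0[of t "Suc N"] by simp
  qed
  then show ?thesis unfolding b_def by blast
qed

text \<open>Distributivity, by which interpolation in each mode number separately gives
  interpolation in all of them.\<close>

lemma sum_bounded_lists_prod:
  fixes F :: "nat \<Rightarrow> nat \<Rightarrow> complex"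
  assumes "finite A"
  shows "(\<Sum>ms | length ms = n \<and> set ms \<subseteq> A. \<Prod>j<n. F j (ms ! j)) = (\<Prod>j<n. \<Sum>m\<in>A. F j m)"
proof (induction n arbitrary: F)
  case 0
  have "{ms :: nat list. length ms = 0 \<and> set ms \<subseteq> A} = {[]}" by auto
  then show ?case by simp
next
  case (Suc n)
  let ?L = "{ms :: nat list. length ms = n \<and> set ms \<subseteq> A}"
  have eq: "{ms. length ms = Suc n \<and> set ms \<subseteq> A} = (\<lambda>(m, ms). m # ms) ` (A \<times> ?L)"
    by (auto simp: length_Suc_conv image_def)
  have inj: "inj_on (\<lambda>(m, ms). m # ms) (A \<times> ?L)" by (auto simp: inj_on_def)
  have "(\<Sum>ms | length ms = Suc n \<and> set ms \<subseteq> A. \<Prod>j<Suc n. F j (ms ! j))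
     = (\<Sum>(m, ms)\<in>A \<times> ?L. F 0 m * (\<Prod>j<n. F (Suc j) (ms ! j)))"
    unfolding eq by (subst sum.reindex[OF inj])
      (simp add: case_prod_unfold prod.lessThan_Suc_shift del: prod.lessThan_Suc)
  also have "\<dots> = (\<Sum>m\<in>A. F 0 m) * (\<Sum>ms\<in>?L. \<Prod>j<n. F (Suc j) (ms ! j))"
    by (simp add: sum_product sum.cartesian_product)
  also have "\<dots> = (\<Prod>j<Suc n. \<Sum>m\<in>A. F j m)"
    unfolding Suc[of "\<lambda>j. F (Suc j)"] by (simp add: prod.lessThan_Suc_shift del: prod.lessThan_Suc)
  finally show ?case .
qed

section \<open>The generated module\<close>

context balanced_action
begin

context
  fixes B :: "sign \<Rightarrow> sign \<Rightarrow> complex" and l :: complex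
begin

abbreviation FF where "FF \<equiv> F_vec SS (S_vec R c p h U f)"
abbreviation am where "am \<equiv> apply_modes SS act B l"
abbreviation FSp where "FSp \<equiv> F_space SS"

lemma FF_E: "FF = F.E [] (Q.cl (e []))"
  unfolding S_vec_e by (rule F.F_vec_E)

text \<open>\<open>zip\<close> stops at the end of the shorter list, here the \<open>t\<close>, so
  exactly the signs of the negative modes are taken.\<close>

definition wmodes :: "nat list \<times> sign list \<Rightarrow> mode_word" where
  "wmodes x = zip (snd x) (fst x)"

definition wtail :: "nat list \<times> sign list \<Rightarrow> sign list" where
  "wtail x = drop (length (fst x)) (snd x)"

definition bvec :: "nat list \<times> sign list \<Rightarrow> mode_word \<Rightarrow> (sign list \<Rightarrow> 'a \<Rightarrow> complex) set" where
  "bvec x = F.E (wmodes x) (Q.cl (e (wtail x)))"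

lemma basis_indexD:
  assumes "x \<in> basis_indices"
  shows "length (fst x) \<le> length (snd x)" "\<forall>m\<in>set (fst x). 0 < m" "balanced (snd x)" "reduced (wtail x)"
    "wmodes x \<in> mode_words"
proof -
  obtain t i where x: "x = (t, i)" by (cases x)
  show a: "length (fst x) \<le> length (snd x)" and b: "\<forall>m\<in>set (fst x). 0 < m" and "balanced (snd x)"
    using assms unfolding basis_indices_def by (auto simp: balanced_def)
  show "reduced (wtail x)"
  proof (cases "x = ([], [])")
    case True
    then show ?thesis by (simp add: reduced_def wtail_def)
  next
    case False
    then have n: "\<not> balanced (drop (q - 1) i)" if "q \<in> {length t + 1..length i}" for q
      using assms that unfolding basis_indices_def x by auto
    show ?thesis unfolding reduced_def wtail_def x
    proof (intro allI impI)
      fix q assume "q < length (drop (length (fst (t, i))) (snd (t, i)))"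
      then have "\<not> balanced (drop ((length t + q + 1) - 1) i)" by (intro n) auto
      then show "\<not> balanced (drop q (drop (length (fst (t, i))) (snd (t, i))))" by (simp add: add.commute)
    qed
  qed
  show "wmodes x \<in> mode_words"
    using b unfolding mode_words_def wmodes_def by (auto dest: set_zip_rightD)
qed

text \<open>Without negative modes \<open>w\<close> is balanced and reduced, hence empty. This is
  why \<open>f\<close> is the only basis vector with k = 0.\<close>

lemma basis_indexI:
  assumes "\<forall>m\<in>set t. 0 < m" "length s = length t" "balanced (s @ w)" "reduced w"
  shows "(t, s @ w) \<in> basis_indices"
proof (cases "t = []")
  case True
  then have "w = []" using assms reduced_suffix[of "[]" w] by simp
  then show ?thesis using True assms(2) by (simp add: basis_indices_def)
next
  case False
  have "\<not> balanced (drop (q - 1) (s @ w))" if "q \<in> {length t + 1..length (s @ w)}" for q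
  proof -
    have "q - 1 - length s < length w" using that assms(2) by auto
    then have nb: "\<not> balanced (drop (q - 1 - length s) w)" using assms(4) unfolding reduced_def by blast
    have "Suc (length t) \<le> q" using that by simp
    then have "length s \<le> q - 1" using assms(2) by arith
    then have eq: "drop (q - 1) (s @ w) = drop (q - 1 - length s) w" by simp
    show ?thesis unfolding eq by (rule nb)
  qed
  then show ?thesis using assms False unfolding basis_indices_def by (auto simp: Suc_le_eq)
qed

text \<open>\<open>wmodes\<close> remembers the \<open>t\<close> and the first signs,
  \<open>wtail\<close> the remaining signs.\<close>

lemma index_inj:
  assumes "length (fst x) \<le> length (snd x)" "length (fst y) \<le> length (snd y)"
    "wmodes x = wmodes y" "wtail x = wtail y"
  shows "x = y"
proof -
  have snds: "snd z = map fst (wmodes z) @ wtail z" "fst z = map snd (wmodes z)"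
    if "length (fst z) \<le> length (snd z)" for z
  proof -
    have "map fst (wmodes z) = take (length (fst z)) (snd z)"
      unfolding wmodes_def using that by (simp add: map_fst_zip_take min_def)
    then show "snd z = map fst (wmodes z) @ wtail z" unfolding wtail_def by simp
    show "fst z = map snd (wmodes z)"
      unfolding wmodes_def using that by (simp add: map_snd_zip_take min_def)
  qed
  have "snd x = snd y" using snds(1)[OF assms(1)] snds(1)[OF assms(2)] assms(3,4) by (simp only:)
  moreover have "fst x = fst y" using snds(2)[OF assms(1)] snds(2)[OF assms(2)] assms(3) by (simp only:)
  ultimately show ?thesis by (rule prod_eqI[rotated])
qed

lemma bvec_carrier: "x \<in> basis_indices \<Longrightarrow> bvec x \<in> carrier FSp"
  unfolding bvec_def by (rule F.E_carrier[OF basis_indexD(5) cl_e_carrier])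

text \<open>The entries of \<tau> are negated mode numbers; zeros may stand anywhere and are moved
  to the right by the normal ordering.\<close>

definition tmodes :: "sign list \<Rightarrow> nat list \<Rightarrow> (sign \<times> int) list" where
  "tmodes i \<tau> = zip i (map (\<lambda>m. - int m) \<tau>)"

definition tvec :: "sign list \<Rightarrow> nat list \<Rightarrow> mode_word \<Rightarrow> (sign list \<Rightarrow> 'a \<Rightarrow> complex) set" where
  "tvec i \<tau> = am (normal_order (tmodes i \<tau>)) FF"

lemma apply_FF:
  assumes "filter (\<lambda>x. snd x > 0) xs = []"
  shows "am (normal_order xs) FF
    = F.E (map (\<lambda>x. (fst x, nat (- snd x))) (filter (\<lambda>x. snd x < 0) xs))
        (Q.cl (e (map fst (filter (\<lambda>x. snd x = 0) xs))))"
  unfolding FF_E F.apply_normal_order[where act = act, OF act_zero assms] act_word_e by simp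

lemma apply_FF_pos:
  assumes "filter (\<lambda>x. snd x > 0) xs \<noteq> []"
  shows "am (normal_order xs) FF = (\<lambda>w. \<zero>\<^bsub>SS\<^esub>)"
  unfolding FF_E by (rule F.apply_normal_order_pos[where act = act, OF act_zero assms])

lemma apply_FF_carrier: "am (normal_order xs) FF \<in> carrier FSp"
proof (cases "filter (\<lambda>x. snd x > 0) xs = []")
  case True
  show ?thesis unfolding apply_FF[OF True]
    by (rule F.E_carrier[OF _ cl_e_carrier]) (auto simp: mode_words_def)
next
  case False
  show ?thesis unfolding apply_FF_pos[OF False] F.FS_simps(2)[symmetric] by (rule F.F.zero_closed)
qed

text \<open>Negative modes already precede zero modes, so normal ordering changes nothing. The
  second equation prepares for \<open>tvec_in_GM\<close>, the first for the computations in
  \<open>S\<close>.\<close>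

lemma basis_vector_tvec:
  assumes "x \<in> basis_indices"
  shows "am (basis_modes x) FF = bvec x"
    "am (basis_modes x) FF = tvec (snd x) (fst x @ replicate (length (snd x) - length (fst x)) 0)"
proof -
  obtain t i where x: "x = (t, i)" by (cases x)
  note D = basis_indexD[OF assms, unfolded x, simplified]
  define i1 i2 where "i1 = take (length t) i" and "i2 = drop (length t) i"
  have i: "i = i1 @ i2" and l: "length i1 = length t" unfolding i1_def i2_def using D(1) by auto
  let ?n = "zip i1 (map (\<lambda>m. - int m) t)" and ?z = "zip i2 (replicate (length i2) (0::int))"
  have bm: "basis_modes x = ?n @ ?z" unfolding basis_modes_def x i by (simp add: l Let_def)
  have tm: "tmodes i (t @ replicate (length i - length t) 0) = ?n @ ?z"
    unfolding tmodes_def i by (simp add: l map_replicate_const)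
  have n: "snd y < 0" if "y \<in> set ?n" for y
  proof -
    have "snd y \<in> set (map (\<lambda>m. - int m) t)"
      using set_zip_rightD[of "fst y" "snd y" i1 "map (\<lambda>m. - int m) t"] that by simp
    then show ?thesis using D(2) by auto
  qed
  have z: "snd y = 0" if "y \<in> set ?z" for y
    using set_zip_rightD[of "fst y" "snd y" i2 "replicate (length i2) 0"] that by simp
  have "filter (\<lambda>x. snd x < 0) ?n = ?n" by (rule filter_True) (rule ballI, rule n)
  moreover have "filter (\<lambda>x. snd x < 0) ?z = []" by (rule filter_False) (intro ballI, drule z, simp)
  moreover have "filter (\<lambda>x. snd x > 0) ?n = []" by (rule filter_False) (intro ballI, drule n, simp)
  moreover have "filter (\<lambda>x. snd x > 0) ?z = []" by (rule filter_False) (intro ballI, drule z, simp)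
  moreover have "filter (\<lambda>x. snd x = 0) ?n = []" by (rule filter_False) (intro ballI, drule n, simp)
  moreover have "filter (\<lambda>x. snd x = 0) ?z = ?z" by (rule filter_True) (rule ballI, rule z)
  ultimately have neg: "filter (\<lambda>x. snd x < 0) (?n @ ?z) = ?n" and pos: "filter (\<lambda>x. snd x > 0) (?n @ ?z) = []"
    and zr: "filter (\<lambda>x. snd x = 0) (?n @ ?z) = ?z"
    by (simp_all only: filter_append append_Nil append_Nil2)
  have no: "normal_order (?n @ ?z) = ?n @ ?z"
    unfolding normal_order_def neg pos zr by simp
  show "am (basis_modes x) FF = tvec (snd x) (fst x @ replicate (length (snd x) - length (fst x)) 0)"
    unfolding tvec_def x fst_conv snd_conv tm no bm[unfolded x] ..
  have m: "map (\<lambda>x. (fst x, nat (- snd x))) ?n = zip i1 t"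
    by (rule nth_equalityI) (simp_all add: l)
  have m': "map fst ?z = i2" by simp
  have "am (?n @ ?z) FF = F.E (zip i1 t) (Q.cl (e i2))"
    using apply_FF[OF pos] unfolding no neg zr m m' .
  moreover have "zip i t = zip i1 t" unfolding i by (simp add: zip_append1 l)
  ultimately have "am (basis_modes x) FF = F.E (zip i t) (Q.cl (e i2))" unfolding bm by (simp only:)
  then show "am (basis_modes x) FF = bvec x"
    by (simp only: bvec_def wmodes_def wtail_def x fst_conv snd_conv i2_def)
qed

text \<open>Without positive modes every letter survives in the negative or the zero part, so the
  charges of these parts cancel. A balanced end of the zero part acts by a scalar; what remains has
  a reduced tail and is balanced as a whole.\<close>

lemma apply_FF_in_span:
  assumes "balanced (map fst xs)"
  shows "am (normal_order xs) FF \<in> lin_span FSp (bvec ` basis_indices)"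
proof -
  have sub: "F.F.csubspace (lin_span FSp (bvec ` basis_indices))"
    by (rule F.F.csubspace_lin_span) (use bvec_carrier in auto)
  show ?thesis
  proof (cases "filter (\<lambda>x. snd x > 0) xs = []")
    case False
    show ?thesis unfolding apply_FF_pos[OF False] F.FS_simps(2)[symmetric]
      using sub unfolding F.F.csubspace_def by blast
  next
    case True
    let ?ng = "map (\<lambda>x. (fst x, nat (- snd x))) (filter (\<lambda>x. snd x < 0) xs)"
    let ?zr = "map fst (filter (\<lambda>x. snd x = 0) xs)"
    obtain w b where wb: "?zr = w @ b" "reduced w" "balanced b" using reduced_decomposition by blast
    obtain k where k: "Q.cl (e (w @ b)) = k \<odot>\<^bsub>SS\<^esub> Q.cl (e w)" using e_append_balanced[OF wb(3)] by blast
    have "charge (map fst xs) = charge (map fst (filter (\<lambda>x. snd x < 0) xs)) + charge ?zr"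
      using True
    proof (induction xs)
      case (Cons x xs)
      then show ?case by (cases "snd x > 0"; cases "snd x = 0") (auto split: if_splits)
    qed simp
    then have "charge (map fst ?ng) + charge w = 0"
      using assms wb(3) unfolding wb(1) by (simp add: balanced_iff comp_def)
    then have bal: "balanced (map fst ?ng @ w)" by (simp add: balanced_iff)
    define x where "x = (map snd ?ng, map fst ?ng @ w)"
    have xb: "x \<in> basis_indices" unfolding x_def
      by (rule basis_indexI[OF _ _ bal wb(2)]) auto
    have "am (normal_order xs) FF = k \<odot>\<^bsub>FSp\<^esub> F.E ?ng (Q.cl (e w))"
      unfolding apply_FF[OF True] wb(1) k by (rule F.E_sm[OF cl_e_carrier])
    also have "F.E ?ng (Q.cl (e w)) = bvec x"
    proof -
      have z: "zip (map fst ys @ v) (map snd ys) = ys" for ys :: "(sign \<times> nat) list" and v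
        by (induction ys) auto
      have "wmodes x = ?ng" unfolding wmodes_def x_def fst_conv snd_conv by (rule z)
      moreover have "wtail x = w" unfolding wtail_def x_def by simp
      ultimately show ?thesis unfolding bvec_def by (simp only:)
    qed
    finally have "am (normal_order xs) FF = k \<odot>\<^bsub>FSp\<^esub> bvec x" .
    moreover have "bvec x \<in> lin_span FSp (bvec ` basis_indices)"
      by (rule F.F.lin_span_base) (use xb bvec_carrier in auto)
    ultimately show ?thesis using sub unfolding F.F.csubspace_def by simp
  qed
qed

lemma word_vertex_in_csubspace:
  assumes W: "F.F.csubspace W" and t: "\<And>\<nu>. length \<nu> = length v \<Longrightarrow> am (normal_order (zip (map fst v) \<nu>)) FF \<in> W"
  shows "word_vertex_mode SS act B l v n FF \<in> W"
  unfolding word_vertex_mode_def Let_def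
proof (rule F.F.finsum_in_csubspace[OF W])
  fix \<nu> assume "\<nu> \<in> {\<nu>. length \<nu> = length v \<and> (\<Sum>j<length v. \<nu> ! j + int (snd (v ! j))) = n + 1 \<and>
     (\<Prod>j<length v. (of_int (- (\<nu> ! j) - 1) :: complex) gchoose (snd (v ! j) - 1)) \<odot>\<^bsub>FSp\<^esub>
       am (normal_order (zip (map fst v) \<nu>)) FF \<noteq> \<zero>\<^bsub>FSp\<^esub>}"
  then have "length \<nu> = length v" by blast
  from t[OF this] show "(\<Prod>j<length v. (of_int (- (\<nu> ! j) - 1) :: complex) gchoose (snd (v ! j) - 1)) \<odot>\<^bsub>FSp\<^esub>
       am (normal_order (zip (map fst v) \<nu>)) FF \<in> W"
    using W unfolding F.F.csubspace_def by blast
qed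

lemma word_vertex_carrier: "word_vertex_mode SS act B l v n FF \<in> carrier FSp"
proof (rule word_vertex_in_csubspace)
  show "F.F.csubspace (carrier FSp)" unfolding F.F.csubspace_def by auto
qed (rule apply_FF_carrier)

lemma vertex_in_csubspace:
  assumes W: "F.F.csubspace W" and v: "\<And>w. v w \<noteq> 0 \<Longrightarrow> word_vertex_mode SS act B l w n FF \<in> W"
  shows "vertex_mode SS act B l v n FF \<in> W"
  unfolding vertex_mode_def
  by (rule F.F.finsum_in_csubspace[OF W]) (use v W in \<open>auto simp: F.F.csubspace_def\<close>)

abbreviation GM where "GM \<equiv> generated_module SS act B l FF"

lemma vertex_carrier: "vertex_mode SS act B l v n FF \<in> carrier FSp"
proof (rule vertex_in_csubspace)
  show "F.F.csubspace (carrier FSp)" unfolding F.F.csubspace_def by auto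
qed (rule word_vertex_carrier)

lemma csubspace_GM: "F.F.csubspace GM"
  unfolding generated_module_def by (rule F.F.csubspace_lin_span) (use vertex_carrier in auto)

lemma GM_subset: "GM \<subseteq> lin_span FSp (bvec ` basis_indices)"
  unfolding generated_module_def
proof (rule F.F.lin_span_minimal)
  show sub: "F.F.csubspace (lin_span FSp (bvec ` basis_indices))"
    by (rule F.F.csubspace_lin_span) (use bvec_carrier in auto)
  show "{vertex_mode SS act B l v n FF | v n. v \<in> V_elements} \<subseteq> lin_span FSp (bvec ` basis_indices)"
  proof
    fix u assume "u \<in> {vertex_mode SS act B l v n FF | v n. v \<in> V_elements}"
    then obtain v n where u: "u = vertex_mode SS act B l v n FF" "v \<in> V_elements" by blast
    show "u \<in> lin_span FSp (bvec ` basis_indices)" unfolding u(1)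
    proof (rule vertex_in_csubspace[OF sub], rule word_vertex_in_csubspace[OF sub])
      fix w and \<nu> :: "int list" assume w: "v w \<noteq> 0" "length \<nu> = length w"
      have "balanced (map fst w)" using u(2) w(1) unfolding V_elements_def by blast
      then have "balanced (map fst (zip (map fst w) \<nu>))" using w(2) by simp
      then show "am (normal_order (zip (map fst w) \<nu>)) FF \<in> lin_span FSp (bvec ` basis_indices)"
        by (rule apply_FF_in_span)
    qed
  qed
qed

lemma word_vertex_in_GM:
  assumes "w \<in> mode_words" "balanced (map fst w)"
  shows "word_vertex_mode SS act B l w n FF \<in> GM"
proof -
  have s: "{v. (if v = w then 1 else 0 :: complex) \<noteq> 0} = {w}" by auto
  have "vertex_mode SS act B l (\<lambda>v. if v = w then 1 else 0) n FF = word_vertex_mode SS act B l w n FF"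
    unfolding vertex_mode_def s
    by (subst F.F.finsum_single[of "{w}" w]) (auto simp: word_vertex_carrier F.F.one_sm)
  moreover have "(\<lambda>v. if v = w then 1 else 0) \<in> V_elements"
    unfolding V_elements_def mem_Collect_eq s using assms by simp
  then have "vertex_mode SS act B l (\<lambda>v. if v = w then 1 else 0) n FF \<in> GM"
    unfolding generated_module_def
    by (intro F.F.lin_span_base vertex_carrier) blast
  ultimately show ?thesis by simp
qed

text \<open>The operators \<open>v\<^sub>n\<close> with \<open>v = h\<^bsub>i\<^sub>1\<^esub>(-m\<^sub>1)\<dots>h\<^bsub>i\<^sub>r\<^esub>(-m\<^sub>r)1\<close> give the sums of the \<open>tvec i \<tau>\<close> over all \<open>\<tau>\<close> of a fixed
  total \<open>N\<close> with coefficients \<open>\<Prod>\<^sub>j (\<tau>\<^sub>j - 1 choose m\<^sub>j - 1)\<close>. For varying \<open>m\<close> these coefficients span all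
  functions of \<open>\<tau>\<close>, so each \<open>tvec i \<tau>\<close> is reached.\<close>
lemma tvec_in_GM:
  assumes i: "balanced i" and \<tau>0: "length \<tau>0 = length i"
  shows "tvec i \<tau>0 \<in> GM"
proof -
  define r where "r = length i"
  define N where "N = sum_list \<tau>0"
  \<comment> \<open>The fixed total bounds every entry by \<open>N\<close>, so interpolation on 0,
    ..., N suffices.\<close>
  define \<Omega> where "\<Omega> = {\<tau>. length \<tau> = r \<and> sum_list \<tau> = N}"
  have le: "\<tau> ! j \<le> N" if "\<tau> \<in> \<Omega>" "j < r" for \<tau> j
    using that elem_le_sum_list[of j \<tau>] unfolding \<Omega>_def by simp
  have "\<Omega> \<subseteq> {\<tau>. set \<tau> \<subseteq> {..N} \<and> length \<tau> = r}"
    unfolding \<Omega>_def using member_le_sum_list by auto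
  then have fin: "finite \<Omega>" using finite_lists_length_eq[of "{..N}" r] finite_subset by blast
  have tc: "tvec i \<tau> \<in> carrier FSp" for \<tau> unfolding tvec_def by (rule apply_FF_carrier)
  define comb where "comb \<gamma> = finsum FSp (\<lambda>\<tau>. \<gamma> \<tau> \<odot>\<^bsub>FSp\<^esub> tvec i \<tau>) \<Omega>" for \<gamma> :: "nat list \<Rightarrow> complex"
  have comb_add: "comb (\<lambda>\<tau>. \<gamma> \<tau> + \<gamma>' \<tau>) = comb \<gamma> \<oplus>\<^bsub>FSp\<^esub> comb \<gamma>'" for \<gamma> \<gamma>'
    unfolding comb_def using tc by (simp add: F.F.add_sm F.F.finsum_addf)
  have comb_sm: "comb (\<lambda>\<tau>. k * \<gamma> \<tau>) = k \<odot>\<^bsub>FSp\<^esub> comb \<gamma>" for k \<gamma>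
    unfolding comb_def using tc by (subst F.F.sm_finsum[OF fin]) (auto simp: F.F.sm_sm)
  have comb_zero: "comb (\<lambda>\<tau>. 0) = \<zero>\<^bsub>FSp\<^esub>"
    unfolding comb_def using tc by simp
  let ?b = "\<lambda>m t. (of_int (int t - 1) :: complex) gchoose (m - 1)"
  have comb_word: "comb (\<lambda>\<tau>. \<Prod>j<r. ?b (ms ! j) (\<tau> ! j)) \<in> GM"
    if ms: "length ms = r" "set ms \<subseteq> {1..Suc N}" for ms
  proof -
    define v where "v = zip i ms"
    have v: "length v = r" "map fst v = i" "\<And>j. j < r \<Longrightarrow> snd (v ! j) = ms ! j"
      using ms unfolding v_def r_def by auto
    have vm: "v \<in> mode_words" using ms(2) unfolding mode_words_def v_def by (fastforce dest: set_zip_rightD)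
    \<comment> \<open>In \<open>v_n\<close> the mode numbers and the \<open>ms\<close> together add
      up to n+1, so with this \<open>n\<close> the mode numbers have sum -N.\<close>
    define n where "n = - int N - 1 + (\<Sum>j<r. int (ms ! j))"
    let ?term = "\<lambda>\<nu>. (\<Prod>j<length v. (of_int (- (\<nu> ! j) - 1) :: complex) gchoose (snd (v ! j) - 1))
        \<odot>\<^bsub>FSp\<^esub> am (normal_order (zip (map fst v) \<nu>)) FF"
    let ?S = "{\<nu>. length \<nu> = length v \<and> (\<Sum>j<length v. \<nu> ! j + int (snd (v ! j))) = n + 1 \<and> ?term \<nu> \<noteq> \<zero>\<^bsub>FSp\<^esub>}"
    let ?g = "map (\<lambda>m. - int m) :: nat list \<Rightarrow> int list"
    have "inj (\<lambda>m. - int m)" by (simp add: inj_def)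
    then have "inj ?g" by (rule inj_mapI)
    then have inj: "inj_on ?g \<Omega>" by (rule inj_on_subset[OF _ subset_UNIV])
    have sub: "?S \<subseteq> ?g ` \<Omega>"
    proof
      fix \<nu> assume a: "\<nu> \<in> ?S"
      then have len: "length \<nu> = r" and sm: "(\<Sum>j<length v. \<nu> ! j + int (snd (v ! j))) = n + 1" using v by auto
      \<comment> \<open>A positive mode number kills \<open>f\<close>, so a surviving \<nu> is the
        negative of a list of natural numbers.\<close>
      have "filter (\<lambda>x. snd x > 0) (zip i \<nu>) = []"
      proof (rule ccontr)
        assume "filter (\<lambda>x. snd x > 0) (zip i \<nu>) \<noteq> []"
        then have "am (normal_order (zip (map fst v) \<nu>)) FF = \<zero>\<^bsub>FSp\<^esub>"
          unfolding v(2) F.FS_simps(2) by (rule apply_FF_pos)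
        then show False using a by simp
      qed
      then have np: "\<nu> ! j \<le> 0" if j: "j < r" for j
      proof -
        have "zip i \<nu> ! j \<in> set (zip i \<nu>)" by (rule nth_mem) (use j len in \<open>simp add: r_def\<close>)
        with \<open>filter (\<lambda>x. snd x > 0) (zip i \<nu>) = []\<close> have "\<not> snd (zip i \<nu> ! j) > 0"
          unfolding filter_empty_conv by blast
        then show ?thesis using j len by (simp add: r_def)
      qed
      define \<tau> where "\<tau> = map (\<lambda>x. nat (- x)) \<nu>"
      have g: "?g \<tau> = \<nu>" unfolding \<tau>_def using np len by (intro nth_equalityI) auto
      have "(\<Sum>j<r. \<nu> ! j) = - int N"
        using sm v unfolding n_def by (simp add: sum.distrib)
      moreover have "int (sum_list \<tau>) = (\<Sum>j<r. - (\<nu> ! j))"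
        unfolding sum_list_sum_nth \<tau>_def using np len by (simp add: atLeast0LessThan)
      ultimately have "sum_list \<tau> = N" by (simp add: sum_negf)
      moreover have "length \<tau> = r" unfolding \<tau>_def using len by simp
      ultimately show "\<nu> \<in> ?g ` \<Omega>" unfolding \<Omega>_def using g by blast
    qed
    \<comment> \<open>Lists from \<Omega> have the right length and total, so only a vanishing term
      can keep them out of \<open>?S\<close>.\<close>
    have zero: "?term \<nu> = \<zero>\<^bsub>FSp\<^esub>" if nu: "\<nu> \<in> ?g ` \<Omega> - ?S" for \<nu>
    proof -
      obtain \<tau> where \<tau>: "\<tau> \<in> \<Omega>" "\<nu> = ?g \<tau>" using nu by blast
      have len: "length \<nu> = length v" using \<tau> v unfolding \<Omega>_def by simp
      have "(\<Sum>j<r. int (\<tau> ! j)) = int (sum_list \<tau>)"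
        unfolding sum_list_sum_nth using \<tau>(1) unfolding \<Omega>_def by (simp add: atLeast0LessThan)
      then have s: "(\<Sum>j<r. int (\<tau> ! j)) = int N" using \<tau>(1) unfolding \<Omega>_def by simp
      have "(\<Sum>j<length v. \<nu> ! j + int (snd (v ! j))) = (\<Sum>j<r. - int (\<tau> ! j) + int (ms ! j))"
        using \<tau> v unfolding \<Omega>_def by (intro sum.cong) auto
      also have "\<dots> = n + 1" unfolding n_def by (simp add: sum_subtractf sum.distrib sum_negf s)
      finally show ?thesis using nu len by blast
    qed
    have termc: "?term \<nu> \<in> carrier FSp" for \<nu> by (intro F.F.sm_closed apply_FF_carrier)
    have "word_vertex_mode SS act B l v n FF = finsum FSp ?term ?S"
      unfolding word_vertex_mode_def Let_def ..
    also have "\<dots> = finsum FSp ?term (?g ` \<Omega>)"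
    proof (rule F.F.add.finprod_mono_neutral_cong_left)
      show "finite (?g ` \<Omega>)" using fin by simp
      show "?S \<subseteq> ?g ` \<Omega>" by (rule sub)
      show "?term \<in> ?g ` \<Omega> \<rightarrow> carrier FSp" using termc by blast
    qed (rule zero, assumption, rule refl)
    also have "\<dots> = finsum FSp (\<lambda>\<tau>. ?term (?g \<tau>)) \<Omega>"
      by (rule F.F.finsum_reindex[OF _ inj]) (rule Pi_I, rule termc)
    also have "\<dots> = comb (\<lambda>\<tau>. \<Prod>j<r. ?b (ms ! j) (\<tau> ! j))"
      unfolding comb_def
    proof (rule F.F.finsum_cong'[OF refl])
      fix \<tau> assume \<tau>: "\<tau> \<in> \<Omega>"
      have "(\<Prod>j<length v. (of_int (- (?g \<tau> ! j) - 1) :: complex) gchoose (snd (v ! j) - 1))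
         = (\<Prod>j<r. ?b (ms ! j) (\<tau> ! j))"
        using \<tau> v unfolding \<Omega>_def by (intro prod.cong) auto
      then show "?term (?g \<tau>) = (\<Prod>j<r. ?b (ms ! j) (\<tau> ! j)) \<odot>\<^bsub>FSp\<^esub> tvec i \<tau>"
        unfolding tvec_def tmodes_def v(2) by (simp only:)
    next
      show "(\<lambda>\<tau>. (\<Prod>j<r. ?b (ms ! j) (\<tau> ! j)) \<odot>\<^bsub>FSp\<^esub> tvec i \<tau>) \<in> \<Omega> \<rightarrow> carrier FSp"
        by (intro Pi_I F.F.sm_closed tc)
    qed
    finally have "word_vertex_mode SS act B l v n FF = comb (\<lambda>\<tau>. \<Prod>j<r. ?b (ms ! j) (\<tau> ! j))" .
    moreover have "word_vertex_mode SS act B l v n FF \<in> GM"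
      by (rule word_vertex_in_GM[OF vm]) (simp only: v(2) i)
    ultimately show ?thesis by (simp only:)
  qed
  \<comment> \<open>For each position \<open>j\<close> the indicator of the value
    \<open>\<tau>0 ! j\<close> is interpolated; the product over \<open>j\<close> is the indicator
    of \<tau>0 on \<Omega>.\<close>
  have "\<forall>j. \<exists>\<kappa>. \<forall>t\<le>N. (\<Sum>m = 1..Suc N. \<kappa> m * ?b m t) = (if t = \<tau>0 ! j then 1 else 0)"
    by (intro allI gbinomial_interpolation)
  from choice[OF this] obtain \<kappa> where
    "\<forall>j. \<forall>t\<le>N. (\<Sum>m = 1..Suc N. \<kappa> j m * ?b m t) = (if t = \<tau>0 ! j then 1 else 0)" ..
  then have \<kappa>: "(\<Sum>m = 1..Suc N. \<kappa> j m * ?b m t) = (if t = \<tau>0 ! j then 1 else 0)" if "t \<le> N" for j t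
    using that by (simp only:)
  let ?L = "{ms :: nat list. length ms = r \<and> set ms \<subseteq> {1..Suc N}}"
  have finL: "finite ?L" using finite_lists_length_eq[of "{1..Suc N}" r] by (simp add: conj_commute)
  have sums: "comb (\<lambda>\<tau>. \<Sum>ms\<in>L. k ms * (\<Prod>j<r. ?b (ms ! j) (\<tau> ! j))) \<in> GM"
    if "finite L" "L \<subseteq> ?L" for L and k :: "nat list \<Rightarrow> complex"
    using that
  proof (induction L)
    case empty
    show ?case using csubspace_GM comb_zero unfolding F.F.csubspace_def by simp
  next
    case (insert ms L)
    have gm_add: "x \<oplus>\<^bsub>FSp\<^esub> y \<in> GM" if "x \<in> GM" "y \<in> GM" for x y
      using csubspace_GM that unfolding F.F.csubspace_def by simp
    have gm_sm: "j \<odot>\<^bsub>FSp\<^esub> x \<in> GM" if "x \<in> GM" for j x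
      using csubspace_GM that unfolding F.F.csubspace_def by simp
    have ms: "length ms = r" "set ms \<subseteq> {1..Suc N}" using insert.prems by auto
    have "comb (\<lambda>\<tau>. k ms * (\<Prod>j<r. ?b (ms ! j) (\<tau> ! j))) \<in> GM"
      unfolding comb_sm by (rule gm_sm[OF comb_word[OF ms]])
    moreover have "comb (\<lambda>\<tau>. \<Sum>ms\<in>L. k ms * (\<Prod>j<r. ?b (ms ! j) (\<tau> ! j))) \<in> GM"
      by (rule insert.IH) (use insert.prems in simp)
    ultimately have "comb (\<lambda>\<tau>. k ms * (\<Prod>j<r. ?b (ms ! j) (\<tau> ! j))
        + (\<Sum>ms\<in>L. k ms * (\<Prod>j<r. ?b (ms ! j) (\<tau> ! j)))) \<in> GM"
      unfolding comb_add by (rule gm_add)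
    then show ?case unfolding sum.insert[OF insert.hyps] .
  qed
  have delta: "(\<Sum>ms\<in>?L. (\<Prod>j<r. \<kappa> j (ms ! j)) * (\<Prod>j<r. ?b (ms ! j) (\<tau> ! j))) = (if \<tau> = \<tau>0 then 1 else 0)"
    if \<tau>: "\<tau> \<in> \<Omega>" for \<tau>
  proof -
    have "(\<Sum>ms\<in>?L. (\<Prod>j<r. \<kappa> j (ms ! j)) * (\<Prod>j<r. ?b (ms ! j) (\<tau> ! j)))
       = (\<Prod>j<r. \<Sum>m = 1..Suc N. \<kappa> j m * ?b m (\<tau> ! j))"
      unfolding prod.distrib[symmetric]
      by (rule sum_bounded_lists_prod[where F = "\<lambda>j m. \<kappa> j m * ?b m (\<tau> ! j)"]) simp
    also have "\<dots> = (\<Prod>j<r. if \<tau> ! j = \<tau>0 ! j then 1 else 0)"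
    proof (rule prod.cong[OF refl])
      fix j assume "j \<in> {..<r}"
      then have "\<tau> ! j \<le> N" using le[OF \<tau>] by simp
      then show "(\<Sum>m = 1..Suc N. \<kappa> j m * ?b m (\<tau> ! j)) = (if \<tau> ! j = \<tau>0 ! j then 1 else 0)" by (rule \<kappa>)
    qed
    also have "\<dots> = (if \<tau> = \<tau>0 then 1 else 0)"
    proof (cases "\<tau> = \<tau>0")
      case False
      then obtain j where "j < r" "\<tau> ! j \<noteq> \<tau>0 ! j"
        using \<tau> \<tau>0 nth_equalityI[of \<tau> \<tau>0] unfolding \<Omega>_def r_def by auto
      then have "(\<Prod>j<r. if \<tau> ! j = \<tau>0 ! j then 1 else 0 :: complex) = 0"
        by (intro prod_zero) auto
      with False show ?thesis by simp
    qed simp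
    finally show ?thesis .
  qed
  have \<tau>0\<Omega>: "\<tau>0 \<in> \<Omega>" using \<tau>0 unfolding \<Omega>_def r_def N_def by simp
  have "comb (\<lambda>\<tau>. \<Sum>ms\<in>?L. (\<Prod>j<r. \<kappa> j (ms ! j)) * (\<Prod>j<r. ?b (ms ! j) (\<tau> ! j)))
     = finsum FSp (\<lambda>\<tau>. (if \<tau> = \<tau>0 then 1 else 0) \<odot>\<^bsub>FSp\<^esub> tvec i \<tau>) \<Omega>"
    unfolding comb_def
  proof (rule F.F.finsum_cong'[OF refl])
    show "(\<lambda>\<tau>. (if \<tau> = \<tau>0 then 1 else 0) \<odot>\<^bsub>FSp\<^esub> tvec i \<tau>) \<in> \<Omega> \<rightarrow> carrier FSp"
      by (intro Pi_I F.F.sm_closed tc)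
  qed (simp only: delta)
  also have "\<dots> = (if \<tau>0 = \<tau>0 then 1 else 0) \<odot>\<^bsub>FSp\<^esub> tvec i \<tau>0"
    by (rule F.F.finsum_single[OF fin \<tau>0\<Omega>]) (use tc in auto)
  also have "\<dots> = tvec i \<tau>0" using tc by (simp add: F.F.one_sm)
  finally have "comb (\<lambda>\<tau>. \<Sum>ms\<in>?L. (\<Prod>j<r. \<kappa> j (ms ! j)) * (\<Prod>j<r. ?b (ms ! j) (\<tau> ! j))) = tvec i \<tau>0" .
  then show ?thesis using sums[OF finL subset_refl, of "\<lambda>ms. \<Prod>j<r. \<kappa> j (ms ! j)"] by (simp only:)
qed

lemma basis_span: "lin_span FSp (bvec ` basis_indices) = GM"
proof
  show "lin_span FSp (bvec ` basis_indices) \<subseteq> GM"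
  proof (rule F.F.lin_span_minimal[OF csubspace_GM], rule image_subsetI)
    fix x assume x: "x \<in> basis_indices"
    show "bvec x \<in> GM"
      unfolding basis_vector_tvec(1)[OF x, symmetric] basis_vector_tvec(2)[OF x]
      by (rule tvec_in_GM) (use basis_indexD[OF x] in auto)
  qed
qed (rule GM_subset)

text \<open>The coefficient at one mode word is a relation between reduced words in
  \<open>S\<close>. The functional of the tail of \<open>x\<close> isolates \<open>k x\<close>,
  since mode word and tail determine the index, and multiplies it by a nonzero value of
  \<open>f\<close>.\<close>

lemma basis_independent:
  assumes A: "finite A" "A \<subseteq> basis_indices" and z: "finsum FSp (\<lambda>x. k x \<odot>\<^bsub>FSp\<^esub> bvec x) A = \<zero>\<^bsub>FSp\<^esub>"
    and x: "x \<in> A"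
  shows "k x = 0"
proof -
  let ?m = "wmodes x" and ?v = "wtail x"
  have red: "reduced (wtail y)" if "y \<in> A" for y using basis_indexD(4) A(2) that by blast
  \<comment> \<open>Evaluating at the word \<open>?m\<close> keeps only the indices that share
    it.\<close>
  let ?k = "\<lambda>y. if wmodes y = ?m then k y else 0"
  have bc: "bvec y \<in> carrier FSp" if "y \<in> A" for y using bvec_carrier A(2) that by blast
  have "finsum SS (\<lambda>y. (k y \<odot>\<^bsub>FSp\<^esub> bvec y) ?m) A = \<zero>\<^bsub>SS\<^esub>"
    using F.FS_finsum_apply[OF A(1), of "\<lambda>y. k y \<odot>\<^bsub>FSp\<^esub> bvec y" ?m] bc
    unfolding z by (auto simp: F.FS_simps(2) F.F.sm_closed)
  moreover have "finsum SS (\<lambda>y. (k y \<odot>\<^bsub>FSp\<^esub> bvec y) ?m) A = finsum SS (\<lambda>y. Q.cl (?k y \<odot>\<^bsub>TF\<^esub> e (wtail y))) A"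
  proof (rule F.S.finsum_cong'[OF refl])
    show "(\<lambda>y. Q.cl (?k y \<odot>\<^bsub>TF\<^esub> e (wtail y))) \<in> A \<rightarrow> carrier SS"
      unfolding SS_Q Q.Q_carrier using e_carrier by auto
    show "(k y \<odot>\<^bsub>FSp\<^esub> bvec y) ?m = Q.cl (?k y \<odot>\<^bsub>TF\<^esub> e (wtail y))" for y
    proof (cases "wmodes y = ?m")
      case True
      then have "(k y \<odot>\<^bsub>FSp\<^esub> bvec y) ?m = k y \<odot>\<^bsub>SS\<^esub> Q.cl (e (wtail y))"
        unfolding F.FS_simps(4) bvec_def F.E_def by simp
      also have "\<dots> = Q.cl (k y \<odot>\<^bsub>TF\<^esub> e (wtail y))" unfolding SS_Q by (rule Q.Q_sm[OF e_carrier])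
      finally show ?thesis using True by simp
    next
      case False
      then have "?m \<noteq> wmodes y" by auto
      then have "(k y \<odot>\<^bsub>FSp\<^esub> bvec y) ?m = \<zero>\<^bsub>SS\<^esub>"
        unfolding F.FS_simps(4) bvec_def F.E_def by simp
      then show ?thesis using False e_carrier unfolding SS_Q Q.Q_zero by simp
    qed
  qed
  moreover have "\<dots> = Q.cl (finsum TF (\<lambda>y. ?k y \<odot>\<^bsub>TF\<^esub> e (wtail y)) A)"
    unfolding SS_Q by (rule Q.Q_finsum[OF A(1)]) (use e_carrier in auto)
  ultimately have "Q.cl (finsum TF (\<lambda>y. ?k y \<odot>\<^bsub>TF\<^esub> e (wtail y)) A) = Bal"
    unfolding SS_Q Q.Q_zero Q.cl_zero by simp
  moreover have ec: "(\<lambda>y. ?k y \<odot>\<^bsub>TF\<^esub> e (wtail y)) \<in> A \<rightarrow> carrier TF" using e_carrier by auto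
  ultimately have "finsum TF (\<lambda>y. ?k y \<odot>\<^bsub>TF\<^esub> e (wtail y)) A \<in> Bal"
    using Q.cl_N[OF T.finsum_closed[OF ec]] by simp
  then have "0 = phi ?v (finsum TF (\<lambda>y. ?k y \<odot>\<^bsub>TF\<^esub> e (wtail y)) A)"
    using phi_Bal[OF red[OF x]] by simp
  also have "\<dots> = (\<Sum>y\<in>A. phi ?v (?k y \<odot>\<^bsub>TF\<^esub> e (wtail y)))"
    by (rule T.functional_finsum[OF phi_add phi_sm A(1) ec])
  also have "\<dots> = (\<Sum>y\<in>A. if y = x then k x * Dq [] f else 0)"
  proof (rule sum.cong[OF refl])
    fix y assume y: "y \<in> A"
    have "wmodes y = ?m \<and> wtail y = ?v \<longleftrightarrow> y = x"
      using index_inj[of y x] basis_indexD(1) A(2) x y by blast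
    then show "phi ?v (?k y \<odot>\<^bsub>TF\<^esub> e (wtail y)) = (if y = x then k x * Dq [] f else 0)"
      unfolding phi_sm[OF e_carrier] phi_e[OF red[OF x] red[OF y]] by auto
  qed
  also have "\<dots> = k x * Dq [] f" using A(1) x by simp
  finally show ?thesis using Dq_f by simp
qed

lemma basis_theorem: "lin_basis FSp basis_indices (\<lambda>x. am (basis_modes x) FF) GM"
proof -
  have im: "(\<lambda>x. am (basis_modes x) FF) ` basis_indices = bvec ` basis_indices"
    by (rule image_cong[OF refl]) (rule basis_vector_tvec(1))
  show ?thesis unfolding lin_basis_def im
  proof (intro conjI allI impI)
    show "bvec ` basis_indices \<subseteq> carrier FSp" using bvec_carrier by blast
    show "lin_span FSp (bvec ` basis_indices) = GM" by (rule basis_span)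
    fix A k assume a: "finite A \<and> A \<subseteq> basis_indices \<and> finsum FSp (\<lambda>x. k x \<odot>\<^bsub>FSp\<^esub> am (basis_modes x) FF) A = \<zero>\<^bsub>FSp\<^esub>"
    have "finsum FSp (\<lambda>x. k x \<odot>\<^bsub>FSp\<^esub> am (basis_modes x) FF) A = finsum FSp (\<lambda>x. k x \<odot>\<^bsub>FSp\<^esub> bvec x) A"
      by (rule F.F.finsum_cong'[OF refl]) (use a bvec_carrier basis_vector_tvec(1) in auto)
    then show "\<forall>x\<in>A. k x = 0" using basis_independent[of A k] a by simp
  qed
qed

end

end

theorem corollary4p12:
  fixes R :: "('a::{t2_space,second_countable_topology}) riem"
    and K :: real and c :: "'a chart" and p :: 'a and e1 e2 :: "real^2"
    and U :: "'a set" and f :: "'a \<Rightarrow> complex" and l :: complex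
  assumes "riemannian_surface R" and "connected (UNIV :: 'a set)"
    and "geodesically_complete R" and "orientable R"
    and "constant_curvature R K" and "K \<noteq> 0"
    and "c \<in> atlas R" and "p \<in> fst c" and "orthonormal_basis R c p e1 e2"
    and "open U" and "eigenfunction R U f" and "l \<noteq> 0"
  shows "let h = hvec e1 e2;
             S = S_space R c p h U;
             act = S_act R c p h U;
             B = (\<lambda>i j. bilinear_metric R c p (h i) (h j));
             F = F_vec S (S_vec R c p h U f)
         in lin_basis (F_space S) basis_indices
              (\<lambda>x. apply_modes S act B l (basis_modes x) F)
              (generated_module S act B l F)"
proof -
  obtain Dq where "balanced_action R c p (hvec e1 e2) U f Dq"
    using geometric_action[OF assms(1,2,4-11)] by blast
  then interpret balanced_action R c p "hvec e1 e2" U f Dq .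
  show ?thesis unfolding Let_def by (rule basis_theorem)
qed

end
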